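(* Let $k$ be a field of characteristic $0$. For every dg $k$-algebra $(A,\phi)$ there is a convergent spectral sequence $E$ calculating $HC^*_{dg}(A)$ such that there is a morphism of spectral sequences $f:E\to{}_cE$, where ${}_cE$ is the characteristic spectral sequence of $A$ converging to $HH^*_{dg}(A)$.
   Context: **Dgas.** A dg $k$-algebra (dga) $(A,\phi)$ is a unital associative graded $k$-algebra $A=\bigoplus_{m\ge 0}A^m$ with a $k$-linear map $\phi$ lowering degree by one such that $\phi^2=0$ and $\phi(xy)=\phi(x)y+(-1)^{|x|}x\phi(y)$, where $|x|$ is the degree of a homogeneous element. $(A^{\otimes n})^m$ is the total-degree-$m$ part of $A^{\otimes n}$, and $\phi^{\otimes n}$ denotes the induced differential $\phi^{\otimes n}(a_1\otimes\dots\otimes a_n)=\sum_i(-1)^{|a_1|+\dots+|a_{i-1}|}a_1\otimes\dots\otimes\phi(a_i)\otimes\dots\otimes a_n$. For $n,m\ge 0$ put $C^n(A)^m=\mathrm{Hom}_k((A^{\otimes n+1})^m,k)$. **Operators** (on homogeneous $a_i$, with $\gamma_n=|a_n|(|a_0|+\dots+|a_{n-1}|)$): $\delta:C^n(A)^m\to C^n(A)^{m+1}$, $\delta f=(-1)^mf\circ\phi^{\otimes n+1}$; $b:C^{n-1}(A)^m\to C^n(A)^m$, $b(f)(a_0\otimes\dots\otimes a_n)=\sum_{i=0}^{n-1}(-1)^if(a_0\otimes\dots\otimes a_ia_{i+1}\otimes\dots\otimes a_n)+(-1)^{n+\gamma_n}f(a_na_0\otimes a_1\otimes\dots\otimes a_{n-1})$;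 $\Lambda:C^n(A)^m\to C^n(A)^m$, $\Lambda f(a_0\otimes\dots\otimes a_n)=(-1)^{n+\gamma_n}f(a_n\otimes a_0\otimes\dots\otimes a_{n-1})$. **Hochschild cohomology.** $EH(A)^{p,q}=C^p(A)^q$; $\mathcal T(EH(A))^n=\bigoplus_{p+q=n}C^p(A)^q$ with differential $d=b+(-1)^p\delta$ on $C^p(A)^q$; $HH^n_{dg}(A)=H^n(\mathcal T(EH(A)))$. The characteristic spectral sequence ${}_cE$ is the spectral sequence of the vertical filtration $F^s\mathcal T(EH(A))^n=\bigoplus_{p+q=n,\,p\ge s}EH(A)^{p,q}$; it converges to $HH^*_{dg}(A)$. **Cyclic cohomology.** $C^n_\Lambda(A)^m=\ker(\mathbf 1-\Lambda)\subset C^n(A)^m$. The operators $b,\delta$ restrict to these subspaces, and $\mathcal T(C_\Lambda(A))^n=\bigoplus_{p+q=n}C_\Lambda^p(A)^q$ with differential $d=b+(-1)^p\delta$. $HC^n_{dg}(A)=H^n(\mathcal T(C_\Lambda(A)))$. A spectral sequence "calculates $HC^*_{dg}(A)$" if it converges to $HC^*_{dg}(A)$: $E_\infty^{p,q}\simeq F^pHC^{p+q}_{dg}(A)/F^{p+1}HC^{p+q}_{dg}(A)$ for some filtration that is finite in each degree. A morphism of spectral sequences is a family of maps $f_r^{p,q}:E_r^{p,q}\to{}_cE_r^{p,q}$ commuting with $d_r$ and with $f_{r+1}$ induced by $f_r$ on cohomology. *)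

theory Defs
  imports
    "HOL-Algebra.Algebraic_Closure_Type"
    "HOL-Algebra.Module"
    "HOL-Library.Function_Algebras"
begin

text \<open>
  The ground field is a type \<open>'k\<close> of class \<open>field\<close>, and \<open>ring_of_type_algebra\<close> is the
  associated ring record.  Abstract \<open>k\<close>-vector spaces (quotients, cohomology, pages of spectral
  sequences) are modules in the sense of \<open>HOL-Algebra\<close> over this ring; the ring
  multiplication and unit that a \<^typ>\<open>('k, 'v) module\<close> record carries are meaningless for them
  and left unspecified.
\<close>

section \<open>Vector spaces\<close>

definition linear_hom :: "('k::field, 'v) module \<Rightarrow> ('k, 'w) module \<Rightarrow> ('v \<Rightarrow> 'w) set" where
  "linear_hom M N = {h \<in> carrier M \<rightarrow> carrier N.
     (\<forall>x\<in>carrier M. \<forall>y\<in>carrier M. h (x \<oplus>\<^bsub>M\<^esub> y) = h x \<oplus>\<^bsub>N\<^esub> h y) \<and>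
     (\<forall>c. \<forall>x\<in>carrier M. h (c \<odot>\<^bsub>M\<^esub> x) = c \<odot>\<^bsub>N\<^esub> h x)}"

definition linear_iso :: "('k::field, 'v) module \<Rightarrow> ('k, 'w) module \<Rightarrow> ('v \<Rightarrow> 'w) set" where
  "linear_iso M N = {h \<in> linear_hom M N. bij_betw h (carrier M) (carrier N)}"

text \<open>The quotient of \<open>M\<close> by a submodule \<open>N\<close>; its elements are the cosets \<open>N + x\<close>.\<close>

definition quot_module :: "('k::field, 'v) module \<Rightarrow> 'v set \<Rightarrow> ('k, 'v set) module" where
  "quot_module M N =
     \<lparr>carrier = a_rcosets\<^bsub>M\<^esub> N, monoid.mult = undefined, one = undefined,
      zero = N, add = set_add M, module.smult = (\<lambda>c U. \<Union>x\<in>U. N +>\<^bsub>M\<^esub> (c \<odot>\<^bsub>M\<^esub> x))\<rparr>"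

definition module_of :: "('k::field \<Rightarrow> 'v::ab_group_add \<Rightarrow> 'v) \<Rightarrow> 'v set \<Rightarrow> ('k, 'v) module" where
  "module_of s V =
     \<lparr>carrier = V, monoid.mult = undefined, one = undefined, zero = 0, add = (+), module.smult = s\<rparr>"

text \<open>Cohomology at \<open>M\<close> of a sequence \<open>L \<rightarrow> M \<rightarrow> N\<close> with maps \<open>f\<close> and \<open>g\<close>, \<open>g \<circ> f = 0\<close>.\<close>

definition cohomology_at ::
  "('k::field, 'u) module \<Rightarrow> ('u \<Rightarrow> 'v) \<Rightarrow> ('k, 'v) module \<Rightarrow> ('v \<Rightarrow> 'w) \<Rightarrow> ('k, 'w) module
     \<Rightarrow> ('k, 'v set) module" where
  "cohomology_at L f M g N =
     quot_module (M\<lparr>carrier := {x \<in> carrier M. g x = \<zero>\<^bsub>N\<^esub>}\<rparr>) (f ` carrier L)"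

definition complex_cohomology ::
  "(int \<Rightarrow> ('k::field, 'v) module) \<Rightarrow> (int \<Rightarrow> 'v \<Rightarrow> 'v) \<Rightarrow> int \<Rightarrow> ('k, 'v set) module" where
  "complex_cohomology M d n = cohomology_at (M (n - 1)) (d (n - 1)) (M n) (d n) (M (n + 1))"


section \<open>Cohomological spectral sequences\<close>

text \<open>
  The pages \<open>E\<^sub>r\<^sup>p\<^sup>q\<close> are indexed by \<open>r \<ge> 0\<close> and integers \<open>p\<close>, \<open>q\<close>; \<open>ss_next E r p q\<close> is the
  isomorphism from the cohomology of the \<open>r\<close>-th page at \<open>(p, q)\<close> to \<open>E\<^sub>r\<^sub>+\<^sub>1\<^sup>p\<^sup>q\<close>, which is
  part of the data.
\<close>

record ('k, 'e) spectral_seq =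
  ss_page :: "nat \<Rightarrow> int \<Rightarrow> int \<Rightarrow> ('k, 'e) module"
  ss_diff :: "nat \<Rightarrow> int \<Rightarrow> int \<Rightarrow> 'e \<Rightarrow> 'e"
  ss_next :: "nat \<Rightarrow> int \<Rightarrow> int \<Rightarrow> 'e set \<Rightarrow> 'e"

definition ss_boundaries ::
  "('k::field, 'e) spectral_seq \<Rightarrow> nat \<Rightarrow> int \<Rightarrow> int \<Rightarrow> 'e set" where
  "ss_boundaries E r p q =
     ss_diff E r (p - int r) (q + int r - 1) ` carrier (ss_page E r (p - int r) (q + int r - 1))"

definition ss_cohomology ::
  "('k::field, 'e) spectral_seq \<Rightarrow> nat \<Rightarrow> int \<Rightarrow> int \<Rightarrow> ('k, 'e set) module" where
  "ss_cohomology E r p q = cohomology_at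
     (ss_page E r (p - int r) (q + int r - 1)) (ss_diff E r (p - int r) (q + int r - 1))
     (ss_page E r p q) (ss_diff E r p q)
     (ss_page E r (p + int r) (q - int r + 1))"

definition spectral_sequence :: "('k::field, 'e) spectral_seq \<Rightarrow> bool" where
  "spectral_sequence E \<longleftrightarrow> (\<forall>r p q.
     module ring_of_type_algebra (ss_page E r p q) \<and>
     ss_diff E r p q \<in> linear_hom (ss_page E r p q) (ss_page E r (p + int r) (q - int r + 1)) \<and>
     (\<forall>x\<in>carrier (ss_page E r p q).
        ss_diff E r (p + int r) (q - int r + 1) (ss_diff E r p q x)
          = \<zero>\<^bsub>ss_page E r (p + int r + int r) (q - int r + 1 - int r + 1)\<^esub>) \<and>
     ss_next E r p q \<in> linear_iso (ss_cohomology E r p q) (ss_page E (Suc r) p q))"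

text \<open>
  A morphism is a family of linear maps that commutes with the differentials and for which
  \<open>f\<^sub>r\<^sub>+\<^sub>1\<close> corresponds to the map \<open>[x] \<mapsto> [f\<^sub>r x]\<close> on cohomology.
\<close>

definition ss_morphism ::
  "('k::field, 'e) spectral_seq \<Rightarrow> ('k, 'h) spectral_seq
     \<Rightarrow> (nat \<Rightarrow> int \<Rightarrow> int \<Rightarrow> 'e \<Rightarrow> 'h) \<Rightarrow> bool" where
  "ss_morphism E E' f \<longleftrightarrow> (\<forall>r p q.
     f r p q \<in> linear_hom (ss_page E r p q) (ss_page E' r p q) \<and>
     (\<forall>x\<in>carrier (ss_page E r p q).
        f r (p + int r) (q - int r + 1) (ss_diff E r p q x) = ss_diff E' r p q (f r p q x)) \<and>
     (\<forall>x\<in>carrier (ss_page E r p q).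
        ss_diff E r p q x = \<zero>\<^bsub>ss_page E r (p + int r) (q - int r + 1)\<^esub> \<longrightarrow>
        f (Suc r) p q (ss_next E r p q (ss_boundaries E r p q +>\<^bsub>ss_page E r p q\<^esub> x))
          = ss_next E' r p q (ss_boundaries E' r p q +>\<^bsub>ss_page E' r p q\<^esub> f r p q x)))"

text \<open>
  From page \<open>r\<^sub>0\<close> on, all differentials leaving and entering position \<open>(p, q)\<close> vanish, so
  that \<open>E\<^sub>\<infinity>\<^sup>p\<^sup>q = E\<^sub>r\<^sup>p\<^sup>q\<close> for all \<open>r \<ge> r\<^sub>0\<close> (via \<open>ss_next\<close>).
\<close>

definition ss_stable_from ::
  "('k::field, 'e) spectral_seq \<Rightarrow> int \<Rightarrow> int \<Rightarrow> nat \<Rightarrow> bool" where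
  "ss_stable_from E p q r0 \<longleftrightarrow> (\<forall>r\<ge>r0.
     (\<forall>x\<in>carrier (ss_page E r p q).
        ss_diff E r p q x = \<zero>\<^bsub>ss_page E r (p + int r) (q - int r + 1)\<^esub>) \<and>
     ss_boundaries E r p q \<subseteq> {\<zero>\<^bsub>ss_page E r p q\<^esub>})"

definition finite_filtration :: "('k::field, 'v) module \<Rightarrow> (int \<Rightarrow> 'v set) \<Rightarrow> bool" where
  "finite_filtration H F \<longleftrightarrow>
     (\<forall>s. submodule (F s) ring_of_type_algebra H) \<and>
     (\<forall>s. F (s + 1) \<subseteq> F s) \<and>
     (\<exists>s. F s = carrier H) \<and> (\<exists>s. F s = {\<zero>\<^bsub>H\<^esub>})"

definition ss_converges_to ::
  "('k::field, 'e) spectral_seq \<Rightarrow> (int \<Rightarrow> ('k, 'v) module) \<Rightarrow> bool" where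
  "ss_converges_to E H \<longleftrightarrow> (\<exists>F.
     (\<forall>n. finite_filtration (H n) (F n)) \<and>
     (\<forall>p q. \<exists>r0. ss_stable_from E p q r0 \<and>
        linear_iso (ss_page E r0 p q)
          (quot_module ((H (p + q))\<lparr>carrier := F (p + q) p\<rparr>) (F (p + q) (p + 1))) \<noteq> {}))"


section \<open>The spectral sequence of a filtered complex\<close>

text \<open>
  \<open>F s n\<close> is the \<open>s\<close>-th step of a decreasing filtration of the complex \<open>(M, d)\<close> in degree \<open>n\<close>.
  With \<open>Z\<^sub>r\<^sup>p\<^sup>q = {x \<in> F\<^sup>pM\<^sup>p\<^sup>+\<^sup>q. d x \<in> F\<^sup>p\<^sup>+\<^sup>r}\<close> and
  \<open>B\<^sub>r\<^sup>p\<^sup>q = Z\<^sub>r\<^sub>-\<^sub>1\<^sup>p\<^sup>+\<^sup>1\<^sup>,\<^sup>q\<^sup>-\<^sup>1 + d Z\<^sub>r\<^sub>-\<^sub>1\<^sup>p\<^sup>-\<^sup>r\<^sup>+\<^sup>1\<^sup>,\<^sup>q\<^sup>+\<^sup>r\<^sup>-\<^sup>2\<close> one puts \<open>E\<^sub>r = Z\<^sub>r/B\<^sub>r\<close>.  The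
  parameter \<open>r\<close> of \<open>filt_cyc\<close> is an integer, since \<open>E\<^sub>0\<close> involves \<open>r - 1 = -1\<close>; this gives
  \<open>E\<^sub>0\<^sup>p\<^sup>q = F\<^sup>pM\<^sup>p\<^sup>+\<^sup>q/F\<^sup>p\<^sup>+\<^sup>1M\<^sup>p\<^sup>+\<^sup>q\<close>.
\<close>

definition filt_cyc ::
  "(int \<Rightarrow> 'v \<Rightarrow> 'v) \<Rightarrow> (int \<Rightarrow> int \<Rightarrow> 'v set) \<Rightarrow> int \<Rightarrow> int \<Rightarrow> int \<Rightarrow> 'v set" where
  "filt_cyc d F r p q = {x \<in> F p (p + q). d (p + q) x \<in> F (p + r) (p + q + 1)}"

definition filt_bdry ::
  "(int \<Rightarrow> ('k::field, 'v) module) \<Rightarrow> (int \<Rightarrow> 'v \<Rightarrow> 'v) \<Rightarrow> (int \<Rightarrow> int \<Rightarrow> 'v set)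
     \<Rightarrow> int \<Rightarrow> int \<Rightarrow> int \<Rightarrow> 'v set" where
  "filt_bdry M d F r p q =
     filt_cyc d F (r - 1) (p + 1) (q - 1)
       <+>\<^bsub>M (p + q)\<^esub> d (p + q - 1) ` filt_cyc d F (r - 1) (p - r + 1) (q + r - 2)"

text \<open>
  The differential is \<open>[x] \<mapsto> [d x]\<close>.  For a class \<open>U\<close> in the cohomology of \<open>E\<^sub>r\<close> (a set of
  cosets), \<open>\<Union>U\<close> is the set of its representatives in \<open>Z\<^sub>r\<close>; those lying in \<open>Z\<^sub>r\<^sub>+\<^sub>1\<close> represent the
  corresponding element of \<open>E\<^sub>r\<^sub>+\<^sub>1\<close>.
\<close>

definition filtration_ss ::
  "(int \<Rightarrow> ('k::field, 'v) module) \<Rightarrow> (int \<Rightarrow> 'v \<Rightarrow> 'v) \<Rightarrow> (int \<Rightarrow> int \<Rightarrow> 'v set)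
     \<Rightarrow> ('k, 'v set) spectral_seq" where
  "filtration_ss M d F =
     \<lparr>ss_page = (\<lambda>r p q. quot_module ((M (p + q))\<lparr>carrier := filt_cyc d F (int r) p q\<rparr>)
                           (filt_bdry M d F (int r) p q)),
      ss_diff = (\<lambda>r p q U. filt_bdry M d F (int r) (p + int r) (q - int r + 1)
                             <+>\<^bsub>M (p + q + 1)\<^esub> d (p + q) ` U),
      ss_next = (\<lambda>r p q U. filt_bdry M d F (int r + 1) p q
                             <+>\<^bsub>M (p + q)\<^esub> (\<Union>U \<inter> filt_cyc d F (int r + 1) p q))\<rparr>"


section \<open>Differential graded algebras\<close>

text \<open>
  The unit is a parameter, rather than \<open>1\<close> of class \<open>ring_1\<close>, because that class excludes the
  zero algebra.  The differential lowers the degree, with \<open>A\<^sup>-\<^sup>1 = 0\<close>.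
\<close>

locale dg_algebra = vector_space scale
  for scale :: "'k::field \<Rightarrow> 'a::ring \<Rightarrow> 'a" +
  fixes unit :: 'a and gr :: "nat \<Rightarrow> 'a set" and \<phi> :: "'a \<Rightarrow> 'a"
  assumes unit_left: "unit * x = x"
    and unit_right: "x * unit = x"
    and scale_mult_left: "scale c x * y = scale c (x * y)"
    and scale_mult_right: "x * scale c y = scale c (x * y)"
    and gr_subspace: "subspace (gr m)"
    and gr_direct_sum: "\<exists>!c. (\<forall>m. c m \<in> gr m) \<and> finite {m. c m \<noteq> 0} \<and> x = (\<Sum>m | c m \<noteq> 0. c m)"
    and gr_unit: "unit \<in> gr 0"
    and gr_mult: "x \<in> gr m \<Longrightarrow> y \<in> gr n \<Longrightarrow> x * y \<in> gr (m + n)"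
    and phi_linear: "Vector_Spaces.linear scale scale \<phi>"
    and phi_degree: "x \<in> gr (Suc m) \<Longrightarrow> \<phi> x \<in> gr m"
    and phi_degree_0: "x \<in> gr 0 \<Longrightarrow> \<phi> x = 0"
    and phi_phi: "\<phi> (\<phi> x) = 0"
    and leibniz: "x \<in> gr m \<Longrightarrow> \<phi> (x * y) = \<phi> x * y + scale ((-1) ^ m) (x * \<phi> y)"

text \<open>
  The tensor power \<open>A\<^sup>\<otimes>\<^sup>n\<close> is the free vector space on \<open>A\<^sup>n\<close> (lists of length \<open>n\<close>, basis vectors
  \<open>basis_vec as\<close>, inside the functions on lists) modulo the multilinearity relations.
\<close>

type_synonym ('k, 'a) tensor = "('a list \<Rightarrow> 'k) set"
type_synonym ('k, 'a) cochain = "('k, 'a) tensor \<Rightarrow> 'k"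
type_synonym ('k, 'a) total_cochain = "nat \<Rightarrow> nat \<Rightarrow> ('k, 'a) cochain"

definition fun_scale :: "'k::field \<Rightarrow> ('x \<Rightarrow> 'k) \<Rightarrow> 'x \<Rightarrow> 'k" where
  "fun_scale c f = (\<lambda>x. c * f x)"

definition basis_vec :: "'a list \<Rightarrow> 'a list \<Rightarrow> 'k::field" where
  "basis_vec as = (\<lambda>bs. if bs = as then 1 else 0)"

definition free_space :: "nat \<Rightarrow> ('a list \<Rightarrow> 'k::field) set" where
  "free_space n = Modules.module.span fun_scale {basis_vec as |as. length as = n}"

context dg_algebra
begin

definition tensor_relations :: "nat \<Rightarrow> ('a list \<Rightarrow> 'k) set" where
  "tensor_relations n = Modules.module.span fun_scale
     ({basis_vec (as[i := x + y]) - basis_vec (as[i := x]) - basis_vec (as[i := y]) |as i x y.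
         length as = n \<and> i < n} \<union>
      {basis_vec (as[i := scale c x]) - fun_scale c (basis_vec (as[i := x])) |as i c x.
         length as = n \<and> i < n})"

definition tensor_power :: "nat \<Rightarrow> ('k, ('k, 'a) tensor) module" where
  "tensor_power n = quot_module (module_of fun_scale (free_space n)) (tensor_relations n)"

definition tensor_class :: "nat \<Rightarrow> ('a list \<Rightarrow> 'k) \<Rightarrow> ('k, 'a) tensor" where
  "tensor_class n v = tensor_relations n +>\<^bsub>module_of fun_scale (free_space n)\<^esub> v"

text \<open>The pure tensor \<open>a\<^sub>0 \<otimes> a\<^sub>1 \<otimes> \<dots>\<close> of a list \<open>[a\<^sub>0, a\<^sub>1, \<dots>]\<close>.\<close>

definition tens :: "'a list \<Rightarrow> ('k, 'a) tensor" where
  "tens as = tensor_class (length as) (basis_vec as)"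

text \<open>
  The list \<open>as\<close> consists of homogeneous elements of degrees \<open>ds\<close>.  The degrees are given
  separately since \<open>0\<close> is homogeneous of every degree.
\<close>

definition homogeneous :: "nat list \<Rightarrow> 'a list \<Rightarrow> bool" where
  "homogeneous ds as \<longleftrightarrow> list_all2 (\<lambda>m a. a \<in> gr m) ds as"

definition tensor_deg :: "nat \<Rightarrow> nat \<Rightarrow> ('k, ('k, 'a) tensor) module" where
  "tensor_deg n m = (tensor_power n)\<lparr>carrier := tensor_class n `
     Modules.module.span fun_scale
       {basis_vec as |as ds. homogeneous ds as \<and> length as = n \<and> sum_list ds = m}\<rparr>"

definition tensor_diff :: "nat \<Rightarrow> ('k, 'a) tensor \<Rightarrow> ('k, 'a) tensor" where
  "tensor_diff n = (THE L.
     L \<in> linear_hom (tensor_power n) (tensor_power n) \<and>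
     L \<in> extensional (carrier (tensor_power n)) \<and>
     (\<forall>ds as. homogeneous ds as \<and> length as = n \<longrightarrow>
        L (tens as) = (\<Oplus>\<^bsub>tensor_power n\<^esub>i\<in>{..<n}.
          (-1) ^ sum_list (take i ds) \<odot>\<^bsub>tensor_power n\<^esub> tens (as[i := \<phi> (as ! i)]))))"

text \<open>
  \<open>C\<^sup>n(A)\<^sup>m = Hom((A\<^sup>\<otimes>\<^sup>n\<^sup>+\<^sup>1)\<^sup>m, k)\<close>.  Functionals are extended by \<open>0\<close> outside the carrier, so that
  the vector space operations are the pointwise ones.
\<close>

definition cochains :: "nat \<Rightarrow> nat \<Rightarrow> ('k, 'a) cochain set" where
  "cochains n m = {f.
     f \<in> linear_hom (tensor_deg (n + 1) m) (module_of (*) UNIV) \<and>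
     (\<forall>U. U \<notin> carrier (tensor_deg (n + 1) m) \<longrightarrow> f U = 0)}"

text \<open>The operators \<open>\<delta>, b, \<Lambda>\<close> on \<open>C\<^sup>n(A)\<^sup>m\<close>; note that \<open>b\<close> maps it to \<open>C\<^sup>n\<^sup>+\<^sup>1(A)\<^sup>m\<close>.\<close>

definition delta :: "nat \<Rightarrow> nat \<Rightarrow> ('k, 'a) cochain \<Rightarrow> ('k, 'a) cochain" where
  "delta n m f = (\<lambda>U. if U \<in> carrier (tensor_deg (n + 1) (m + 1))
                      then (-1) ^ m * f (tensor_diff (n + 1) U) else 0)"

definition koszul_exp :: "nat list \<Rightarrow> nat" where
  "koszul_exp ds = last ds * sum_list (butlast ds)"

definition hochschild_b :: "nat \<Rightarrow> nat \<Rightarrow> ('k, 'a) cochain \<Rightarrow> ('k, 'a) cochain" where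
  "hochschild_b n m f = (THE g. g \<in> cochains (n + 1) m \<and>
     (\<forall>ds as. homogeneous ds as \<and> length as = n + 2 \<and> sum_list ds = m \<longrightarrow>
        g (tens as) =
          (\<Sum>i\<le>n. (-1) ^ i * f (tens (take i as @ [as ! i * as ! (i + 1)] @ drop (i + 2) as)))
          + (-1) ^ (n + 1 + koszul_exp ds) * f (tens ((last as * hd as) # butlast (tl as)))))"

definition cyclic_op :: "nat \<Rightarrow> nat \<Rightarrow> ('k, 'a) cochain \<Rightarrow> ('k, 'a) cochain" where
  "cyclic_op n m f = (THE g. g \<in> cochains n m \<and>
     (\<forall>ds as. homogeneous ds as \<and> length as = n + 1 \<and> sum_list ds = m \<longrightarrow>
        g (tens as) = (-1) ^ (n + koszul_exp ds) * f (tens (last as # butlast as))))"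

definition cyclic_cochains :: "nat \<Rightarrow> nat \<Rightarrow> ('k, 'a) cochain set" where
  "cyclic_cochains n m = {f \<in> cochains n m. f - cyclic_op n m f = 0}"

text \<open>
  Total complexes.  An element of degree \<open>n\<close> is a family \<open>x p q \<in> C\<^sup>p(A)\<^sup>q\<close> vanishing unless
  \<open>p + q = n\<close>; since \<open>p, q \<ge> 0\<close>, only finitely many components can be nonzero.
\<close>

definition total_scale ::
  "'k \<Rightarrow> ('k, 'a) total_cochain \<Rightarrow> ('k, 'a) total_cochain" where
  "total_scale c x = (\<lambda>p q U. c * x p q U)"

definition total ::
  "(nat \<Rightarrow> nat \<Rightarrow> ('k, 'a) cochain set) \<Rightarrow> int \<Rightarrow> ('k, ('k, 'a) total_cochain) module" where
  "total C n = module_of total_scale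
     {x. (\<forall>p q. x p q \<in> C p q) \<and> (\<forall>p q. int p + int q \<noteq> n \<longrightarrow> x p q = 0)}"

definition total_diff ::
  "int \<Rightarrow> ('k, 'a) total_cochain \<Rightarrow> ('k, 'a) total_cochain" where
  "total_diff n x = (\<lambda>p q.
     (if p = 0 then 0 else hochschild_b (p - 1) q (x (p - 1) q)) +
     (if q = 0 then 0 else fun_scale ((-1) ^ p) (delta p (q - 1) (x p (q - 1)))))"

definition vertical_filtration ::
  "int \<Rightarrow> int \<Rightarrow> ('k, 'a) total_cochain set" where
  "vertical_filtration s n =
     {x \<in> carrier (total cochains n). \<forall>p q. int p < s \<longrightarrow> x p q = 0}"

definition HH :: "int \<Rightarrow> ('k, ('k, 'a) total_cochain set) module" where
  "HH = complex_cohomology (total cochains) total_diff"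

definition HC :: "int \<Rightarrow> ('k, ('k, 'a) total_cochain set) module" where
  "HC = complex_cohomology (total cyclic_cochains) total_diff"

definition characteristic_ss :: "('k, ('k, 'a) total_cochain set) spectral_seq" where
  "characteristic_ss = filtration_ss (total cochains) total_diff vertical_filtration"

end

end

theory Submission
  imports Defs
begin

text \<open>
  The Hochschild cochains and the cyclic cochains form total complexes with the same
  differential, both filtered by the first index \<open>p\<close>, and in total degree \<open>n\<close> this filtration is
  finite because \<open>0 \<le> p \<le> n\<close>.  A bounded filtered complex has a spectral sequence that converges
  to its cohomology, and a map of filtered complexes induces a morphism of spectral sequences.
  So \<open>E\<close> can be taken to be the spectral sequence of the filtered cyclic complex, and \<open>f\<close> the
  morphism induced by the inclusion of the cyclic complex into the Hochschild complex; the
  lemmas are \<open>spectral_sequence_filtration\<close>, \<open>filtration_ss_converges\<close> and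
  \<open>ss_morphism_page_map\<close>.
  
  For this the two total complexes have to be complexes at all.  The identities behind that are
  \<open>b\<^sup>2 = 0\<close>, \<open>\<delta>\<^sup>2 = 0\<close> and \<open>b \<delta> = \<delta> b\<close>, together with the fact that \<open>b\<close> and \<open>\<delta>\<close> preserve the
  \<open>\<Lambda>\<close>-invariant cochains.  A cochain is the same as a function on lists of homogeneous elements
  that is linear in every entry (\<open>multilinear_val\<close>, \<open>cochain_exists\<close>, \<open>cochain_eqI\<close>).  This shows
  that the cochains \<open>b f\<close> and \<open>\<Lambda> f\<close> described by their values on pure tensors exist, and it turns
  the identities into statements about lists.  There the last summand of \<open>b\<close>, which carries the
  Koszul sign, is the composite of a cyclic rotation with the multiplication of the first two
  entries.  All identities then follow from the relations between the multiplications of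
  neighbouring entries and the rotation: the simplicial identities give \<open>b\<^sup>2 = 0\<close>, the
  multiplications and the signed rotation commute with the internal differential, and rotating
  the arguments permutes the summands of \<open>b\<close> cyclically.
\<close>

section \<open>Presented quotient spaces\<close>

text \<open>
  The spaces below are quotients of subspaces of one ambient space, but iterated ones: an element
  of the cohomology of a page is a set of cosets, and so is an element of a graded piece of
  cohomology.  Recording only a surjection \<open>\<kappa>\<close> from \<open>Y\<close> onto \<open>Q\<close> with kernel \<open>R\<close> hides this
  nesting: submodules, further quotients, linear maps and isomorphisms can all be described by
  what happens to representatives in \<open>Y\<close>.
\<close>

definition presents ::
  "('k::field \<Rightarrow> 'v::ab_group_add \<Rightarrow> 'v) \<Rightarrow> ('k, 'q) module \<Rightarrow> 'v set \<Rightarrow> 'v set \<Rightarrow> ('v \<Rightarrow> 'q) \<Rightarrow> bool"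
  where "presents s Q Y R \<kappa> \<longleftrightarrow>
    vector_space s \<and> Modules.module.subspace s Y \<and> Modules.module.subspace s R \<and> R \<subseteq> Y \<and>
    carrier Q = \<kappa> ` Y \<and> \<zero>\<^bsub>Q\<^esub> = \<kappa> 0 \<and>
    (\<forall>x\<in>Y. \<forall>y\<in>Y. \<kappa> x \<oplus>\<^bsub>Q\<^esub> \<kappa> y = \<kappa> (x + y)) \<and>
    (\<forall>c. \<forall>x\<in>Y. c \<odot>\<^bsub>Q\<^esub> \<kappa> x = \<kappa> (s c x)) \<and>
    (\<forall>x\<in>Y. \<forall>y\<in>Y. \<kappa> x = \<kappa> y \<longleftrightarrow> x - y \<in> R)"

definition coset :: "'v::ab_group_add set \<Rightarrow> 'v \<Rightarrow> 'v set" where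
  "coset R y = (\<lambda>x. x + y) ` R"

lemma mem_coset: "z \<in> coset R y \<longleftrightarrow> z - y \<in> R"
  by (force simp: coset_def)

context vector_space
begin

lemma coset_eqI:
  assumes "subspace B" "x - y \<in> B"
  shows "coset B x = coset B y"
proof -
  have "z - x \<in> B \<longleftrightarrow> z - y \<in> B" for z
    using subspace_add[OF assms(1) _ assms(2), of "z - x"]
      subspace_diff[OF assms(1) _ assms(2), of "z - y"] by auto
  then show ?thesis by (auto simp: mem_coset)
qed

lemma set_add_coset:
  assumes "subspace B" "\<And>z. z \<in> U \<Longrightarrow> z - y \<in> B" "U \<noteq> {}"
  shows "{b + w |b w. b \<in> B \<and> w \<in> U} = coset B y"
proof safe
  fix b w assume "b \<in> B" "w \<in> U"
  then have "b + (w - y) \<in> B" using assms(2) by (intro subspace_add[OF assms(1)])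
  then show "b + w \<in> coset B y" by (simp add: mem_coset algebra_simps)
next
  fix x assume "x \<in> coset B y"
  moreover obtain w where w: "w \<in> U" using assms(3) by blast
  ultimately have "x - y \<in> B" "w - y \<in> B" using assms(2) by (simp_all add: mem_coset)
  from subspace_diff[OF assms(1) this] have "x = (x - w) + w \<and> x - w \<in> B" by simp
  with w show "\<exists>b w. x = b + w \<and> b \<in> B \<and> w \<in> U" by blast
qed

lemma Union_cosets:
  assumes "B \<subseteq> H" "subspace B" "subspace H"
  shows "\<Union> (coset B ` coset H y) = coset H y"
proof safe
  fix x z assume "x \<in> coset B z" "z \<in> coset H y"
  then have "(x - z) + (z - y) \<in> H"
    using assms(1) by (intro subspace_add[OF assms(3)]) (auto simp: mem_coset)
  then show "x \<in> coset H y" by (simp add: mem_coset)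
next
  fix x assume "x \<in> coset H y"
  then show "x \<in> \<Union> (coset B ` coset H y)"
    using subspace_0[OF assms(2)] by (intro UN_I[of x]) (auto simp: mem_coset)
qed

end

lemma presents_eq_zero_iff:
  assumes "presents s Q Y R \<kappa>" "y \<in> Y"
  shows "\<kappa> y = \<zero>\<^bsub>Q\<^esub> \<longleftrightarrow> y \<in> R"
proof -
  interpret vector_space s using assms(1) by (simp add: presents_def)
  have "0 \<in> Y" using assms(1) by (simp add: presents_def subspace_0)
  then show ?thesis using assms by (simp add: presents_def)
qed

lemma presents_module:
  assumes "presents s Q Y R \<kappa>"
  shows "Module.module ring_of_type_algebra Q"
proof -
  interpret vector_space s using assms by (simp add: presents_def)
  have Y: "subspace Y" and car: "carrier Q = \<kappa> ` Y" and zero: "\<zero>\<^bsub>Q\<^esub> = \<kappa> 0"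
    and add: "\<And>x y. x \<in> Y \<Longrightarrow> y \<in> Y \<Longrightarrow> \<kappa> x \<oplus>\<^bsub>Q\<^esub> \<kappa> y = \<kappa> (x + y)"
    and smult: "\<And>c x. x \<in> Y \<Longrightarrow> c \<odot>\<^bsub>Q\<^esub> \<kappa> x = \<kappa> (s c x)"
    using assms by (auto simp: presents_def)
  have Y': "0 \<in> Y" "\<And>x y. x \<in> Y \<Longrightarrow> y \<in> Y \<Longrightarrow> x + y \<in> Y" "\<And>c x. x \<in> Y \<Longrightarrow> s c x \<in> Y"
    "\<And>x. x \<in> Y \<Longrightarrow> - x \<in> Y"
    using Y by (auto simp: subspace_0 subspace_add subspace_scale subspace_neg)
  have inv: "\<exists>y\<in>carrier Q. y \<oplus>\<^bsub>Q\<^esub> x = \<zero>\<^bsub>Q\<^esub>" if "x \<in> carrier Q" for x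
  proof -
    obtain z where "z \<in> Y" "x = \<kappa> z" using \<open>x \<in> carrier Q\<close> car by blast
    then have "\<kappa> (- z) \<in> carrier Q" "\<kappa> (- z) \<oplus>\<^bsub>Q\<^esub> x = \<zero>\<^bsub>Q\<^esub>"
      using Y'(4)[of z] by (auto simp: car add zero)
    then show ?thesis by blast
  qed
  have "abelian_group Q"
    by (rule abelian_groupI[OF _ _ _ _ _ inv]) (auto simp: car zero add Y' ac_simps)
  then show ?thesis
    by (intro Module.moduleI[OF cring_from_type_algebra])
      (auto simp: car zero add smult Y' ring_of_type_algebra_def
         scale_left_distrib scale_right_distrib)
qed

lemma presents_module_of:
  assumes "vector_space s" "Modules.module.subspace s Y"
  shows "presents s (module_of s Y) Y {0} (\<lambda>y. y)"
proof -
  interpret vector_space s by fact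
  show ?thesis using assms by (auto simp: presents_def module_of_def subspace_0)
qed

lemma presents_restrict:
  assumes "presents s Q Y R \<kappa>" "Modules.module.subspace s Y'" "R \<subseteq> Y'" "Y' \<subseteq> Y"
  shows "presents s (Q\<lparr>carrier := \<kappa> ` Y'\<rparr>) Y' R \<kappa>"
  using assms unfolding presents_def by (auto simp: subset_eq)

lemma presents_coset_image:
  assumes Q: "presents s Q Y B \<kappa>" and R: "R \<subseteq> Y" and y: "y \<in> Y"
  shows "\<kappa> ` R +>\<^bsub>Q\<^esub> \<kappa> y = \<kappa> ` coset R y"
proof -
  have "\<kappa> x \<oplus>\<^bsub>Q\<^esub> \<kappa> y = \<kappa> (x + y)" if "x \<in> R" for x
    using Q R y that by (auto simp: presents_def)
  then show ?thesis by (force simp: a_r_coset_def' coset_def)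
qed

text \<open>
  The third isomorphism theorem: dividing \<open>Y/B\<close> by \<open>R/B\<close> leaves \<open>Y/R\<close>, only with nested cosets as
  elements.
\<close>

lemma presents_quot_module:
  assumes Q: "presents s Q Y B \<kappa>" and R: "Modules.module.subspace s R" "B \<subseteq> R" "R \<subseteq> Y"
  shows "presents s (quot_module Q (\<kappa> ` R)) Y R (\<lambda>y. \<kappa> ` coset R y)"
proof -
  interpret vector_space s using Q by (simp add: presents_def)
  have Y: "subspace Y" and car: "carrier Q = \<kappa> ` Y" and zero: "\<zero>\<^bsub>Q\<^esub> = \<kappa> 0"
    and add: "\<And>x y. x \<in> Y \<Longrightarrow> y \<in> Y \<Longrightarrow> \<kappa> x \<oplus>\<^bsub>Q\<^esub> \<kappa> y = \<kappa> (x + y)"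
    and smult: "\<And>c x. x \<in> Y \<Longrightarrow> c \<odot>\<^bsub>Q\<^esub> \<kappa> x = \<kappa> (s c x)"
    and eq: "\<And>x y. x \<in> Y \<Longrightarrow> y \<in> Y \<Longrightarrow> \<kappa> x = \<kappa> y \<longleftrightarrow> x - y \<in> B"
    using Q by (auto simp: presents_def)
  have Y': "0 \<in> Y" "\<And>x y. x \<in> Y \<Longrightarrow> y \<in> Y \<Longrightarrow> x + y \<in> Y" "\<And>c x. x \<in> Y \<Longrightarrow> s c x \<in> Y"
    using Y by (auto simp: subspace_0 subspace_add subspace_scale)
  have R': "0 \<in> R" "\<And>x y. x \<in> R \<Longrightarrow> y \<in> R \<Longrightarrow> x + y \<in> R" "\<And>c x. x \<in> R \<Longrightarrow> s c x \<in> R"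
    "\<And>x y. x \<in> R \<Longrightarrow> y \<in> R \<Longrightarrow> x - y \<in> R"
    using R by (auto simp: subspace_0 subspace_add subspace_scale subspace_diff)
  have XY: "\<And>x. x \<in> R \<Longrightarrow> x \<in> Y" using R by auto
  note rc = presents_coset_image[OF Q R(3)]
  have mem: "z \<in> coset R y \<Longrightarrow> y \<in> Y \<Longrightarrow> z \<in> Y" for z y
    by (auto simp: coset_def XY Y')
  have self: "y \<in> coset R y" for y by (simp add: mem_coset R')
  note shift = coset_eqI[OF R(1)]
  have add': "(\<Union>h\<in>\<kappa> ` coset R x. \<Union>k\<in>\<kappa> ` coset R y. {h \<oplus>\<^bsub>Q\<^esub> k}) = \<kappa> ` coset R (x + y)"
    if "x \<in> Y" "y \<in> Y" for x y
  proof -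
    have "(\<Union>h\<in>\<kappa> ` coset R x. \<Union>k\<in>\<kappa> ` coset R y. {h \<oplus>\<^bsub>Q\<^esub> k})
        = \<kappa> ` {a + b |a b. a \<in> coset R x \<and> b \<in> coset R y}"
      by (auto simp: add mem[OF _ that(1)] mem[OF _ that(2)])
    also have "{a + b |a b. a \<in> coset R x \<and> b \<in> coset R y} = coset R (x + y)"
    proof safe
      fix a b assume "a \<in> coset R x" "b \<in> coset R y"
      then show "a + b \<in> coset R (x + y)"
        using R'(2)[of "a - x" "b - y"] by (simp add: mem_coset algebra_simps)
    next
      fix z assume "z \<in> coset R (x + y)"
      then have "z = (z - y) + y \<and> z - y \<in> coset R x \<and> y \<in> coset R y"
        by (simp add: mem_coset R' algebra_simps)
      then show "\<exists>a b. z = a + b \<and> a \<in> coset R x \<and> b \<in> coset R y" by blast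
    qed
    finally show ?thesis .
  qed
  have smult': "(\<Union>h\<in>\<kappa> ` coset R x. \<kappa> ` R +>\<^bsub>Q\<^esub> (c \<odot>\<^bsub>Q\<^esub> h)) = \<kappa> ` coset R (s c x)"
    if "x \<in> Y" for c x
  proof -
    have "\<kappa> ` R +>\<^bsub>Q\<^esub> (c \<odot>\<^bsub>Q\<^esub> \<kappa> z) = \<kappa> ` coset R (s c x)" if z: "z \<in> coset R x" for z
    proof -
      have "s c z - s c x \<in> R"
        using z R'(3)[of "z - x" c] by (simp add: mem_coset scale_right_diff_distrib)
      then show ?thesis using mem[OF z \<open>x \<in> Y\<close>] by (simp add: smult rc Y' shift)
    qed
    then show ?thesis using self[of x] by auto
  qed
  have eq': "\<kappa> ` coset R x = \<kappa> ` coset R y \<longleftrightarrow> x - y \<in> R" if "x \<in> Y" "y \<in> Y" for x y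
  proof
    assume "\<kappa> ` coset R x = \<kappa> ` coset R y"
    then obtain z where z: "z \<in> coset R y" "\<kappa> x = \<kappa> z" using self[of x] by auto
    then have "x - z \<in> R" using eq[of x z] mem[OF z(1) that(2)] that R by auto
    then show "x - y \<in> R" using z(1) R'(2)[of "x - z" "z - y"] by (simp add: mem_coset)
  next
    assume "x - y \<in> R"
    then show "\<kappa> ` coset R x = \<kappa> ` coset R y" by (simp add: shift)
  qed
  have q_car: "carrier (quot_module Q (\<kappa> ` R)) = (\<lambda>y. \<kappa> ` coset R y) ` Y"
    by (auto simp: quot_module_def A_RCOSETS_def' car rc)
  have q_zero: "\<zero>\<^bsub>quot_module Q (\<kappa> ` R)\<^esub> = \<kappa> ` coset R 0"
    by (simp add: quot_module_def coset_def)
  have q_add: "\<kappa> ` coset R x \<oplus>\<^bsub>quot_module Q (\<kappa> ` R)\<^esub> \<kappa> ` coset R y = \<kappa> ` coset R (x + y)"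
    if "x \<in> Y" "y \<in> Y" for x y
    using add'[OF that] by (simp add: quot_module_def set_add_def')
  have q_smult: "c \<odot>\<^bsub>quot_module Q (\<kappa> ` R)\<^esub> (\<kappa> ` coset R x) = \<kappa> ` coset R (s c x)" if "x \<in> Y" for c x
    using smult'[OF that] by (simp add: quot_module_def)
  show ?thesis
    unfolding presents_def
    by (intro conjI ballI allI vector_space_axioms Y R(1,3) q_car q_zero q_add q_smult eq')
qed

lemma presents_coset:
  assumes "vector_space s" "Modules.module.subspace s Y" "Modules.module.subspace s R" "R \<subseteq> Y"
  shows "presents s (quot_module (module_of s Y) R) Y R (coset R)"
proof -
  interpret vector_space s by fact
  show ?thesis
    using presents_quot_module[OF presents_module_of[OF assms(1,2)] assms(3) _ assms(4)]
      subspace_0[OF assms(3)] by simp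
qed

text \<open>
  The second isomorphism theorem: \<open>Y/R\<close> is also \<open>Y'/(Y' \<inter> R)\<close> as soon as \<open>Y = Y' + R\<close>.  It lets two
  quotients be compared by presenting both on the same \<open>Y'\<close> with the same kernel.
\<close>

lemma presents_subpresentation:
  assumes Q: "presents s Q Y R \<kappa>" and Y': "Modules.module.subspace s Y'" "Y' \<subseteq> Y"
    and surj: "\<And>y. y \<in> Y \<Longrightarrow> \<exists>y'\<in>Y'. y - y' \<in> R"
  shows "presents s Q Y' (Y' \<inter> R) \<kappa>"
proof -
  interpret vector_space s using Q by (simp add: presents_def)
  have "\<kappa> ` Y \<subseteq> \<kappa> ` Y'"
  proof safe
    fix y assume y: "y \<in> Y"
    then obtain y' where "y' \<in> Y'" "y - y' \<in> R" using surj by blast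
    then show "\<kappa> y \<in> \<kappa> ` Y'" using Q Y' y unfolding presents_def by blast
  qed
  then have img: "\<kappa> ` Y = \<kappa> ` Y'" using Y'(2) by blast
  have "x - y \<in> Y'" if "x \<in> Y'" "y \<in> Y'" for x y
    using that Y'(1) by (rule_tac subspace_diff)
  then show ?thesis
    using Q Y' unfolding presents_def by (auto simp: subset_eq img subspace_inter)
qed

text \<open>
  The boundaries are represented already by \<open>f'(Y\<^sub>1)\<close>; adding \<open>R\<close>, which \<open>\<kappa>\<close> kills, makes the set
  of representatives a full preimage, and hence usable as the kernel of a presentation.
\<close>

lemma presents_boundaries:
  assumes L: "presents s L Y\<^sub>1 R\<^sub>1 \<kappa>\<^sub>1" and M: "presents s M Y R \<kappa>"
    and f: "\<And>y. y \<in> Y\<^sub>1 \<Longrightarrow> f (\<kappa>\<^sub>1 y) = \<kappa> (f' y)" "\<And>y. y \<in> Y\<^sub>1 \<Longrightarrow> f' y \<in> Y"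
    and B: "B = {x + f' y |x y. x \<in> R \<and> y \<in> Y\<^sub>1}"
  shows "f ` carrier L = \<kappa> ` B"
proof -
  interpret vector_space s using M by (simp add: presents_def)
  have absorb: "\<kappa> (x + f' y) = \<kappa> (f' y)" if xy: "x \<in> R" "y \<in> Y\<^sub>1" for x y
  proof -
    have "x \<in> Y" using xy M by (auto simp: presents_def)
    then have "x + f' y \<in> Y" using f(2)[OF xy(2)] M by (auto simp: presents_def intro: subspace_add)
    then have "\<kappa> (x + f' y) = \<kappa> (f' y) \<longleftrightarrow> x + f' y - f' y \<in> R"
      using M f(2)[OF xy(2)] unfolding presents_def by blast
    then show ?thesis using xy(1) by simp
  qed
  have "0 \<in> R" using M by (simp add: presents_def subspace_0)
  then have "f' y \<in> B" if "y \<in> Y\<^sub>1" for y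
    unfolding B using that by (intro CollectI exI[of _ 0] exI[of _ y]) simp
  then have "\<kappa> ` B = (\<lambda>y. \<kappa> (f' y)) ` Y\<^sub>1"
    using absorb unfolding B by (auto simp: image_iff)
  moreover have "f ` carrier L = (\<lambda>y. \<kappa> (f' y)) ` Y\<^sub>1"
    using L f(1) by (auto simp: presents_def image_image)
  ultimately show ?thesis by simp
qed

lemma presents_cohomology_at:
  assumes L: "presents s L Y\<^sub>1 R\<^sub>1 \<kappa>\<^sub>1" and M: "presents s M Y R \<kappa>" and N: "presents s N Y\<^sub>2 R\<^sub>2 \<kappa>\<^sub>2"
    and f: "\<And>y. y \<in> Y\<^sub>1 \<Longrightarrow> f (\<kappa>\<^sub>1 y) = \<kappa> (f' y)"
    and g: "\<And>y. y \<in> Y \<Longrightarrow> g (\<kappa> y) = \<kappa>\<^sub>2 (g' y)" "\<And>y. y \<in> Y \<Longrightarrow> g' y \<in> Y\<^sub>2"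
    and Z: "Z = {y \<in> Y. g' y \<in> R\<^sub>2}" "Modules.module.subspace s Z"
    and B: "B = {x + f' y |x y. x \<in> R \<and> y \<in> Y\<^sub>1}" "Modules.module.subspace s B" "B \<subseteq> Z"
    and zero: "0 \<in> Y\<^sub>1" "f' 0 = 0"
  shows "presents s (cohomology_at L f M g N) Z B (\<lambda>y. \<kappa> ` coset B y)"
proof -
  interpret vector_space s using M by (simp add: presents_def)
  have R: "R \<subseteq> B"
  proof
    fix x assume "x \<in> R"
    then show "x \<in> B" unfolding B(1) using zero by (intro CollectI exI[of _ x] exI[of _ 0]) simp
  qed
  have cycles: "{x \<in> carrier M. g x = \<zero>\<^bsub>N\<^esub>} = \<kappa> ` Z"
    using M g presents_eq_zero_iff[OF N] by (auto simp: Z presents_def)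
  have "f' y \<in> Y" if "y \<in> Y\<^sub>1" for y
  proof -
    have "0 \<in> R" using M by (simp add: presents_def subspace_0)
    with that have "0 + f' y \<in> B" unfolding B(1) by blast
    then show ?thesis using B(3) Z(1) by auto
  qed
  then have boundaries: "f ` carrier L = \<kappa> ` B" by (intro presents_boundaries[OF L M f _ B(1)])
  have "presents s (M\<lparr>carrier := \<kappa> ` Z\<rparr>) Z R \<kappa>"
    using R B(3) Z by (intro presents_restrict[OF M]) auto
  then show ?thesis
    unfolding cohomology_at_def cycles boundaries
    by (rule presents_quot_module[OF _ B(2) R B(3)])
qed

lemma presents_linear_hom:
  assumes Q: "presents s Q Y R \<kappa>" and Q': "presents s' Q' Y' R' \<kappa>'"
    and h: "\<And>y. y \<in> Y \<Longrightarrow> h (\<kappa> y) = \<kappa>' (h' y)" "\<And>y. y \<in> Y \<Longrightarrow> h' y \<in> Y'"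
    and lin: "\<And>x y. x \<in> Y \<Longrightarrow> y \<in> Y \<Longrightarrow> h' (x + y) = h' x + h' y"
      "\<And>c x. x \<in> Y \<Longrightarrow> h' (s c x) = s' c (h' x)"
  shows "h \<in> linear_hom Q Q'"
proof -
  interpret vector_space s using Q by (simp add: presents_def)
  have Y: "\<And>x y. x \<in> Y \<Longrightarrow> y \<in> Y \<Longrightarrow> x + y \<in> Y" "\<And>c x. x \<in> Y \<Longrightarrow> s c x \<in> Y"
    using Q by (auto simp: presents_def intro: subspace_add subspace_scale)
  show ?thesis
    using Q Q' unfolding linear_hom_def presents_def by (auto simp: h lin Y)
qed

lemma presents_linear_iso:
  assumes Q: "presents s Q Y R \<kappa>" and Q': "presents s Q' Y R \<kappa>'"
    and h: "\<And>y. y \<in> Y \<Longrightarrow> h (\<kappa> y) = \<kappa>' y"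
  shows "h \<in> linear_iso Q Q'"
proof -
  have "h \<in> linear_hom Q Q'" by (rule presents_linear_hom[OF Q Q', of h "\<lambda>y. y"]) (auto simp: h)
  moreover have "bij_betw h (carrier Q) (carrier Q')"
  proof -
    have "h ` \<kappa> ` Y = \<kappa>' ` Y" unfolding image_image by (rule image_cong) (simp_all add: h)
    moreover have "inj_on h (\<kappa> ` Y)"
      using Q Q' unfolding presents_def inj_on_def by (auto simp: h)
    ultimately show ?thesis using Q Q' by (simp add: presents_def bij_betw_def)
  qed
  ultimately show ?thesis by (simp add: linear_iso_def)
qed

text \<open>
  The isomorphism sends a class to the class of any of its representatives.
\<close>

lemma presents_isomorphic:
  assumes Q: "presents s Q Y R \<kappa>" and Q': "presents s Q' Y R \<kappa>'"
  shows "linear_iso Q Q' \<noteq> {}"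
proof -
  have *: "\<kappa>' (SOME x. x \<in> Y \<and> \<kappa> x = \<kappa> y) = \<kappa>' y" if y: "y \<in> Y" for y
  proof -
    have "\<exists>x. x \<in> Y \<and> \<kappa> x = \<kappa> y" using y by blast
    from someI_ex[OF this] show ?thesis using y Q Q' unfolding presents_def by metis
  qed
  have "(\<lambda>q. \<kappa>' (SOME x. x \<in> Y \<and> \<kappa> x = q)) \<in> linear_iso Q Q'"
    by (rule presents_linear_iso[OF Q Q']) (rule *)
  then show ?thesis by blast
qed

lemma presents_finsum:
  assumes Q: "presents s Q Y R \<kappa>" and "finite I" and v: "\<And>i. i \<in> I \<Longrightarrow> v i \<in> Y"
  shows "(\<Oplus>\<^bsub>Q\<^esub>i\<in>I. \<kappa> (v i)) = \<kappa> (\<Sum>i\<in>I. v i)"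
proof -
  interpret vector_space s using Q by (simp add: presents_def)
  interpret Q: Module.module ring_of_type_algebra Q by (rule presents_module[OF Q])
  show ?thesis
    using \<open>finite I\<close> v
  proof (induction I)
    case empty
    then show ?case using Q by (simp add: presents_def)
  next
    case (insert i I)
    have "(\<lambda>i. \<kappa> (v i)) \<in> I \<rightarrow> carrier Q" "\<kappa> (v i) \<in> carrier Q"
      using insert.prems Q by (auto simp: presents_def)
    then have "(\<Oplus>\<^bsub>Q\<^esub>j\<in>insert i I. \<kappa> (v j)) = \<kappa> (v i) \<oplus>\<^bsub>Q\<^esub> (\<Oplus>\<^bsub>Q\<^esub>j\<in>I. \<kappa> (v j))"
      using insert.hyps by (intro Q.finsum_insert) auto
    also have "\<dots> = \<kappa> (v i) \<oplus>\<^bsub>Q\<^esub> \<kappa> (\<Sum>j\<in>I. v j)" using insert by simp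
    also have "\<dots> = \<kappa> (\<Sum>j\<in>insert i I. v j)"
    proof -
      have "(\<Sum>j\<in>I. v j) \<in> Y" using Q insert.prems by (auto simp: presents_def intro: subspace_sum)
      then show ?thesis using Q insert by (simp add: presents_def)
    qed
    finally show ?case .
  qed
qed

lemma presents_submodule:
  assumes Q: "presents s Q Y R \<kappa>" and Y': "Modules.module.subspace s Y'" "Y' \<subseteq> Y"
  shows "submodule (\<kappa> ` Y') ring_of_type_algebra Q"
proof -
  interpret vector_space s using Q by (simp add: presents_def)
  interpret Q: Module.module ring_of_type_algebra Q by (rule presents_module[OF Q])
  have Y'': "0 \<in> Y'" "\<And>x y. x \<in> Y' \<Longrightarrow> y \<in> Y' \<Longrightarrow> x + y \<in> Y'" "\<And>c x. x \<in> Y' \<Longrightarrow> s c x \<in> Y'"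
    "\<And>x. x \<in> Y' \<Longrightarrow> - x \<in> Y'"
    using Y' by (auto simp: subspace_0 subspace_add subspace_scale subspace_neg)
  have [simp]: "x \<in> Y' \<Longrightarrow> x \<in> Y" for x using Y'(2) by blast
  show ?thesis
  proof (rule Q.submoduleI)
    fix a assume "a \<in> \<kappa> ` Y'"
    then obtain x where x: "x \<in> Y'" "a = \<kappa> x" by blast
    then have "\<kappa> (- x) \<oplus>\<^bsub>Q\<^esub> a = \<zero>\<^bsub>Q\<^esub>" "\<kappa> (- x) \<in> carrier Q" "a \<in> carrier Q"
      using Q Y''(4)[OF x(1)] unfolding presents_def by auto
    then have "\<ominus>\<^bsub>Q\<^esub> a = \<kappa> (- x)" by (simp add: Q.M.minus_equality)
    then show "\<ominus>\<^bsub>Q\<^esub> a \<in> \<kappa> ` Y'" using x Y'' by auto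
  next
    show "\<kappa> ` Y' \<subseteq> carrier Q" using Q Y'(2) by (auto simp: presents_def)
  next
    show "\<zero>\<^bsub>Q\<^esub> \<in> \<kappa> ` Y'" using Q Y''(1) by (simp add: presents_def)
  next
    fix a b assume "a \<in> \<kappa> ` Y'" "b \<in> \<kappa> ` Y'"
    then obtain x y where xy: "x \<in> Y'" "y \<in> Y'" "a = \<kappa> x" "b = \<kappa> y" by blast
    then have "a \<oplus>\<^bsub>Q\<^esub> b = \<kappa> (x + y)" using Q by (simp add: presents_def)
    then show "a \<oplus>\<^bsub>Q\<^esub> b \<in> \<kappa> ` Y'" using Y''(2)[OF xy(1,2)] by simp
  next
    fix c :: 'a and a assume "a \<in> \<kappa> ` Y'"
    then obtain x where x: "x \<in> Y'" "a = \<kappa> x" by blast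
    then have "c \<odot>\<^bsub>Q\<^esub> a = \<kappa> (s c x)" using Q by (simp add: presents_def)
    then show "c \<odot>\<^bsub>Q\<^esub> a \<in> \<kappa> ` Y'" using Y''(3)[OF x(1)] by simp
  qed
qed


section \<open>The spectral sequence of a bounded filtered complex\<close>

text \<open>
  Linearity of \<open>d n\<close> is asked on \<open>V n\<close> only, since the Hochschild operators are determined on cochains
  and take unspecified values elsewhere.
\<close>

locale filtered_complex = vector_space s
  for s :: "'k::field \<Rightarrow> 'v::ab_group_add \<Rightarrow> 'v" +
  fixes V :: "int \<Rightarrow> 'v set" and d :: "int \<Rightarrow> 'v \<Rightarrow> 'v" and F :: "int \<Rightarrow> int \<Rightarrow> 'v set"
  assumes subspace_V: "subspace (V n)"
    and d_V: "x \<in> V n \<Longrightarrow> d n x \<in> V (n + 1)"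
    and d_add: "x \<in> V n \<Longrightarrow> y \<in> V n \<Longrightarrow> d n (x + y) = d n x + d n y"
    and d_scale: "x \<in> V n \<Longrightarrow> d n (s c x) = s c (d n x)"
    and d_d: "x \<in> V n \<Longrightarrow> d (n + 1) (d n x) = 0"
    and subspace_F: "subspace (F p n)"
    and F_V: "F p n \<subseteq> V n"
    and F_decreasing: "F (p + 1) n \<subseteq> F p n"
    and d_F: "x \<in> F p n \<Longrightarrow> d n x \<in> F p (n + 1)"
    and F_exhaustive: "\<exists>p. F p n = V n"
    and F_bounded: "\<exists>p. F p n = {0}"
begin

definition M :: "int \<Rightarrow> ('k, 'v) module" where "M n = module_of s (V n)"

text \<open>
  \<open>cyc r p n\<close> and \<open>bdr r p n\<close> are the spaces \<open>Z\<^sub>r\<^sup>p\<^sup>q\<close> and \<open>B\<^sub>r\<^sup>p\<^sup>q\<close> with \<open>n = p + q\<close>.  Indexing them by the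
  total degree instead of \<open>q\<close> keeps \<open>q\<close> out of the degree arithmetic; \<open>r\<close> is an integer since
  \<open>bdr 0\<close> refers to \<open>cyc (- 1)\<close>.
\<close>

definition cyc :: "int \<Rightarrow> int \<Rightarrow> int \<Rightarrow> 'v set" where
  "cyc r p n = {x \<in> F p n. d n x \<in> F (p + r) (n + 1)}"

definition bdr :: "int \<Rightarrow> int \<Rightarrow> int \<Rightarrow> 'v set" where
  "bdr r p n = {u + d (n - 1) z |u z. u \<in> cyc (r - 1) (p + 1) n \<and> z \<in> cyc (r - 1) (p - r + 1) (n - 1)}"

abbreviation E :: "('k, 'v set) spectral_seq" where "E \<equiv> filtration_ss M d F"

lemma F_antimono: "p \<le> p' \<Longrightarrow> F p' n \<subseteq> F p n"
proof (induction p' rule: int_ge_induct)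
  case (step i)
  then show ?case using F_decreasing[of i n] by blast
qed simp

lemma F_antimonoD: "x \<in> F p' n \<Longrightarrow> p \<le> p' \<Longrightarrow> x \<in> F p n"
  using F_antimono by blast

lemma F_imp_V: "x \<in> F p n \<Longrightarrow> x \<in> V n"
  using F_V by blast

lemma d_zero [simp]: "d n 0 = 0"
  using d_scale[of 0 n 0] subspace_0[OF subspace_V] by simp

lemma d_neg: "x \<in> V n \<Longrightarrow> d n (- x) = - d n x"
  using d_scale[of x n "-1"] by simp

lemma d_diff: "x \<in> V n \<Longrightarrow> y \<in> V n \<Longrightarrow> d n (x - y) = d n x - d n y"
  using d_add[of x n "- y"] d_neg[of y n] subspace_neg[OF subspace_V, of y n] by simp

lemma d_d': "x \<in> V (n - 1) \<Longrightarrow> d n (d (n - 1) x) = 0"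
  using d_d[of x "n - 1"] by simp

lemma cyc_F: "x \<in> cyc r p n \<Longrightarrow> x \<in> F p n"
  by (simp add: cyc_def)

lemma cyc_V: "x \<in> cyc r p n \<Longrightarrow> x \<in> V n"
  using cyc_F F_imp_V by blast

lemma cyc_antimono: "x \<in> cyc r p n \<Longrightarrow> p' \<le> p \<Longrightarrow> p' + r' \<le> p + r \<Longrightarrow> x \<in> cyc r' p' n"
  unfolding cyc_def using F_antimonoD by blast

lemma d_cyc: "z \<in> cyc r p n \<Longrightarrow> d n z \<in> cyc r' (p + r) (n + 1)"
  using d_d[OF cyc_V[of z r p n]] by (simp add: cyc_def subspace_0[OF subspace_F])

lemma d_cyc': "z \<in> cyc r (p - r) (n - 1) \<Longrightarrow> d (n - 1) z \<in> cyc r' p n"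
  using d_cyc[of z r "p - r" "n - 1" r'] by simp

lemma subspace_cyc: "subspace (cyc r p n)"
  using subspace_0[OF subspace_F] subspace_add[OF subspace_F] subspace_scale[OF subspace_F]
  by (intro subspaceI) (auto simp: cyc_def d_add[OF F_imp_V F_imp_V] d_scale[OF F_imp_V])

lemma subspace_plus_d:
  assumes "subspace U" "subspace W" "W \<subseteq> V n"
  shows "subspace {u + d n z |u z. u \<in> U \<and> z \<in> W}"
proof -
  have "subspace {u + v |u v. u \<in> U \<and> v \<in> d n ` W}"
  proof (rule subspace_sums[OF assms(1)])
    show "subspace (d n ` W)"
    proof (rule subspaceI)
      show "0 \<in> d n ` W" using subspace_0[OF assms(2)] by force
      show "x + y \<in> d n ` W" if "x \<in> d n ` W" "y \<in> d n ` W" for x y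
      proof -
        from that obtain a b where "a \<in> W" "b \<in> W" "x = d n a" "y = d n b" by blast
        then show ?thesis
          using assms(3) subspace_add[OF assms(2)] d_add[of a n b]
          by (intro image_eqI[of _ _ "a + b"]) (auto simp: subset_eq)
      qed
      show "s c x \<in> d n ` W" if "x \<in> d n ` W" for c x
      proof -
        from that obtain a where "a \<in> W" "x = d n a" by blast
        then show ?thesis
          using assms(3) subspace_scale[OF assms(2)]
            d_scale[of a n c]
          by (intro image_eqI[of _ _ "s c a"]) (auto simp: subset_eq)
      qed
    qed
  qed
  moreover have "{u + v |u v. u \<in> U \<and> v \<in> d n ` W} = {u + d n z |u z. u \<in> U \<and> z \<in> W}" by blast
  ultimately show ?thesis by simp
qed

lemma subspace_bdr: "subspace (bdr r p n)"
  unfolding bdr_def using cyc_V by (intro subspace_plus_d subspace_cyc) blast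

lemma bdrI: "u \<in> cyc (r - 1) (p + 1) n \<Longrightarrow> z \<in> cyc (r - 1) (p - r + 1) (n - 1) \<Longrightarrow>
    u + d (n - 1) z \<in> bdr r p n"
  unfolding bdr_def by blast

lemma bdrE:
  assumes "x \<in> bdr r p n"
  obtains u z where "x = u + d (n - 1) z" "u \<in> cyc (r - 1) (p + 1) n"
    "z \<in> cyc (r - 1) (p - r + 1) (n - 1)"
  using assms unfolding bdr_def by blast

lemma cyc_bdr: "u \<in> cyc (r - 1) (p + 1) n \<Longrightarrow> u \<in> bdr r p n"
  using bdrI[of u r p n 0] subspace_0[OF subspace_cyc] by simp

lemma d_cyc_bdr: "z \<in> cyc (r - 1) (p - r + 1) (n - 1) \<Longrightarrow> d (n - 1) z \<in> bdr r p n"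
  using bdrI[of 0 r p n z] subspace_0[OF subspace_cyc] by simp

lemma bdr_cyc: "bdr r p n \<subseteq> cyc r p n"
proof
  fix x assume "x \<in> bdr r p n"
  then obtain u z where x: "x = u + d (n - 1) z" "u \<in> cyc (r - 1) (p + 1) n"
    "z \<in> cyc (r - 1) (p - r + 1) (n - 1)" by (rule bdrE)
  have "u \<in> cyc r p n" by (rule cyc_antimono[OF x(2)]) auto
  moreover have "d (n - 1) z \<in> cyc r p n"
    using d_cyc'[of z "r - 1" p n r] x(3) by (simp add: algebra_simps)
  ultimately show "x \<in> cyc r p n" using x(1) subspace_add[OF subspace_cyc] by blast
qed

lemma d_bdr:
  assumes "x \<in> bdr r p n"
  shows "d n x \<in> bdr r (p + r) (n + 1)"
proof -
  obtain u z where x: "x = u + d (n - 1) z" "u \<in> cyc (r - 1) (p + 1) n"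
    "z \<in> cyc (r - 1) (p - r + 1) (n - 1)" using assms by (rule bdrE)
  have "d (n - 1) z \<in> V n" using d_V[OF cyc_V[OF x(3)]] by simp
  then have "d n x = d n u" using x d_d'[OF cyc_V[OF x(3)]] d_add[OF cyc_V[OF x(2)]] by simp
  then show ?thesis using d_cyc_bdr[of u r "p + r" "n + 1"] x(2) by simp
qed

subsection \<open>The pages\<close>

lemma filt_cyc_eq: "filt_cyc d F r p q = cyc r p (p + q)"
  by (auto simp: filt_cyc_def cyc_def algebra_simps)

lemma set_add_module_of: "U <+>\<^bsub>M n\<^esub> W = {u + w |u w. u \<in> U \<and> w \<in> W}"
  by (auto simp: set_add_def' M_def module_of_def)

lemma filt_bdry_eq: "filt_bdry M d F r p q = bdr r p (p + q)"
  by (auto simp: filt_bdry_def set_add_module_of filt_cyc_eq bdr_def algebra_simps)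

lemma page_eq: "ss_page E r p q =
    quot_module (module_of s (cyc (int r) p (p + q))) (bdr (int r) p (p + q))"
  by (simp add: filtration_ss_def filt_cyc_eq filt_bdry_eq M_def module_of_def)

lemma presents_page:
  "presents s (ss_page E r p q) (cyc (int r) p (p + q)) (bdr (int r) p (p + q))
     (coset (bdr (int r) p (p + q)))"
  unfolding page_eq using bdr_cyc subspace_bdr subspace_cyc vector_space_axioms
  by (intro presents_coset) auto

lemma presents_page':
  "p' + q' = n \<Longrightarrow> presents s (ss_page E r p' q') (cyc (int r) p' n) (bdr (int r) p' n)
     (coset (bdr (int r) p' n))"
  using presents_page[of r p' q'] by simp

lemma diff_coset:
  assumes "x \<in> cyc (int r) p (p + q)"
  shows "ss_diff E r p q (coset (bdr (int r) p (p + q)) x)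
    = coset (bdr (int r) (p + int r) (p + q + 1)) (d (p + q) x)"
proof -
  have "d (p + q) z - d (p + q) x \<in> bdr (int r) (p + int r) (p + q + 1)"
    if z: "z \<in> coset (bdr (int r) p (p + q)) x" for z
  proof -
    have zx: "z - x \<in> bdr (int r) p (p + q)" using z by (simp add: mem_coset)
    then have "z - x \<in> V (p + q)" using bdr_cyc cyc_V by blast
    then have "z \<in> V (p + q)" using subspace_add[OF subspace_V _ cyc_V[OF assms], of "z - x"] by simp
    then show ?thesis using d_bdr[OF zx] d_diff cyc_V[OF assms] by simp
  qed
  moreover have "x \<in> coset (bdr (int r) p (p + q)) x"
    by (simp add: mem_coset subspace_0[OF subspace_bdr])
  ultimately have "{b + w |b w. b \<in> bdr (int r) (p + int r) (p + q + 1)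
        \<and> w \<in> d (p + q) ` coset (bdr (int r) p (p + q)) x}
      = coset (bdr (int r) (p + int r) (p + q + 1)) (d (p + q) x)"
    by (intro set_add_coset subspace_bdr) auto
  moreover have "p + int r + (q - int r + 1) = p + q + 1" by simp
  ultimately show ?thesis
    unfolding filtration_ss_def spectral_seq.simps set_add_module_of filt_bdry_eq by (simp only:)
qed

text \<open>
  The representatives in \<open>Z\<^sub>r\<close> of the boundaries of the page \<open>E\<^sub>r\<close>, namely \<open>B\<^sub>r + d Z\<^sub>r\<close>, and of its
  cycles.
\<close>

definition page_bdr :: "int \<Rightarrow> int \<Rightarrow> int \<Rightarrow> 'v set" where
  "page_bdr r p n = {u + d (n - 1) z |u z. u \<in> bdr r p n \<and> z \<in> cyc r (p - r) (n - 1)}"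

definition page_cyc :: "int \<Rightarrow> int \<Rightarrow> int \<Rightarrow> 'v set" where
  "page_cyc r p n = {x \<in> cyc r p n. d n x \<in> bdr r (p + r) (n + 1)}"

lemma subspace_page_bdr: "subspace (page_bdr r p n)"
  unfolding page_bdr_def using cyc_V by (intro subspace_plus_d subspace_bdr subspace_cyc) blast

lemma subspace_page_cyc: "subspace (page_cyc r p n)"
  using subspace_0[OF subspace_cyc] subspace_add[OF subspace_cyc] subspace_scale[OF subspace_cyc]
    subspace_0[OF subspace_bdr] subspace_add[OF subspace_bdr] subspace_scale[OF subspace_bdr]
  by (intro subspaceI) (auto simp: page_cyc_def d_add[OF cyc_V cyc_V] d_scale[OF cyc_V])

lemma page_bdr_cyc: "page_bdr r p n \<subseteq> page_cyc r p n"
proof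
  fix x assume "x \<in> page_bdr r p n"
  then obtain u z where x: "x = u + d (n - 1) z" and u: "u \<in> bdr r p n"
    and z: "z \<in> cyc r (p - r) (n - 1)" unfolding page_bdr_def by blast
  have "u \<in> page_cyc r p n" using u bdr_cyc d_bdr by (auto simp: page_cyc_def)
  moreover have "d (n - 1) z \<in> page_cyc r p n"
    using d_cyc'[OF z] d_d'[OF cyc_V[OF z]] by (simp add: page_cyc_def subspace_0 subspace_bdr)
  ultimately show "x \<in> page_cyc r p n" using x subspace_add[OF subspace_page_cyc] by blast
qed

lemma presents_ss_cohomology:
  "presents s (ss_cohomology E r p q) (page_cyc (int r) p (p + q)) (page_bdr (int r) p (p + q))
     (\<lambda>y. coset (bdr (int r) p (p + q)) ` coset (page_bdr (int r) p (p + q)) y)"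
  unfolding ss_cohomology_def
proof (rule presents_cohomology_at)
  show "presents s (ss_page E r (p - int r) (q + int r - 1)) (cyc (int r) (p - int r) (p + q - 1))
     (bdr (int r) (p - int r) (p + q - 1)) (coset (bdr (int r) (p - int r) (p + q - 1)))"
    by (rule presents_page') simp
  show "presents s (ss_page E r p q) (cyc (int r) p (p + q)) (bdr (int r) p (p + q))
     (coset (bdr (int r) p (p + q)))" by (rule presents_page)
  show "presents s (ss_page E r (p + int r) (q - int r + 1)) (cyc (int r) (p + int r) (p + q + 1))
     (bdr (int r) (p + int r) (p + q + 1)) (coset (bdr (int r) (p + int r) (p + q + 1)))"
    by (rule presents_page') simp
  show "ss_diff E r (p - int r) (q + int r - 1) (coset (bdr (int r) (p - int r) (p + q - 1)) y)
      = coset (bdr (int r) p (p + q)) (d (p + q - 1) y)"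
    if "y \<in> cyc (int r) (p - int r) (p + q - 1)" for y
    using diff_coset[of y r "p - int r" "q + int r - 1"] that by (simp add: algebra_simps)
  show "ss_diff E r p q (coset (bdr (int r) p (p + q)) y)
      = coset (bdr (int r) (p + int r) (p + q + 1)) (d (p + q) y)"
    if "y \<in> cyc (int r) p (p + q)" for y by (rule diff_coset[OF that])
  show "d (p + q) y \<in> cyc (int r) (p + int r) (p + q + 1)"
    if "y \<in> cyc (int r) p (p + q)" for y by (rule d_cyc[OF that])
qed (rule subspace_0[OF subspace_cyc] d_zero page_cyc_def page_bdr_def subspace_page_cyc subspace_page_bdr page_bdr_cyc)+

text \<open>
  A cycle of \<open>E\<^sub>r\<close> need not lie in \<open>Z\<^sub>r\<^sub>+\<^sub>1\<close>, but its class contains an element of \<open>Z\<^sub>r\<^sub>+\<^sub>1\<close>: if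
  \<open>d x = u + d z\<close> with \<open>u\<close> of filtration \<open>p + r + 1\<close> and \<open>z\<close> of filtration \<open>p + 1\<close>, then \<open>x - z\<close> is
  in \<open>Z\<^sub>r\<^sub>+\<^sub>1\<close>, and \<open>z\<close> is in \<open>B\<^sub>r\<close>.
\<close>

lemma page_cyc_decompose:
  assumes "x \<in> page_cyc r p n"
  shows "\<exists>y\<in>cyc (r + 1) p n. x - y \<in> page_bdr r p n"
proof -
  have x: "x \<in> cyc r p n" "d n x \<in> bdr r (p + r) (n + 1)" using assms by (auto simp: page_cyc_def)
  obtain u z where dx: "d n x = u + d n z" and u: "u \<in> cyc (r - 1) (p + r + 1) (n + 1)"
    and z: "z \<in> cyc (r - 1) (p + 1) n" using bdrE[OF x(2)] by (auto simp: algebra_simps)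
  have "d n (x - z) = u" using dx d_diff cyc_V x(1) z by auto
  moreover have "x - z \<in> F p n"
    using cyc_F[OF x(1)] F_antimonoD[OF cyc_F[OF z]] by (intro subspace_diff[OF subspace_F]) auto
  ultimately have "x - z \<in> cyc (r + 1) p n" using cyc_F[OF u] by (simp add: cyc_def algebra_simps)
  moreover have "z \<in> page_bdr r p n"
    unfolding page_bdr_def using cyc_bdr[OF z] subspace_0[OF subspace_cyc]
    by (intro CollectI exI[of _ z] exI[of _ 0]) simp
  ultimately show ?thesis by (intro bexI[of _ "x - z"]) auto
qed

lemma cyc_Suc_page_cyc: "cyc (r + 1) p n \<subseteq> page_cyc r p n"
proof
  fix x assume x: "x \<in> cyc (r + 1) p n"
  have "d n x \<in> cyc (r - 1) (p + r + 1) (n + 1)" using d_cyc[OF x, of "r - 1"] by (simp add: algebra_simps)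
  then have "d n x \<in> bdr r (p + r) (n + 1)" by (rule cyc_bdr)
  moreover have "x \<in> cyc r p n" by (rule cyc_antimono[OF x]) auto
  ultimately show "x \<in> page_cyc r p n" by (simp add: page_cyc_def)
qed

text \<open>
  For \<open>x = u + d z\<close> in \<open>Z\<^sub>r\<^sub>+\<^sub>1\<close> the equation \<open>d x = d u\<close> improves \<open>u\<close> from \<open>Z\<^sub>r\<^sub>-\<^sub>1\<close> to \<open>Z\<^sub>r\<close>.  So both
  the cohomology of \<open>E\<^sub>r\<close> and \<open>E\<^sub>r\<^sub>+\<^sub>1\<close> are \<open>Z\<^sub>r\<^sub>+\<^sub>1/B\<^sub>r\<^sub>+\<^sub>1\<close>.
\<close>

lemma cyc_Suc_page_bdr: "cyc (r + 1) p n \<inter> page_bdr r p n = bdr (r + 1) p n"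
proof safe
  fix x assume x: "x \<in> cyc (r + 1) p n" "x \<in> page_bdr r p n"
  then obtain u z1 z2 where xeq: "x = u + d (n - 1) z1 + d (n - 1) z2"
    and u: "u \<in> cyc (r - 1) (p + 1) n" and z1: "z1 \<in> cyc (r - 1) (p - r + 1) (n - 1)"
    and z2: "z2 \<in> cyc r (p - r) (n - 1)" unfolding page_bdr_def by (auto elim!: bdrE)
  have z1': "z1 \<in> cyc r (p - r) (n - 1)" by (rule cyc_antimono[OF z1]) auto
  let ?z = "z1 + z2"
  have z: "?z \<in> cyc r (p - r) (n - 1)" using z1' z2 by (rule subspace_add[OF subspace_cyc])
  have xu: "x = u + d (n - 1) ?z" using xeq d_add[OF cyc_V[OF z1] cyc_V[OF z2]] by simp
  have "d (n - 1) ?z \<in> V n" using d_V[OF cyc_V[OF z]] by simp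
  then have "d n u = d n x" using xu d_add[OF cyc_V[OF u]] d_d'[OF cyc_V[OF z]] by simp
  then have "u \<in> cyc r (p + 1) n" using x(1) cyc_F[OF u] by (simp add: cyc_def algebra_simps)
  then show "x \<in> bdr (r + 1) p n" unfolding xu using z by (intro bdrI) auto
next
  fix x assume x: "x \<in> bdr (r + 1) p n"
  then show "x \<in> cyc (r + 1) p n" using bdr_cyc by blast
  obtain u z where xu: "x = u + d (n - 1) z" and u: "u \<in> cyc r (p + 1) n"
    and z: "z \<in> cyc r (p - r) (n - 1)" using bdrE[OF x] by auto
  have "u \<in> cyc (r - 1) (p + 1) n" by (rule cyc_antimono[OF u]) auto
  then show "x \<in> page_bdr r p n" unfolding xu page_bdr_def using z cyc_bdr by blast
qed

lemma presents_ss_cohomology_cyc: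
  "presents s (ss_cohomology E r p q) (cyc (int r + 1) p (p + q)) (bdr (int r + 1) p (p + q))
     (\<lambda>y. coset (bdr (int r) p (p + q)) ` coset (page_bdr (int r) p (p + q)) y)"
  using presents_subpresentation[OF presents_ss_cohomology subspace_cyc cyc_Suc_page_cyc page_cyc_decompose]
  unfolding cyc_Suc_page_bdr .

lemma bdr_page_bdr: "bdr r p n \<subseteq> page_bdr r p n"
  unfolding page_bdr_def using subspace_0[OF subspace_cyc] by force

text \<open>
  In the presentation by \<open>Z\<^sub>r\<^sub>+\<^sub>1\<close> the map from the cohomology of \<open>E\<^sub>r\<close> to \<open>E\<^sub>r\<^sub>+\<^sub>1\<close> is the identity on
  representatives, which is why it is an isomorphism.
\<close>

lemma next_coset:
  assumes y: "y \<in> cyc (int r + 1) p (p + q)"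
  shows "ss_next E r p q (coset (bdr (int r) p (p + q)) ` coset (page_bdr (int r) p (p + q)) y)
    = coset (bdr (int r + 1) p (p + q)) y"
proof -
  have "z - y \<in> bdr (int r + 1) p (p + q)"
    if "z \<in> coset (page_bdr (int r) p (p + q)) y" "z \<in> cyc (int r + 1) p (p + q)" for z
    unfolding cyc_Suc_page_bdr[symmetric]
    using that y subspace_diff[OF subspace_cyc] by (auto simp: mem_coset)
  moreover have "y \<in> coset (page_bdr (int r) p (p + q)) y"
    by (simp add: mem_coset subspace_0 subspace_page_bdr)
  ultimately show ?thesis
    using y unfolding filtration_ss_def spectral_seq.simps set_add_module_of filt_bdry_eq filt_cyc_eq
      Union_cosets[OF bdr_page_bdr subspace_bdr subspace_page_bdr]
    by (intro set_add_coset subspace_bdr) auto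
qed

lemma ss_boundaries_eq:
  "ss_boundaries E r p q = coset (bdr (int r) p (p + q)) ` page_bdr (int r) p (p + q)"
  unfolding ss_boundaries_def
proof (rule presents_boundaries)
  show "presents s (ss_page E r (p - int r) (q + int r - 1)) (cyc (int r) (p - int r) (p + q - 1))
     (bdr (int r) (p - int r) (p + q - 1)) (coset (bdr (int r) (p - int r) (p + q - 1)))"
    by (rule presents_page') simp
  show "presents s (ss_page E r p q) (cyc (int r) p (p + q)) (bdr (int r) p (p + q))
     (coset (bdr (int r) p (p + q)))" by (rule presents_page)
  show "ss_diff E r (p - int r) (q + int r - 1) (coset (bdr (int r) (p - int r) (p + q - 1)) y)
      = coset (bdr (int r) p (p + q)) (d (p + q - 1) y)"
    if "y \<in> cyc (int r) (p - int r) (p + q - 1)" for y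
    using diff_coset[of y r "p - int r" "q + int r - 1"] that by (simp add: algebra_simps)
  show "d (p + q - 1) y \<in> cyc (int r) p (p + q)"
    if "y \<in> cyc (int r) (p - int r) (p + q - 1)" for y using that by (rule d_cyc')
qed (rule page_bdr_def)

text \<open>
  The same map on the class of an arbitrary cycle \<open>y\<close> of the page, given a representative \<open>y'\<close> of that
  class in \<open>Z\<^sub>r\<^sub>+\<^sub>1\<close>.
\<close>

lemma next_class:
  assumes y: "y \<in> cyc (int r) p (p + q)" and y': "y' \<in> cyc (int r + 1) p (p + q)"
    and diff: "y - y' \<in> page_bdr (int r) p (p + q)"
  shows "ss_next E r p q (ss_boundaries E r p q +>\<^bsub>ss_page E r p q\<^esub> coset (bdr (int r) p (p + q)) y)
    = coset (bdr (int r + 1) p (p + q)) y'"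
proof -
  have "page_bdr (int r) p (p + q) \<subseteq> cyc (int r) p (p + q)"
    using page_bdr_cyc by (auto simp: page_cyc_def)
  then show ?thesis
    using presents_coset_image[OF presents_page _ y] next_coset[OF y']
      coset_eqI[OF subspace_page_bdr diff] by (simp add: ss_boundaries_eq)
qed

theorem spectral_sequence_filtration: "spectral_sequence E"
  unfolding spectral_sequence_def
proof (intro allI conjI)
  fix r :: nat and p q :: int
  let ?n = "p + q"
  have target: "presents s (ss_page E r (p + int r) (q - int r + 1))
      (cyc (int r) (p + int r) (?n + 1)) (bdr (int r) (p + int r) (?n + 1))
      (coset (bdr (int r) (p + int r) (?n + 1)))"
    by (rule presents_page') simp
  show "Module.module ring_of_type_algebra (ss_page E r p q)"
    by (rule presents_module[OF presents_page])
  show "ss_diff E r p q \<in> linear_hom (ss_page E r p q) (ss_page E r (p + int r) (q - int r + 1))"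
    using presents_linear_hom[OF presents_page[of r p q] target, of "ss_diff E r p q" "d ?n"] d_cyc diff_coset[of _ r p q]
    by (simp add: d_add[OF cyc_V cyc_V] d_scale[OF cyc_V])
  show "\<forall>x\<in>carrier (ss_page E r p q). ss_diff E r (p + int r) (q - int r + 1) (ss_diff E r p q x)
      = \<zero>\<^bsub>ss_page E r (p + int r + int r) (q - int r + 1 - int r + 1)\<^esub>"
  proof
    fix U assume "U \<in> carrier (ss_page E r p q)"
    then obtain x where x: "x \<in> cyc (int r) p ?n" "U = coset (bdr (int r) p ?n) x"
      using presents_page[of r p q] by (auto simp: presents_def)
    have dx: "d ?n x \<in> cyc (int r) (p + int r) (?n + 1)" using x(1) by (rule d_cyc)
    have "ss_diff E r (p + int r) (q - int r + 1) (ss_diff E r p q U)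
        = coset (bdr (int r) (p + int r + int r) (?n + 1 + 1)) (d (?n + 1) (d ?n x))"
      using diff_coset[of "d ?n x" r "p + int r" "q - int r + 1"] dx x
      by (simp add: diff_coset algebra_simps)
    also have "\<dots> = \<zero>\<^bsub>ss_page E r (p + int r + int r) (q - int r + 1 - int r + 1)\<^esub>"
      using presents_page'[of "p + int r + int r" "q - int r + 1 - int r + 1" "?n + 1 + 1" r]
        d_d[OF cyc_V[OF x(1)]] by (simp add: presents_def)
    finally show "ss_diff E r (p + int r) (q - int r + 1) (ss_diff E r p q U)
      = \<zero>\<^bsub>ss_page E r (p + int r + int r) (q - int r + 1 - int r + 1)\<^esub>" .
  qed
  have "presents s (ss_page E (Suc r) p q) (cyc (int r + 1) p ?n) (bdr (int r + 1) p ?n)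
      (coset (bdr (int r + 1) p ?n))"
    using presents_page[of "Suc r" p q] by (simp add: add.commute)
  then show "ss_next E r p q \<in> linear_iso (ss_cohomology E r p q) (ss_page E (Suc r) p q)"
    by (rule presents_linear_iso[OF presents_ss_cohomology_cyc[of r p q]]) (rule next_coset)
qed

subsection \<open>Convergence\<close>

text \<open>
  \<open>zcyc n\<close> and \<open>zbdr n\<close> are the cocycles and coboundaries of the complex itself, and \<open>zfilt p n\<close>
  consists of the cocycles whose cohomology class has a representative in \<open>F\<^sup>p\<close>; it is the preimage
  of \<open>F\<^sup>pH\<^sup>n\<close>.
\<close>

definition zcyc :: "int \<Rightarrow> 'v set" where "zcyc n = {x \<in> V n. d n x = 0}"

definition zbdr :: "int \<Rightarrow> 'v set" where "zbdr n = d (n - 1) ` V (n - 1)"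

abbreviation H :: "int \<Rightarrow> ('k, 'v set) module" where "H \<equiv> complex_cohomology M d"

lemma subspace_zcyc: "subspace (zcyc n)"
  using subspace_0[OF subspace_V] subspace_add[OF subspace_V] subspace_scale[OF subspace_V]
  by (intro subspaceI) (auto simp: zcyc_def d_add d_scale)

lemma zbdr_zcyc: "zbdr n \<subseteq> zcyc n"
  using d_V[of _ "n - 1"] d_d' by (auto simp: zbdr_def zcyc_def)

lemma subspace_zbdr: "subspace (zbdr n)"
  using subspace_plus_d[of "{0}" "V (n - 1)" "n - 1"] subspace_V subspace_single_0
  by (simp add: zbdr_def image_def Bex_def conj_commute)

lemma presents_H: "presents s (H n) (zcyc n) (zbdr n) (coset (zbdr n))"
proof -
  have "H n = quot_module (module_of s (zcyc n)) (zbdr n)"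
    by (simp add: complex_cohomology_def cohomology_at_def zcyc_def zbdr_def M_def module_of_def)
  then show ?thesis
    using presents_coset[OF vector_space_axioms subspace_zcyc subspace_zbdr zbdr_zcyc] by simp
qed

definition zfilt :: "int \<Rightarrow> int \<Rightarrow> 'v set" where
  "zfilt p n = {u + d (n - 1) z |u z. u \<in> F p n \<inter> zcyc n \<and> z \<in> V (n - 1)}"

lemma subspace_zfilt: "subspace (zfilt p n)"
  unfolding zfilt_def by (intro subspace_plus_d subspace_inter subspace_F subspace_zcyc subspace_V) simp

lemma zfilt_zcyc: "zfilt p n \<subseteq> zcyc n"
  unfolding zfilt_def using zbdr_zcyc[of n] subspace_add[OF subspace_zcyc, of _ n]
  by (fastforce simp: zbdr_def)

lemma zbdr_zfilt: "zbdr n \<subseteq> zfilt p n"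
proof
  fix x assume "x \<in> zbdr n"
  then obtain z where "z \<in> V (n - 1)" "x = 0 + d (n - 1) z" by (auto simp: zbdr_def)
  moreover have "0 \<in> F p n \<inter> zcyc n" using subspace_0 subspace_F subspace_zcyc by simp
  ultimately show "x \<in> zfilt p n" unfolding zfilt_def by blast
qed

lemma zfilt_decreasing: "zfilt (p + 1) n \<subseteq> zfilt p n"
  unfolding zfilt_def using F_decreasing by blast

lemma F_zcyc_zfilt: "F p n \<inter> zcyc n \<subseteq> zfilt p n"
  unfolding zfilt_def using subspace_0[OF subspace_V] by force

lemma finite_filtration_H: "finite_filtration (H n) (\<lambda>p. coset (zbdr n) ` zfilt p n)"
  unfolding finite_filtration_def
proof (intro conjI allI)
  show "submodule (coset (zbdr n) ` zfilt p n) ring_of_type_algebra (H n)" for p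
    by (rule presents_submodule[OF presents_H subspace_zfilt zfilt_zcyc])
  show "coset (zbdr n) ` zfilt (p + 1) n \<subseteq> coset (zbdr n) ` zfilt p n" for p
    using zfilt_decreasing by (rule image_mono)
  obtain a where "F a n = V n" using F_exhaustive by blast
  then have "zcyc n \<subseteq> F a n \<inter> zcyc n" by (auto simp: zcyc_def)
  then have "zfilt a n = zcyc n" using zfilt_zcyc[of a n] F_zcyc_zfilt[of a n] by blast
  then have "coset (zbdr n) ` zfilt a n = carrier (H n)"
    using presents_H[of n] by (simp add: presents_def)
  then show "\<exists>p. coset (zbdr n) ` zfilt p n = carrier (H n)" by blast
  obtain b where "F b n = {0}" using F_bounded by blast
  then have "zfilt b n \<subseteq> zbdr n" by (auto simp: zfilt_def zbdr_def)
  then have "zfilt b n = zbdr n" using zbdr_zfilt by blast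
  moreover have "coset (zbdr n) x = \<zero>\<^bsub>H n\<^esub>" if "x \<in> zbdr n" for x
    using presents_eq_zero_iff[OF presents_H, of x n] that zbdr_zcyc by blast
  ultimately have "coset (zbdr n) ` zfilt b n = {\<zero>\<^bsub>H n\<^esub>}"
    using subspace_0[OF subspace_zbdr, of n] by force
  then show "\<exists>p. coset (zbdr n) ` zfilt p n = {\<zero>\<^bsub>H n\<^esub>}" by blast
qed

text \<open>
  Since \<open>F\<^sup>pH\<^sup>n\<close> consists of the classes of cocycles in \<open>F\<^sup>p\<close>, such cocycles suffice to present
  \<open>F\<^sup>pH\<^sup>n/F\<^sup>p\<^sup>+\<^sup>1H\<^sup>n\<close>.
\<close>

lemma presents_graded_piece:
  "presents s (quot_module ((H n)\<lparr>carrier := coset (zbdr n) ` zfilt p n\<rparr>) (coset (zbdr n) ` zfilt (p + 1) n))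
     (F p n \<inter> zcyc n) (F p n \<inter> zcyc n \<inter> zfilt (p + 1) n)
     (\<lambda>y. coset (zbdr n) ` coset (zfilt (p + 1) n) y)"
proof (rule presents_subpresentation)
  show "presents s (quot_module ((H n)\<lparr>carrier := coset (zbdr n) ` zfilt p n\<rparr>) (coset (zbdr n) ` zfilt (p + 1) n))
     (zfilt p n) (zfilt (p + 1) n) (\<lambda>y. coset (zbdr n) ` coset (zfilt (p + 1) n) y)"
    by (rule presents_quot_module[OF presents_restrict[OF presents_H]])
      (rule subspace_zfilt zbdr_zfilt zfilt_zcyc zfilt_decreasing)+
  fix y assume "y \<in> zfilt p n"
  then obtain u z where "y = u + d (n - 1) z" "u \<in> F p n \<inter> zcyc n" "z \<in> V (n - 1)"
    unfolding zfilt_def by blast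
  moreover from this have "d (n - 1) z \<in> zfilt (p + 1) n" using zbdr_zfilt by (auto simp: zbdr_def)
  ultimately show "\<exists>y'\<in>F p n \<inter> zcyc n. y - y' \<in> zfilt (p + 1) n" by (intro bexI[of _ u]) auto
qed (rule subspace_inter subspace_F subspace_zcyc F_zcyc_zfilt)+

lemma F_zero_above: "F b n = {0} \<Longrightarrow> b \<le> c \<Longrightarrow> F c n = {0}"
  using F_antimono[of b c n] subspace_0[OF subspace_F, of c n] by auto

lemma F_all_below: "F a n = V n \<Longrightarrow> c \<le> a \<Longrightarrow> F c n = V n"
  using F_antimono[of c a n] F_V[of c n] by auto

text \<open>
  If \<open>r\<close> is so large that the target \<open>F\<^sup>p\<^sup>+\<^sup>r\<close> of \<open>d\<close> is zero and \<open>F\<^sup>p\<^sup>-\<^sup>r\<^sup>+\<^sup>1\<close> is the whole complex, then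
  \<open>Z\<^sub>r\<close> and \<open>B\<^sub>r\<close> are precisely the space and the kernel that present the graded piece of
  cohomology.
\<close>

context
  fixes r p n :: int
  assumes top: "F (p + r) (n + 1) = {0}" and bot: "F (p - r + 1) (n - 1) = V (n - 1)"
begin

lemma cyc_limit: "cyc r p n = F p n \<inter> zcyc n"
  unfolding cyc_def zcyc_def top using F_V by blast

lemma bdr_limit: "bdr r p n = F p n \<inter> zcyc n \<inter> zfilt (p + 1) n"
proof -
  have c1: "cyc (r - 1) (p + 1) n = F (p + 1) n \<inter> zcyc n"
    using top F_V by (auto simp: cyc_def zcyc_def)
  have c2: "cyc (r - 1) (p - r + 1) (n - 1) = {z \<in> V (n - 1). d (n - 1) z \<in> F p n}"
    using bot by (auto simp: cyc_def)
  show ?thesis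
  proof safe
    fix x assume x: "x \<in> bdr r p n"
    then have "x \<in> F p n \<inter> zcyc n" using bdr_cyc cyc_limit by blast
    then show "x \<in> F p n" "x \<in> zcyc n" by auto
    show "x \<in> zfilt (p + 1) n" using x unfolding bdr_def c1 c2 zfilt_def by blast
  next
    fix x assume x: "x \<in> F p n" and "x \<in> zfilt (p + 1) n"
    then obtain u z where uz: "x = u + d (n - 1) z" "u \<in> F (p + 1) n \<inter> zcyc n" "z \<in> V (n - 1)"
      unfolding zfilt_def by blast
    then have "u \<in> F p n" using F_decreasing by blast
    with x have "x - u \<in> F p n" by (rule subspace_diff[OF subspace_F])
    with uz show "x \<in> bdr r p n" unfolding bdr_def c1 c2 by auto
  qed
qed

end

theorem filtration_ss_converges: "ss_converges_to E H"
  unfolding ss_converges_to_def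
proof (rule exI[of _ "\<lambda>n p. coset (zbdr n) ` zfilt p n"], intro conjI allI)
  show "finite_filtration (H n) (\<lambda>p. coset (zbdr n) ` zfilt p n)" for n by (rule finite_filtration_H)
  fix p q :: int
  let ?n = "p + q"
  obtain a where a: "F a (?n - 1) = V (?n - 1)" using F_exhaustive by blast
  obtain b where b: "F b (?n + 1) = {0}" using F_bounded by blast
  (* r >= r0 means p - r + 1 <= a and p + r >= b: everything of degree n - 1 lies in the filtration
     step p - r + 1, and only zero lies in step p + r in degree n + 1. *)
  define r0 where "r0 = nat (max (p + 1 - a) (b - p))"
  have top: "F (p + int r) (?n + 1) = {0}" and bot: "F (p - int r + 1) (?n - 1) = V (?n - 1)"
    if "r0 \<le> r" for r
    using F_zero_above[OF b, of "p + int r"] F_all_below[OF a, of "p - int r + 1"] that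
    by (auto simp: r0_def)
  have target: "presents s (ss_page E r (p + int r) (q - int r + 1))
      (cyc (int r) (p + int r) (?n + 1)) (bdr (int r) (p + int r) (?n + 1))
      (coset (bdr (int r) (p + int r) (?n + 1)))" for r
    by (rule presents_page') simp
  have stable: "ss_stable_from E p q r0"
    unfolding ss_stable_from_def
  proof (intro allI impI conjI ballI)
    fix r assume r: "r0 \<le> r"
    show "ss_diff E r p q U = \<zero>\<^bsub>ss_page E r (p + int r) (q - int r + 1)\<^esub>"
      if "U \<in> carrier (ss_page E r p q)" for U
    proof -
      from \<open>U \<in> _\<close> obtain x where x: "x \<in> cyc (int r) p ?n" "U = coset (bdr (int r) p ?n) x"
        using presents_page[of r p q] by (auto simp: presents_def)
      then have "d ?n x = 0" using cyc_limit[OF top[OF r] bot[OF r]] by (simp add: zcyc_def)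
      then show ?thesis using diff_coset[OF x(1)] x(2) target[of r] by (simp add: presents_def)
    qed
    have "page_bdr (int r) p ?n \<subseteq> bdr (int r) p ?n"
    proof
      fix x assume "x \<in> page_bdr (int r) p ?n"
      then obtain u z where uz: "x = u + d (?n - 1) z" "u \<in> bdr (int r) p ?n"
        "z \<in> cyc (int r) (p - int r) (?n - 1)" unfolding page_bdr_def by blast
      then have "z \<in> cyc (int r - 1) (p - int r + 1) (?n - 1)"
        using bot[OF r] cyc_V[OF uz(3)] by (auto simp: cyc_def)
      then show "x \<in> bdr (int r) p ?n"
        using uz d_cyc_bdr subspace_add[OF subspace_bdr] by blast
    qed
    then show "ss_boundaries E r p q \<subseteq> {\<zero>\<^bsub>ss_page E r p q\<^esub>}"
      using presents_eq_zero_iff[OF presents_page[of r p q]] bdr_cyc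
      unfolding ss_boundaries_eq by blast
  qed
  have "linear_iso (ss_page E r0 p q)
      (quot_module ((H ?n)\<lparr>carrier := coset (zbdr ?n) ` zfilt p ?n\<rparr>) (coset (zbdr ?n) ` zfilt (p + 1) ?n)) \<noteq> {}"
    using presents_isomorphic[OF _ presents_graded_piece] presents_page[of r0 p q]
      cyc_limit[OF top bot, of r0] bdr_limit[OF top bot, of r0] by simp
  with stable show "\<exists>r0. ss_stable_from E p q r0 \<and> linear_iso (ss_page E r0 p q)
      (quot_module ((H ?n)\<lparr>carrier := coset (zbdr ?n) ` zfilt p ?n\<rparr>) (coset (zbdr ?n) ` zfilt (p + 1) ?n)) \<noteq> {}"
    by blast
qed

end

subsection \<open>Functoriality\<close>

text \<open>
  A linear map that commutes with \<open>d\<close> and preserves the filtration maps \<open>Z\<^sub>r\<close> to \<open>Z\<^sub>r\<close> and \<open>B\<^sub>r\<close> to \<open>B\<^sub>r\<close>, so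
  it acts on all pages by \<open>[x] \<mapsto> [h x]\<close>.
\<close>

locale filtered_complex_hom =
  A: filtered_complex s V d F + B: filtered_complex s' V' d' F'
  for s :: "'k::field \<Rightarrow> 'v::ab_group_add \<Rightarrow> 'v" and V d F
    and s' :: "'k \<Rightarrow> 'w::ab_group_add \<Rightarrow> 'w" and V' d' F' +
  fixes h :: "int \<Rightarrow> 'v \<Rightarrow> 'w"
  assumes h_add: "x \<in> V n \<Longrightarrow> y \<in> V n \<Longrightarrow> h n (x + y) = h n x + h n y"
    and h_scale: "x \<in> V n \<Longrightarrow> h n (s c x) = s' c (h n x)"
    and h_F: "x \<in> F p n \<Longrightarrow> h n x \<in> F' p n"
    and h_d: "x \<in> V n \<Longrightarrow> h (n + 1) (d n x) = d' n (h n x)"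
begin

lemma h_diff:
  assumes "x \<in> V n" "y \<in> V n"
  shows "h n (x - y) = h n x - h n y"
  using h_add[of "x - y" n y] A.subspace_diff[OF A.subspace_V assms] assms(2)
  by (simp add: algebra_simps)

lemma h_d': "x \<in> V (n - 1) \<Longrightarrow> h n (d (n - 1) x) = d' (n - 1) (h (n - 1) x)"
  using h_d[of x "n - 1"] by simp

lemma h_cyc: "x \<in> A.cyc r p n \<Longrightarrow> h n x \<in> B.cyc r p n"
  using h_d[of x n] A.cyc_V[of x r p n] h_F[of x p n] h_F[of "d n x" "p + r" "n + 1"]
  by (simp add: A.cyc_def B.cyc_def)

lemma h_plus_d:
  assumes "u \<in> V n" "z \<in> V (n - 1)"
  shows "h n (u + d (n - 1) z) = h n u + d' (n - 1) (h (n - 1) z)"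
  using h_add[of u n "d (n - 1) z"] A.d_V[OF assms(2)] h_d'[OF assms(2)] assms(1) by simp

lemma h_bdr: "x \<in> A.bdr r p n \<Longrightarrow> h n x \<in> B.bdr r p n"
  by (erule A.bdrE) (simp add: h_plus_d A.cyc_V h_cyc B.bdrI)

lemma h_page_bdr:
  assumes "x \<in> A.page_bdr r p n"
  shows "h n x \<in> B.page_bdr r p n"
proof -
  obtain u z where uz: "x = u + d (n - 1) z" "u \<in> A.bdr r p n" "z \<in> A.cyc r (p - r) (n - 1)"
    using assms unfolding A.page_bdr_def by blast
  then have "u \<in> V n" "z \<in> V (n - 1)" using A.bdr_cyc A.cyc_V by blast+
  then have "h n x = h n u + d' (n - 1) (h (n - 1) z)" using uz(1) h_plus_d by simp
  then show ?thesis unfolding B.page_bdr_def using h_bdr[OF uz(2)] h_cyc[OF uz(3)] by blast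
qed

text \<open>
  The sum with \<open>B\<^sub>r\<close> of the target completes the image of a coset to a coset.
\<close>

definition page_map :: "nat \<Rightarrow> int \<Rightarrow> int \<Rightarrow> 'v set \<Rightarrow> 'w set" where
  "page_map r p q U = filt_bdry B.M d' F' (int r) p q <+>\<^bsub>B.M (p + q)\<^esub> h (p + q) ` U"

lemma page_map_coset:
  assumes x: "x \<in> A.cyc (int r) p (p + q)"
  shows "page_map r p q (coset (A.bdr (int r) p (p + q)) x) = coset (B.bdr (int r) p (p + q)) (h (p + q) x)"
  unfolding page_map_def B.set_add_module_of B.filt_bdry_eq
proof (rule B.set_add_coset[OF B.subspace_bdr])
  fix z assume "z \<in> h (p + q) ` coset (A.bdr (int r) p (p + q)) x"
  then obtain y where y: "z = h (p + q) y" "y - x \<in> A.bdr (int r) p (p + q)" by (auto simp: mem_coset)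
  have "y - x \<in> V (p + q)" using y(2) A.bdr_cyc A.cyc_V by blast
  then have "y \<in> V (p + q)" using A.subspace_add[OF A.subspace_V _ A.cyc_V[OF x], of "y - x"] by simp
  then show "z - h (p + q) x \<in> B.bdr (int r) p (p + q)"
    using h_bdr[OF y(2)] y(1) h_diff A.cyc_V[OF x] by simp
next
  show "h (p + q) ` coset (A.bdr (int r) p (p + q)) x \<noteq> {}"
    using A.subspace_0[OF A.subspace_bdr] by (auto simp: coset_def)
qed

theorem ss_morphism_page_map: "ss_morphism A.E B.E page_map"
  unfolding ss_morphism_def
proof (intro allI conjI ballI impI)
  fix r :: nat and p q :: int
  let ?n = "p + q"
  let ?\<kappa> = "coset (A.bdr (int r) p ?n)" and ?\<kappa>' = "coset (B.bdr (int r) p ?n)"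
  show "page_map r p q \<in> linear_hom (ss_page A.E r p q) (ss_page B.E r p q)"
    using presents_linear_hom[OF A.presents_page[of r p q] B.presents_page[of r p q],
        of "page_map r p q" "h ?n"] page_map_coset[of _ r p q] h_cyc[of _ "int r" p ?n]
    by (simp add: h_add[OF A.cyc_V A.cyc_V] h_scale[OF A.cyc_V])
  fix U assume "U \<in> carrier (ss_page A.E r p q)"
  then obtain x where x: "x \<in> A.cyc (int r) p ?n" "U = ?\<kappa> x"
    using A.presents_page[of r p q] by (auto simp: presents_def)
  have n: "p + int r + (q - int r + 1) = ?n + 1" by simp
  have dx: "d ?n x \<in> A.cyc (int r) (p + int r) (?n + 1)" using x(1) by (rule A.d_cyc)
  show "page_map r (p + int r) (q - int r + 1) (ss_diff A.E r p q U)
      = ss_diff B.E r p q (page_map r p q U)"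
    using page_map_coset[of "d ?n x" r "p + int r" "q - int r + 1"] dx
      B.diff_coset[OF h_cyc[OF x(1)]] h_d[OF A.cyc_V[OF x(1)]]
    unfolding x(2) A.diff_coset[OF x(1)] page_map_coset[OF x(1)] n by simp
  assume zero: "ss_diff A.E r p q U = \<zero>\<^bsub>ss_page A.E r (p + int r) (q - int r + 1)\<^esub>"
  have "presents s (ss_page A.E r (p + int r) (q - int r + 1))
      (A.cyc (int r) (p + int r) (?n + 1)) (A.bdr (int r) (p + int r) (?n + 1))
      (coset (A.bdr (int r) (p + int r) (?n + 1)))"
    by (rule A.presents_page') (rule n)
  from presents_eq_zero_iff[OF this dx] zero have "d ?n x \<in> A.bdr (int r) (p + int r) (?n + 1)"
    unfolding x(2) A.diff_coset[OF x(1)] by simp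
  with x(1) have "x \<in> A.page_cyc (int r) p ?n" by (simp add: A.page_cyc_def)
  (* The next page only knows representatives in cyc (r + 1), so x is replaced by such a y; the two
     images under h then differ by an element of page_bdr as well. *)
  then obtain y where y: "y \<in> A.cyc (int r + 1) p ?n" "x - y \<in> A.page_bdr (int r) p ?n"
    using A.page_cyc_decompose by blast
  have "h ?n x - h ?n y \<in> B.page_bdr (int r) p ?n"
    using h_page_bdr[OF y(2)] h_diff[OF A.cyc_V[OF x(1)] A.cyc_V[OF y(1)]] by simp
  from B.next_class[OF h_cyc[OF x(1)] h_cyc[OF y(1)] this]
  show "page_map (Suc r) p q (ss_next A.E r p q (ss_boundaries A.E r p q +>\<^bsub>ss_page A.E r p q\<^esub> U))
      = ss_next B.E r p q (ss_boundaries B.E r p q +>\<^bsub>ss_page B.E r p q\<^esub> page_map r p q U)"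
    using page_map_coset[of y "Suc r" p q] y(1)
    unfolding x(2) page_map_coset[OF x(1)] A.next_class[OF x(1) y] by (simp add: add.commute)
qed

end


section \<open>Hochschild operators on multilinear functions\<close>

context dg_algebra
begin

text \<open>
  The operators are studied on functions of lists of pairs \<open>(m, a)\<close> with \<open>a\<close> of degree \<open>m\<close>.  The degree is
  carried along because it enters the signs but cannot be recovered from \<open>a = 0\<close>.
\<close>

definition graded :: "(nat \<times> 'a) list \<Rightarrow> bool" where
  "graded zs \<longleftrightarrow> (\<forall>z\<in>set zs. snd z \<in> gr (fst z))"

definition tdeg :: "(nat \<times> 'a) list \<Rightarrow> nat" where
  "tdeg zs = sum_list (map fst zs)"

definition linear_slot :: "nat \<Rightarrow> ('a \<Rightarrow> 'k) \<Rightarrow> bool" where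
  "linear_slot m g \<longleftrightarrow> (\<forall>x\<in>gr m. \<forall>y\<in>gr m. g (x + y) = g x + g y) \<and>
     (\<forall>c. \<forall>x\<in>gr m. g (scale c x) = c * g x)"

definition multilinear :: "nat \<Rightarrow> ((nat \<times> 'a) list \<Rightarrow> 'k) \<Rightarrow> bool" where
  "multilinear n F \<longleftrightarrow> (\<forall>us m ws. graded us \<longrightarrow> graded ws \<longrightarrow> length us + length ws + 1 = n \<longrightarrow>
     linear_slot m (\<lambda>x. F (us @ (m, x) # ws)))"

text \<open>
  \<open>mul j\<close> multiplies the entries \<open>j\<close> and \<open>j + 1\<close>.  The third equation only makes the function total.
\<close>

fun mul :: "nat \<Rightarrow> (nat \<times> 'a) list \<Rightarrow> (nat \<times> 'a) list" where
  "mul 0 ((m, a) # (l, b) # zs) = (m + l, a * b) # zs"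
| "mul (Suc j) (z # zs) = z # mul j zs"
| "mul _ zs = zs"

definition rot :: "(nat \<times> 'a) list \<Rightarrow> (nat \<times> 'a) list" where
  "rot zs = last zs # butlast zs"

definition koszul_sign :: "(nat \<times> 'a) list \<Rightarrow> 'k" where
  "koszul_sign zs = (-1) ^ (fst (last zs) * tdeg (butlast zs))"

text \<open>
  The function \<open>F \<circ> \<phi>\<^sup>\<otimes>\<^sup>n\<close> for the differential \<open>\<phi>\<^sup>\<otimes>\<^sup>n\<close> of the tensor power, by recursion on the list; \<open>dif_eq_sum\<close>
  is the closed formula.  In degree \<open>0\<close> the truncated \<open>fst z - 1\<close> is harmless: \<open>\<phi>\<close> vanishes there,
  and a multilinear \<open>F\<close> vanishes on lists with a zero entry.
\<close>

fun dif :: "(nat \<times> 'a) list \<Rightarrow> ((nat \<times> 'a) list \<Rightarrow> 'k) \<Rightarrow> 'k" where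
  "dif [] F = 0"
| "dif (z # zs) F = F ((fst z - 1, \<phi> (snd z)) # zs) + (-1) ^ fst z * dif zs (\<lambda>ws. F (z # ws))"

text \<open>
  The \<open>L + 1\<close> summands of \<open>b F\<close> on lists of length \<open>L + 1\<close>, for \<open>F\<close> on lists of length \<open>L\<close>.  The last one is
  written as a signed rotation followed by the multiplication of the first two entries.
\<close>

definition face :: "nat \<Rightarrow> nat \<Rightarrow> ((nat \<times> 'a) list \<Rightarrow> 'k) \<Rightarrow> (nat \<times> 'a) list \<Rightarrow> 'k" where
  "face L i F zs = (if i < L then F (mul i zs) else koszul_sign zs * F (mul 0 (rot zs)))"

definition hoch :: "nat \<Rightarrow> ((nat \<times> 'a) list \<Rightarrow> 'k) \<Rightarrow> (nat \<times> 'a) list \<Rightarrow> 'k" where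
  "hoch L F zs = (\<Sum>i\<le>L. (-1) ^ i * face L i F zs)"

lemma graded_simps [simp]:
  "graded []" "graded (z # zs) \<longleftrightarrow> snd z \<in> gr (fst z) \<and> graded zs"
  "graded (us @ ws) \<longleftrightarrow> graded us \<and> graded ws"
  by (auto simp: graded_def)

lemma tdeg_simps [simp]:
  "tdeg [] = 0" "tdeg (z # zs) = fst z + tdeg zs" "tdeg (us @ ws) = tdeg us + tdeg ws"
  by (auto simp: tdeg_def)

lemma gr_0 [simp]: "0 \<in> gr m" and gr_add: "x \<in> gr m \<Longrightarrow> y \<in> gr m \<Longrightarrow> x + y \<in> gr m"
  and gr_scale: "x \<in> gr m \<Longrightarrow> scale c x \<in> gr m"
  using gr_subspace[of m] subspace_0 subspace_add subspace_scale by auto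

lemma phi_0 [simp]: "\<phi> 0 = 0"
  using phi_phi phi_degree_0[OF gr_0] by blast

lemma phi_gr: "x \<in> gr m \<Longrightarrow> \<phi> x \<in> gr (m - 1)"
  using phi_degree phi_degree_0 by (cases m) auto

lemma linear_slot_0: "linear_slot m g \<Longrightarrow> g 0 = 0"
  unfolding linear_slot_def using gr_0[of m] scale_zero_left[of 0] by (metis mult_zero_left)



lemma multilinear_slot: "multilinear (length us + length ws + 1) F \<Longrightarrow> graded us \<Longrightarrow> graded ws \<Longrightarrow>
    linear_slot m (\<lambda>x. F (us @ (m, x) # ws))"
  by (simp add: multilinear_def)

text \<open>
  The definition treats all slots alike, as is needed for rotations; splitting off the first slot
  allows induction along the list.
\<close>

lemma multilinear_Suc:
  "multilinear (Suc n) F \<longleftrightarrow>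
     (\<forall>m ws. graded ws \<longrightarrow> length ws = n \<longrightarrow> linear_slot m (\<lambda>x. F ((m, x) # ws))) \<and>
     (\<forall>z. snd z \<in> gr (fst z) \<longrightarrow> multilinear n (\<lambda>ws. F (z # ws)))"
  (is "_ \<longleftrightarrow> ?first \<and> ?rest")
proof (intro iffI conjI)
  assume F: "multilinear (Suc n) F"
  show ?first using multilinear_slot[of "[]" _ F] F by auto
  show ?rest
    unfolding multilinear_def using multilinear_slot[of "_ # _" _ F] F by auto
next
  assume F: "?first \<and> ?rest"
  show "multilinear (Suc n) F"
    unfolding multilinear_def
  proof (intro allI impI)
    fix us m ws assume "graded us" "graded ws" "length us + length ws + 1 = Suc n"
    then show "linear_slot m (\<lambda>x. F (us @ (m, x) # ws))"
      using F by (cases us) (auto simp: multilinear_def)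
  qed
qed

lemma multilinear_first:
  "multilinear (Suc n) F \<Longrightarrow> graded ws \<Longrightarrow> length ws = n \<Longrightarrow> linear_slot m (\<lambda>x. F ((m, x) # ws))"
  by (simp add: multilinear_Suc)

lemma multilinear_Cons:
  "multilinear (Suc n) F \<Longrightarrow> snd z \<in> gr (fst z) \<Longrightarrow> multilinear n (\<lambda>ws. F (z # ws))"
  unfolding multilinear_Suc by blast

lemma linear_slot_sum:
  "(\<And>i. i \<in> I \<Longrightarrow> linear_slot m (g i)) \<Longrightarrow> linear_slot m (\<lambda>x. \<Sum>i\<in>I. c i * g i x)"
  by (simp add: linear_slot_def sum.distrib[symmetric] sum_distrib_left algebra_simps)

lemma multilinear_sum:
  "(\<And>i. i \<in> I \<Longrightarrow> multilinear n (F i)) \<Longrightarrow> multilinear n (\<lambda>zs. \<Sum>i\<in>I. c i * F i zs)"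
  unfolding multilinear_def by (intro allI impI linear_slot_sum) blast

lemma graded_mul: "graded zs \<Longrightarrow> graded (mul j zs)"
  by (induction j zs rule: mul.induct) (auto simp: gr_mult)

lemma length_mul: "Suc j < length zs \<Longrightarrow> length (mul j zs) = length zs - 1"
  by (induction j zs rule: mul.induct) auto

lemma tdeg_mul [simp]: "tdeg (mul j zs) = tdeg zs"
  by (induction j zs rule: mul.induct) auto

text \<open>
  The induction follows the recursion of \<open>mul\<close>, so only the product of the first two entries has to
  be examined, where linearity is distributivity.
\<close>

lemma multilinear_mul:
  assumes "multilinear n F" "j < n"
  shows "multilinear (Suc n) (\<lambda>zs. F (mul j zs))"
  using assms
proof (induction j arbitrary: n F)
  case 0
  then obtain k where n: "n = Suc k" by (cases n) auto
  have F: "linear_slot m (\<lambda>x. F ((m, x) # ws))" if "graded ws" "length ws = k" for m ws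
    using multilinear_first[of k F ws] 0 that n by simp
  have "linear_slot m (\<lambda>x. F (mul 0 ((m, x) # ws)))" if g: "graded ws" "length ws = n" for m ws
  proof -
    obtain z vs where ws: "ws = z # vs" using g n by (cases ws) auto
    then show ?thesis
      using F[of vs "m + fst z"] g n gr_mult[of _ m "snd z" "fst z"]
      by (cases z) (auto simp: linear_slot_def distrib_right scale_mult_left)
  qed
  moreover have "multilinear n (\<lambda>ws. F (mul 0 (z # ws)))" if z: "snd z \<in> gr (fst z)" for z
    unfolding n multilinear_Suc
  proof (intro conjI allI impI)
    fix m and vs :: "(nat \<times> 'a) list" assume "graded vs" "length vs = k"
    then show "linear_slot m (\<lambda>x. F (mul 0 (z # (m, x) # vs)))"
      using F[of vs "fst z + m"] z gr_mult[of "snd z" "fst z" _ m]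
      by (cases z) (auto simp: linear_slot_def distrib_left scale_mult_right)
  next
    fix w :: "nat \<times> 'a" assume "snd w \<in> gr (fst w)"
    then show "multilinear k (\<lambda>ws. F (mul 0 (z # w # ws)))"
      using multilinear_Cons[of k F "(fst z + fst w, snd z * snd w)"] 0 z n gr_mult
      by (cases z; cases w) auto
  qed
  ultimately show ?case by (simp add: multilinear_Suc)
next
  case (Suc j)
  then obtain k where n: "n = Suc k" by (cases n) auto
  show ?case
    unfolding multilinear_Suc[of n]
  proof (intro conjI allI impI)
    fix m and ws :: "(nat \<times> 'a) list" assume "graded ws" "length ws = n"
    then show "linear_slot m (\<lambda>x. F (mul (Suc j) ((m, x) # ws)))"
      using multilinear_first[of k F "mul j ws"] Suc.prems n by (simp add: graded_mul length_mul)
  next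
    fix z :: "nat \<times> 'a" assume "snd z \<in> gr (fst z)"
    then show "multilinear n (\<lambda>ws. F (mul (Suc j) (z # ws)))"
      using Suc.IH[of k "\<lambda>ws. F (z # ws)"] multilinear_Cons[of k F z] Suc.prems n by simp
  qed
qed

lemma rot_simps [simp]: "rot (ws @ [z]) = z # ws"
  by (simp add: rot_def)

lemma koszul_sign_simps [simp]: "koszul_sign (ws @ [z]) = (-1) ^ (fst z * tdeg ws)"
  by (simp add: koszul_sign_def)

lemma length_rot: "zs \<noteq> [] \<Longrightarrow> length (rot zs) = length zs"
  by (simp add: rot_def)

lemma graded_rot: "graded zs \<Longrightarrow> zs \<noteq> [] \<Longrightarrow> graded (rot zs)"
  by (cases zs rule: rev_cases) auto

lemma tdeg_rot: "zs \<noteq> [] \<Longrightarrow> tdeg (rot zs) = tdeg zs"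
  by (cases zs rule: rev_cases) auto

lemma multilinear_rot:
  assumes F: "multilinear n F"
  shows "multilinear n (\<lambda>zs. koszul_sign zs * F (rot zs))"
  unfolding multilinear_def
proof (intro allI impI)
  fix us m ws assume g: "graded us" "graded ws" "length us + length ws + 1 = n"
  show "linear_slot m (\<lambda>x. koszul_sign (us @ (m, x) # ws) * F (rot (us @ (m, x) # ws)))"
  proof (cases ws rule: rev_cases)
    case Nil
    then show ?thesis
      using multilinear_slot[of "[]" us F m] F g by (simp add: linear_slot_def algebra_simps)
  next
    case (snoc vs z)
    have eq: "us @ (m, x) # ws = (us @ (m, x) # vs) @ [z]" for x by (simp add: snoc)
    show ?thesis
      unfolding eq rot_simps koszul_sign_simps
      using multilinear_slot[of "z # us" vs F m] F g snoc
      by (simp add: linear_slot_def algebra_simps)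
  qed
qed

lemma multilinear_face:
  assumes "multilinear L F" "0 < L"
  shows "multilinear (Suc L) (face L i F)"
proof (cases "i < L")
  case True
  then show ?thesis using multilinear_mul[OF assms(1)] by (simp add: face_def[abs_def])
next
  case False
  then show ?thesis
    using multilinear_rot[OF multilinear_mul[OF assms]] by (simp add: face_def[abs_def])
qed

lemma multilinear_hoch: "multilinear L F \<Longrightarrow> 0 < L \<Longrightarrow> multilinear (Suc L) (hoch L F)"
  unfolding hoch_def[abs_def] by (intro multilinear_sum multilinear_face)

lemma hoch_cong:
  assumes "\<And>ws. graded ws \<Longrightarrow> length ws = L \<Longrightarrow> F ws = G ws" "0 < L" "graded zs" "length zs = Suc L"
  shows "hoch L F zs = hoch L G zs"
proof -
  have ne: "zs \<noteq> []" using assms(4) by auto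
  then have "face L i F zs = face L i G zs" for i
    using assms graded_rot[OF assms(3) ne] length_rot[OF ne]
    by (simp add: face_def graded_mul length_mul)
  then show ?thesis by (simp add: hoch_def)
qed

lemma hoch_cmult: "hoch L (\<lambda>ws. c * F ws) zs = c * hoch L F zs"
  unfolding hoch_def face_def by (simp add: sum_distrib_left algebra_simps if_distrib cong: if_cong)

lemma hoch_add: "hoch L (\<lambda>ws. F ws + G ws) zs = hoch L F zs + hoch L G zs"
  unfolding hoch_def face_def
  by (simp add: sum.distrib[symmetric] algebra_simps if_distrib cong: if_cong)

subsection \<open>The Hochschild differential squares to zero\<close>

text \<open>
  The simplicial identity for two multiplications: they commute when they are apart, and for \<open>i = j\<close> it is
  associativity.
\<close>

lemma mul_mul: "i \<le> j \<Longrightarrow> j + 2 < length zs \<Longrightarrow> mul i (mul (Suc j) zs) = mul j (mul i zs)"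
proof (induction i arbitrary: j zs)
  case 0
  then have "Suc (Suc (Suc 0)) \<le> length zs" by simp
  then obtain z1 z2 z3 vs where zs: "zs = z1 # z2 # z3 # vs" unfolding Suc_le_length_iff by blast
  show ?case
  proof (cases j)
    case 0
    then show ?thesis by (cases z1; cases z2; cases z3) (simp add: zs mult.assoc add.assoc)
  next
    case (Suc k)
    then show ?thesis by (cases z1; cases z2) (simp add: zs)
  qed
next
  case (Suc i)
  then obtain k z vs where "j = Suc k" "zs = z # vs" by (cases j; cases zs) auto
  then show ?case using Suc by simp
qed

lemma mul_append: "Suc j < length ws \<Longrightarrow> mul j (ws @ vs) = mul j ws @ vs"
  by (induction j ws rule: mul.induct) auto

lemma mul_snoc2: "mul (length ws) (ws @ [x, y]) = ws @ [(fst x + fst y, snd x * snd y)]"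
  by (induction ws) (cases x; cases y; auto)+

lemma mul_rot: "j + 2 < length zs \<Longrightarrow> mul (Suc j) (rot zs) = rot (mul j zs)"
  by (cases zs rule: rev_cases) (auto simp: mul_append)

lemma koszul_sign_mul: "j + 2 < length zs \<Longrightarrow> koszul_sign (mul j zs) = koszul_sign zs"
  by (cases zs rule: rev_cases) (auto simp: mul_append)

lemma last_two:
  assumes "length zs = Suc (Suc n)"
  obtains ws x y where "zs = ws @ [x, y]" "length ws = n"
  using assms by (metis append.assoc append_Cons append_Nil length_Suc_conv_rev)

text \<open>
  Multiplying the last two entries and rotating is the same as rotating twice and multiplying the
  first two entries.
\<close>

lemma rot_mul_last:
  assumes "length zs = n + 2"
  shows "rot (mul n zs) = mul 0 (rot (rot zs))"
proof -
  obtain ws x y where zs: "zs = ws @ [x, y]" "length ws = n" using last_two[of zs n] assms by (metis add_2_eq_Suc')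
  then have "rot (rot zs) = x # y # ws"
    using rot_simps[of "ws @ [x]" y] rot_simps[of "y # ws" x] by simp
  then show ?thesis using zs mul_snoc2[of ws x y] by (cases x; cases y) simp
qed

text \<open>
  The two signs differ by \<open>(-1) ^ (2 * \<bar>x\<bar> * \<bar>y\<bar>)\<close>, where \<open>x\<close> and \<open>y\<close> are the last two entries: each of them
  is moved past the other once.
\<close>

lemma koszul_sign_mul_last:
  assumes "length zs = n + 2"
  shows "koszul_sign (mul n zs) = koszul_sign zs * koszul_sign (rot zs)"
proof -
  obtain ws x y where zs: "zs = ws @ [x, y]" "length ws = n" using last_two[of zs n] assms by (metis add_2_eq_Suc')
  have "koszul_sign zs = (-1) ^ (fst y * (tdeg ws + fst x))" "koszul_sign (rot zs) = (-1) ^ (fst x * (fst y + tdeg ws))"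
    using koszul_sign_simps[of "ws @ [x]" y] rot_simps[of "ws @ [x]" y] koszul_sign_simps[of "y # ws" x] zs by auto
  moreover have "koszul_sign (mul n zs) = (-1) ^ ((fst x + fst y) * tdeg ws)"
    using zs mul_snoc2[of ws x y] by simp
  moreover have "fst y * (tdeg ws + fst x) + fst x * (fst y + tdeg ws)
      = (fst x + fst y) * tdeg ws + 2 * (fst x * fst y)" by (simp add: algebra_simps)
  ultimately show ?thesis by (simp add: power_add[symmetric]) (simp add: power_add power_mult)
qed

text \<open>
  The simplicial identities, including the last face.  With \<open>t\<close> for the rotation and \<open>d\<^sub>i\<close> for the
  multiplications, the last face is \<open>d\<^sub>0 t\<close>, and the cases with a last face reduce to
  \<open>d\<^sub>i\<^sub>+\<^sub>1 t = t d\<^sub>i\<close> and, for two last faces, to \<open>t d\<^sub>L = d\<^sub>0 t t\<close> together with \<open>d\<^sub>0 d\<^sub>1 = d\<^sub>0 d\<^sub>0\<close>.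
\<close>

lemma face_face:
  assumes "i \<le> j" "j \<le> L" "0 < L" "length zs = L + 2"
  shows "face (Suc L) (Suc j) (face L i F) zs = face (Suc L) i (face L j F) zs"
proof -
  have ne: "zs \<noteq> []" using assms(4) by auto
  have len: "length (rot zs) = L + 2" using length_rot[OF ne] assms(4) by simp
  then have ne': "rot zs \<noteq> []" by auto
  have len': "length (rot (rot zs)) = L + 2" using length_rot[OF ne'] len by simp
  consider "j < L" | "j = L" "i < L" | "j = L" "i = L" using assms by linarith
  then show ?thesis
  proof cases
    case 1
    then show ?thesis using assms mul_mul[of i j zs] by (simp add: face_def)
  next
    case 2
    then show ?thesis
      using assms mul_rot[of i zs] koszul_sign_mul[of i zs] mul_mul[of 0 i "rot zs"] len by (simp add: face_def)
  next
    case 3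
    have "rot (mul L zs) = mul 0 (rot (rot zs))" "koszul_sign (mul L zs) = koszul_sign zs * koszul_sign (rot zs)"
      using rot_mul_last koszul_sign_mul_last assms(4) by blast+
    moreover have "rot (mul 0 (rot zs)) = mul 1 (rot (rot zs))"
      using mul_rot[of 0 "rot zs"] len assms(3) by simp
    moreover have "mul 0 (mul 1 (rot (rot zs))) = mul 0 (mul 0 (rot (rot zs)))"
      using mul_mul[of 0 0 "rot (rot zs)"] len' assms(3) by simp
    moreover have "koszul_sign (mul 0 (rot zs)) = koszul_sign (rot zs)"
      using koszul_sign_mul[of 0 "rot zs"] len assms(3) by simp
    ultimately show ?thesis using 3 by (simp add: face_def)
  qed
qed

text \<open>
  The summands with \<open>i < j\<close> cancel against those with \<open>j \<le> i\<close> under \<open>(j, i) \<mapsto> (i, j - 1)\<close>, which preserves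
  \<open>T\<close> and changes the sign.
\<close>

lemma simplicial_cancel:
  fixes T :: "nat \<Rightarrow> nat \<Rightarrow> 'b::comm_ring_1"
  assumes T: "\<And>i j. i \<le> j \<Longrightarrow> j \<le> L \<Longrightarrow> T (Suc j) i = T i j"
  shows "(\<Sum>j\<le>Suc L. (-1) ^ j * (\<Sum>i\<le>L. (-1) ^ i * T j i)) = 0"
proof -
  let ?f = "\<lambda>(j, i). (-1) ^ (j + i) * T j i"
  let ?A = "{(j, i). i < j \<and> j \<le> Suc L}" and ?B = "{(j, i). j \<le> i \<and> i \<le> L}"
  have fin: "finite ?A" "finite ?B"
    by (rule finite_subset[of _ "{..Suc L} \<times> {..Suc L}"]; auto)+
  have "(\<Sum>j\<le>Suc L. (-1) ^ j * (\<Sum>i\<le>L. (-1) ^ i * T j i)) = sum ?f ({..Suc L} \<times> {..L})"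
    by (simp add: sum.cartesian_product[symmetric] sum_distrib_left power_add mult.assoc del: sum.atMost_Suc)
  also have "{..Suc L} \<times> {..L} = ?A \<union> ?B" by auto
  also have "sum ?f (?A \<union> ?B) = sum ?f ?A + sum ?f ?B"
    using fin by (intro sum.union_disjoint) auto
  also have "sum ?f ?A = sum (\<lambda>x. - ?f x) ?B"
    by (rule sum.reindex_bij_witness[of _ "\<lambda>(i, j). (Suc j, i)" "\<lambda>(j, i). (i, j - 1)"])
      (auto simp: T[symmetric] add.commute dest!: less_imp_Suc_add)
  finally show ?thesis by (simp add: sum_negf)
qed

lemma hoch_hoch:
  assumes "0 < L" "length zs = L + 2"
  shows "hoch (Suc L) (hoch L F) zs = 0"
proof -
  have "face (Suc L) j (hoch L F) zs = (\<Sum>i\<le>L. (-1) ^ i * face (Suc L) j (face L i F) zs)" for j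
    unfolding face_def[of "Suc L"] hoch_def by (simp add: sum_distrib_left algebra_simps)
  then show ?thesis
    unfolding hoch_def[of "Suc L"]
    using simplicial_cancel[of L "\<lambda>j i. face (Suc L) j (face L i F) zs"] face_face[OF _ _ assms]
    by (simp del: sum.atMost_Suc)
qed

subsection \<open>Compatibility with the internal differential\<close>

lemma dif_sum: "dif zs (\<lambda>ws. \<Sum>i\<in>I. c i * F i ws) = (\<Sum>i\<in>I. c i * dif zs (F i))"
proof (induction zs arbitrary: F)
  case (Cons z zs)
  then show ?case by (simp add: sum.distrib[symmetric] sum_distrib_left algebra_simps)
qed simp

lemma dif_cmult: "dif zs (\<lambda>ws. c * F ws) = c * dif zs F"
  using dif_sum[of zs "\<lambda>_. c" "\<lambda>_. F" "{()}"] by simp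

lemma dif_eq_sum:
  "dif zs F = (\<Sum>i<length zs. (-1) ^ tdeg (take i zs) *
     F (zs[i := (fst (zs ! i) - 1, \<phi> (snd (zs ! i)))]))"
proof (induction zs arbitrary: F)
  case (Cons z zs)
  show ?case
    unfolding length_Cons sum.lessThan_Suc_shift
    by (simp add: Cons.IH sum_distrib_left power_add mult.assoc)
qed simp

lemma dif_cong:
  assumes "graded zs" "\<And>us. graded us \<Longrightarrow> length us = length zs \<Longrightarrow> F us = G us"
  shows "dif zs F = dif zs G"
  using assms
proof (induction zs arbitrary: F G)
  case (Cons z zs)
  have "dif zs (\<lambda>ws. F (z # ws)) = dif zs (\<lambda>ws. G (z # ws))"
    using Cons.prems by (intro Cons.IH) auto
  moreover have "F ((fst z - 1, \<phi> (snd z)) # zs) = G ((fst z - 1, \<phi> (snd z)) # zs)"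
    using Cons.prems phi_gr by (intro Cons.prems(2)) auto
  ultimately show ?case by simp
qed simp

lemma dif_append:
  "dif (zs @ ws) F = dif zs (\<lambda>us. F (us @ ws)) + (-1) ^ tdeg zs * dif ws (\<lambda>vs. F (zs @ vs))"
  by (induction zs arbitrary: F) (simp_all add: algebra_simps power_add)

lemma dif_add: "dif zs (\<lambda>ws. F ws + G ws) = dif zs F + dif zs G"
  by (induction zs arbitrary: F G) (simp_all add: algebra_simps)

lemma dif_zero: "dif zs (\<lambda>ws. 0) = 0"
  by (induction zs) simp_all

text \<open>
  The mixed terms, in which \<open>\<phi>\<close> is applied to the first entry and to a later one, occur in both orders
  with opposite signs.
\<close>

lemma dif_dif:
  assumes "multilinear (length zs) F" "graded zs"
  shows "dif zs (\<lambda>ws. dif ws F) = 0"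
  using assms
proof (induction zs arbitrary: F)
  case (Cons z zs)
  let ?F' = "\<lambda>ws. F ((fst z - 1, \<phi> (snd z)) # ws)"
  have F0: "F ((i, 0) # ws) = 0" if "graded ws" "length ws = length zs" for i ws
    using linear_slot_0[OF multilinear_first[of "length zs" F ws]] Cons.prems that by simp
  have "dif zs (\<lambda>ws. dif ws (\<lambda>ws. F (z # ws))) = 0"
    using Cons.IH[of "\<lambda>ws. F (z # ws)"] multilinear_Cons[of "length zs" F z] Cons.prems by simp
  moreover have "(-1) ^ (fst z - 1) * dif zs ?F' + (-1) ^ fst z * dif zs ?F' = 0"
  proof (cases "fst z")
    case 0
    then have "\<phi> (snd z) = 0" using Cons.prems phi_degree_0 by simp
    then have "dif zs ?F' = dif zs (\<lambda>ws. 0)" using F0 Cons.prems by (intro dif_cong) auto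
    then show ?thesis by (simp add: dif_zero)
  qed simp
  ultimately show ?case
    using F0 Cons.prems by (simp add: dif_add dif_cmult phi_phi distrib_left)
qed simp

text \<open>
  Multiplication is a chain map by the Leibniz rule.  Off the two multiplied entries the recursions of \<open>dif\<close>
  and \<open>mul\<close> agree step by step.
\<close>

lemma dif_mul:
  assumes "multilinear n F" "graded zs" "length zs = Suc n" "j < n"
  shows "dif zs (\<lambda>ws. F (mul j ws)) = dif (mul j zs) F"
  using assms
proof (induction j arbitrary: n F zs)
  case 0
  then have "Suc (Suc 0) \<le> length zs" by simp
  then obtain m a l b ws where zs: "zs = (m, a) # (l, b) # ws"
    unfolding Suc_le_length_iff by auto
  then obtain k where n: "n = Suc k" and k: "length ws = k" using 0 by (cases n) auto
  have g: "a \<in> gr m" "b \<in> gr l" "graded ws" using 0 zs by auto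
  have F: "linear_slot i (\<lambda>x. F ((i, x) # ws))" for i
    using multilinear_first[of k F ws] 0 n g k by simp
  have F0: "F ((i, 0) # ws) = 0" for i using linear_slot_0[OF F] .
  (* The degrees in the two products are m - 1 + l and m + (l - 1) with truncated subtraction; they
     equal m + l - 1 except when the corresponding value of phi is zero. *)
  have step: "F ((m + l - 1, \<phi> (a * b)) # ws)
      = F ((m - 1 + l, \<phi> a * b) # ws) + (-1) ^ m * F ((m + (l - 1), a * \<phi> b) # ws)"
  proof (cases "m = 0 \<and> l = 0")
    case True
    then show ?thesis using leibniz[OF g(1), of b] g phi_degree_0 F0 by simp
  next
    case False
    let ?i = "m + l - 1"
    have 1: "F ((m - 1 + l, \<phi> a * b) # ws) = F ((?i, \<phi> a * b) # ws)"
      using g(1) phi_degree_0[of a] F0 by (cases m) auto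
    have 2: "F ((m + (l - 1), a * \<phi> b) # ws) = F ((?i, a * \<phi> b) # ws)"
      using g(2) phi_degree_0[of b] F0 by (cases l) auto
    have m1: "\<phi> a * b \<in> gr ?i"
      using g phi_degree[of a] phi_degree_0[of a] gr_mult[of "\<phi> a" "m - 1" b l] by (cases m) auto
    have m2: "a * \<phi> b \<in> gr ?i"
      using g phi_degree[of b] phi_degree_0[of b] gr_mult[of a m "\<phi> b" "l - 1"] by (cases l) auto
    show ?thesis
      unfolding 1 2 leibniz[OF g(1)]
      using F[of ?i] m1 m2 gr_scale[OF m2, of "(-1) ^ m"] by (simp add: linear_slot_def)
  qed
  show ?case using step by (simp add: zs power_add distrib_left mult.assoc)
next
  case (Suc j)
  then obtain k where n: "n = Suc k" by (cases n) auto
  obtain z ws where zs: "zs = z # ws" using Suc by (cases zs) auto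
  have "dif ws (\<lambda>ws. F (z # mul j ws)) = dif (mul j ws) (\<lambda>ws. F (z # ws))"
    using Suc zs n multilinear_Cons[of k F z] by (intro Suc.IH[of k]) auto
  then show ?case by (simp add: zs)
qed

text \<open>
  Every summand of \<open>dif\<close> lowers the total degree by one, so a sign \<open>e ^ deg\<close> is extracted at the cost of one
  factor \<open>e\<close>.
\<close>

lemma dif_sign:
  assumes "multilinear (length zs) F" "graded zs" and e: "e * e = (1 :: 'k)"
  shows "dif zs (\<lambda>ws. e ^ tdeg ws * F ws) = e * e ^ tdeg zs * dif zs F"
  using assms(1,2)
proof (induction zs arbitrary: F)
  case (Cons z zs)
  have g: "snd z \<in> gr (fst z)" "graded zs" using Cons.prems by auto
  have F0: "F ((i, 0) # zs) = 0" for i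
    using linear_slot_0[OF multilinear_first[of "length zs" F zs]] Cons.prems by simp
  have "e ^ (fst z - 1 + tdeg zs) * F ((fst z - 1, \<phi> (snd z)) # zs)
      = e * e ^ (fst z + tdeg zs) * F ((fst z - 1, \<phi> (snd z)) # zs)"
  proof (cases "fst z")
    case 0
    then show ?thesis using g phi_degree_0[of "snd z"] F0 by simp
  next
    case (Suc m)
    have "e * (e * x) = x" for x using e by (simp add: mult.assoc[symmetric])
    then show ?thesis by (simp add: Suc mult.assoc)
  qed
  moreover have "dif zs (\<lambda>ws. e ^ (fst z + tdeg ws) * F (z # ws))
      = e ^ fst z * (e * e ^ tdeg zs * dif zs (\<lambda>ws. F (z # ws)))"
    using Cons.IH[of "\<lambda>ws. F (z # ws)"] multilinear_Cons[of "length zs" F z] Cons.prems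
      dif_cmult[of zs "e ^ fst z" "\<lambda>ws. e ^ tdeg ws * F (z # ws)"]
    by (simp add: power_add mult.assoc)
  ultimately show ?case by (simp add: algebra_simps power_add)
qed simp

text \<open>
  The signed rotation is a chain map.  Moving the last entry \<open>(m, a)\<close> to the front, the summands where \<open>\<phi>\<close> acts
  on another entry acquire \<open>(-1) ^ m\<close> from \<open>dif_sign\<close>, which is the sign of passing \<open>\<phi>\<close> over \<open>a\<close>.
\<close>

lemma dif_rot:
  assumes F: "multilinear (length zs) F" and g: "graded zs" and ne: "zs \<noteq> []"
  shows "dif zs (\<lambda>ws. koszul_sign ws * F (rot ws)) = koszul_sign zs * dif (rot zs) F"
proof -
  obtain ws m a where zs: "zs = ws @ [(m, a)]" using ne by (metis rev_exhaust prod.exhaust)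
  have gs: "graded ws" "a \<in> gr m" using g zs by auto
  have F0: "F ((i, 0) # ws) = 0" for i
    using linear_slot_0[OF multilinear_first[of "length ws" F ws]] F zs gs by simp
  let ?e = "(-1) ^ m :: 'k"
  have "dif ws (\<lambda>us. ?e ^ tdeg us * F ((m, a) # us)) = ?e * ?e ^ tdeg ws * dif ws (\<lambda>us. F ((m, a) # us))"
    using F zs gs multilinear_Cons[of "length ws" F "(m, a)"]
    by (intro dif_sign) (auto simp: power_add[symmetric] simp flip: mult_2)
  then have 1: "dif ws (\<lambda>us. koszul_sign (us @ [(m, a)]) * F (rot (us @ [(m, a)])))
      = ?e * ?e ^ tdeg ws * dif ws (\<lambda>us. F ((m, a) # us))"
    by (simp add: power_mult)
  have 2: "(-1) ^ tdeg ws * ((-1) ^ ((m - 1) * tdeg ws) * F ((m - 1, \<phi> a) # ws))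
      = ?e ^ tdeg ws * F ((m - 1, \<phi> a) # ws)"
  proof (cases m)
    case 0
    then show ?thesis using gs phi_degree_0[of a] F0 by simp
  next
    case (Suc i)
    have "((-1) ^ Suc i) ^ tdeg ws = (-1) ^ tdeg ws * ((-1) ^ (i * tdeg ws) :: 'k)"
      unfolding power_mult[symmetric] by (simp add: power_add)
    then show ?thesis by (simp only: Suc diff_Suc_1 mult.assoc)
  qed
  show ?thesis
    unfolding zs dif_append 1 using 2 by (simp add: power_mult algebra_simps)
qed

lemma dif_hoch:
  assumes F: "multilinear L F" and "0 < L" and g: "graded zs" and len: "length zs = Suc L"
  shows "dif zs (hoch L F) = hoch L (\<lambda>ws. dif ws F) zs"
proof -
  have ne: "zs \<noteq> []" using len by auto
  have "dif zs (face L i F) = face L i (\<lambda>ws. dif ws F) zs" for i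
  proof (cases "i < L")
    case True
    then show ?thesis using dif_mul[OF F g len] by (simp add: face_def[abs_def])
  next
    case False
    then show ?thesis
      using dif_rot[of zs "\<lambda>ws. F (mul 0 ws)"] multilinear_mul[OF F \<open>0 < L\<close>] g ne len
        dif_mul[OF F graded_rot[OF g ne], of 0] length_rot[OF ne] \<open>0 < L\<close>
      by (simp add: face_def[abs_def])
  qed
  then show ?thesis unfolding hoch_def[abs_def] dif_sum by simp
qed

subsection \<open>Cyclic invariance\<close>

text \<open>
  For \<open>\<Lambda>\<close>-invariant \<open>F\<close> the rotation of the arguments shifts the summands of \<open>b F\<close> by one, up to sign: the summand \<open>i + 1\<close> at
  the rotated list is the summand \<open>i\<close>, the summand \<open>0\<close> is the last one by definition, and the last
  one becomes the summand \<open>L - 1\<close>.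
\<close>

lemma hoch_cyclic:
  assumes F: "\<And>ws. graded ws \<Longrightarrow> length ws = L \<Longrightarrow> F ws = (-1) ^ (L - 1) * (koszul_sign ws * F (rot ws))"
    and "0 < L" and g: "graded zs" and len: "length zs = Suc L"
  shows "hoch L F zs = (-1) ^ L * (koszul_sign zs * hoch L F (rot zs))"
proof -
  obtain n where L: "L = Suc n" using \<open>0 < L\<close> by (cases L) auto
  let ?s = "koszul_sign zs"
  have mid: "(-1) ^ i * F (mul i zs) = (-1) ^ L * (?s * ((-1) ^ Suc i * F (mul (Suc i) (rot zs))))"
    if "i < n" for i
    using F[of "mul i zs"] g len that L
    by (simp add: graded_mul length_mul koszul_sign_mul mul_rot)
  have kk: "koszul_sign ws * (koszul_sign ws * x) = x" for ws x
    by (simp add: koszul_sign_def mult.assoc[symmetric] power_add[symmetric] flip: mult_2)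
  have last: "(-1) ^ n * F (mul n zs)
      = (-1) ^ L * (?s * ((-1) ^ L * (koszul_sign (rot zs) * F (mul 0 (rot (rot zs))))))"
    using F[of "mul n zs"] g len L rot_mul_last[of zs n] koszul_sign_mul_last[of zs n]
    by (simp add: graded_mul length_mul algebra_simps)
  have "hoch L F zs = (\<Sum>i<n. (-1) ^ i * F (mul i zs)) + (-1) ^ n * F (mul n zs)
      + (-1) ^ L * (?s * F (mul 0 (rot zs)))"
    by (simp add: hoch_def L face_def lessThan_Suc_atMost[symmetric])
  also have "\<dots> = (-1) ^ L * (?s * (F (mul 0 (rot zs))
      + (\<Sum>i<n. (-1) ^ Suc i * F (mul (Suc i) (rot zs)))
      + (-1) ^ L * (koszul_sign (rot zs) * F (mul 0 (rot (rot zs))))))"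
    unfolding last using mid by (simp add: sum_distrib_left distrib_left algebra_simps)
  also have "F (mul 0 (rot zs)) + (\<Sum>i<n. (-1) ^ Suc i * F (mul (Suc i) (rot zs)))
      = (\<Sum>i<Suc n. (-1) ^ i * F (mul i (rot zs)))"
    unfolding sum.lessThan_Suc_shift by simp
  also have "\<dots> + (-1) ^ L * (koszul_sign (rot zs) * F (mul 0 (rot (rot zs)))) = hoch L F (rot zs)"
    by (simp add: hoch_def L face_def lessThan_Suc_atMost[symmetric])
  finally show ?thesis .
qed

lemma dif_cyclic:
  assumes F: "\<And>ws. graded ws \<Longrightarrow> length ws = Suc n \<Longrightarrow> F ws = (-1) ^ n * (koszul_sign ws * F (rot ws))"
    and lin: "multilinear (Suc n) F" and g: "graded zs" and len: "length zs = Suc n"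
  shows "dif zs F = (-1) ^ n * (koszul_sign zs * dif (rot zs) F)"
proof -
  have "dif zs F = dif zs (\<lambda>ws. (-1) ^ n * (koszul_sign ws * F (rot ws)))"
    using F len by (intro dif_cong[OF g]) auto
  also have "\<dots> = (-1) ^ n * (koszul_sign zs * dif (rot zs) F)"
    using dif_rot[of zs F] lin g len unfolding dif_cmult by fastforce
  finally show ?thesis .
qed

end


section \<open>Tensor powers\<close>

lemma vector_space_fun_scale: "vector_space (fun_scale :: 'k::field \<Rightarrow> ('x \<Rightarrow> 'k) \<Rightarrow> 'x \<Rightarrow> 'k)"
  by unfold_locales (auto simp: fun_scale_def fun_eq_iff algebra_simps)

lemma vector_space_mult: "vector_space ((*) :: 'k::field \<Rightarrow> 'k \<Rightarrow> 'k)"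
  by unfold_locales (auto simp: algebra_simps)

lemma presents_field:
  "presents (*) (module_of (*) UNIV) (UNIV :: 'k::field set) {0} (\<lambda>y. y)"
proof -
  interpret vector_space "(*) :: 'k \<Rightarrow> 'k \<Rightarrow> 'k" by (rule vector_space_mult)
  show ?thesis by (intro presents_module_of vector_space_axioms subspace_UNIV)
qed

interpretation fs: vector_space "fun_scale :: 'k::field \<Rightarrow> ('x \<Rightarrow> 'k) \<Rightarrow> 'x \<Rightarrow> 'k"
  by (rule vector_space_fun_scale)

lemma inj_basis_vec: "inj (basis_vec :: 'a list \<Rightarrow> 'a list \<Rightarrow> 'k::field)"
  by (rule injI) (metis basis_vec_def one_neq_zero)

text \<open>
  Independence holds because the span of the other basis vectors consists of functions that vanish
  at \<open>as\<close>.  Its consequence \<open>free_lift_exists\<close> is the universal property of the free space.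
\<close>

lemma independent_basis_vec: "\<not> fs.dependent (range (basis_vec :: 'a list \<Rightarrow> 'a list \<Rightarrow> 'k::field))"
proof
  let ?B = "range (basis_vec :: 'a list \<Rightarrow> 'a list \<Rightarrow> 'k)"
  assume "fs.dependent ?B"
  then obtain as where as: "basis_vec as \<in> fs.span (?B - {basis_vec as})"
    unfolding fs.dependent_def by blast
  have "fs.span (?B - {basis_vec as}) \<subseteq> {v. v as = 0}"
    by (rule fs.span_minimal)
      (auto simp: basis_vec_def fun_scale_def intro!: fs.subspaceI)
  with as show False by (auto simp: basis_vec_def)
qed

lemma free_lift_exists:
  assumes "vector_space s"
  shows "\<exists>L. Vector_Spaces.linear (fun_scale :: 'k::field \<Rightarrow> ('a list \<Rightarrow> 'k) \<Rightarrow> _) s L \<and>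
    (\<forall>as. L (basis_vec as) = \<Psi> as)"
proof -
  interpret s: vector_space s by fact
  interpret vector_space_pair "fun_scale :: 'k \<Rightarrow> ('a list \<Rightarrow> 'k) \<Rightarrow> _" s by unfold_locales
  let ?b = "basis_vec :: 'a list \<Rightarrow> 'a list \<Rightarrow> 'k"
  obtain L where "Vector_Spaces.linear fun_scale s L"
    "\<forall>v\<in>range ?b. L v = \<Psi> (inv_into UNIV ?b v)"
    using linear_independent_extend[OF independent_basis_vec, of "\<lambda>v. \<Psi> (inv_into UNIV ?b v)"]
    by blast
  moreover have "inj ?b" by (rule inj_basis_vec)
  ultimately show ?thesis by (intro exI[of _ L]) simp
qed

context dg_algebra
begin

subsection \<open>Homogeneous components\<close>

definition component :: "nat \<Rightarrow> 'a \<Rightarrow> 'a" where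
  "component m x =
     (THE c. (\<forall>m. c m \<in> gr m) \<and> finite {m. c m \<noteq> 0} \<and> x = (\<Sum>m | c m \<noteq> 0. c m)) m"

lemma component_gr: "component m x \<in> gr m"
  and finite_component: "finite {m. component m x \<noteq> 0}"
  and sum_component: "x = (\<Sum>m | component m x \<noteq> 0. component m x)"
  using theI'[OF gr_direct_sum[of x]] by (auto simp: component_def)

text \<open>
  The index set \<open>S\<close> may contain indices with zero component, so that decompositions of two elements can be
  compared over a common set.
\<close>

lemma component_unique:
  assumes "\<And>m. c m \<in> gr m" "finite S" "\<And>m. m \<notin> S \<Longrightarrow> c m = 0" "x = (\<Sum>m\<in>S. c m)"
  shows "component m x = c m"
proof -
  have fin: "finite {m. c m \<noteq> 0}" using assms(2,3) by (rule_tac finite_subset[of _ S]) auto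
  have "x = (\<Sum>m | c m \<noteq> 0. c m)"
    unfolding assms(4) using assms(2,3) by (intro sum.mono_neutral_right) auto
  then have "(THE c. (\<forall>m. c m \<in> gr m) \<and> finite {m. c m \<noteq> 0} \<and> x = (\<Sum>m | c m \<noteq> 0. c m)) = c"
    using the1_equality[OF gr_direct_sum[of x], of c] assms(1) fin by blast
  then show ?thesis by (simp add: component_def)
qed

lemma sum_component_superset:
  assumes "finite S" "{m. component m x \<noteq> 0} \<subseteq> S" "\<And>m. g m 0 = 0"
  shows "(\<Sum>m | component m x \<noteq> 0. g m (component m x)) = (\<Sum>m\<in>S. g m (component m x))"
  using assms by (intro sum.mono_neutral_left) auto

lemma component_add: "component m (x + y) = component m x + component m y"
proof (rule component_unique[of "\<lambda>m. component m x + component m y"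
      "{m. component m x \<noteq> 0} \<union> {m. component m y \<noteq> 0}"])
  let ?S = "{m. component m x \<noteq> 0} \<union> {m. component m y \<noteq> 0}"
  show fin: "finite ?S" using finite_component by simp
  have "x = (\<Sum>m\<in>?S. component m x)" "y = (\<Sum>m\<in>?S. component m y)"
    using sum_component_superset[OF fin, of _ "\<lambda>m z. z"] sum_component by auto
  then show "x + y = (\<Sum>m\<in>?S. component m x + component m y)" by (simp add: sum.distrib)
qed (auto intro: gr_add component_gr)

lemma component_scale: "component m (scale c x) = scale c (component m x)"
proof (rule component_unique[of "\<lambda>m. scale c (component m x)" "{m. component m x \<noteq> 0}"])
  show "scale c x = (\<Sum>m | component m x \<noteq> 0. scale c (component m x))"
    using sum_component[of x] scale_sum_right by metis
qed (auto intro: gr_scale component_gr finite_component)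

lemma component_of_homogeneous:
  assumes "x \<in> gr l"
  shows "component m x = (if m = l then x else 0)"
  by (rule component_unique[of "\<lambda>m. if m = l then x else 0" "{l}"]) (use assms in auto)

text \<open>
  The linear operator \<open>a \<mapsto> (-1) ^ \<bar>a\<bar> a\<close>.  It makes the Koszul signs in \<open>\<phi>\<^sup>\<otimes>\<^sup>n\<close> part of a formula that is
  multilinear on all of \<open>A\<close>, not only on homogeneous elements.
\<close>

definition parity :: "'a \<Rightarrow> 'a" where
  "parity x = (\<Sum>m | component m x \<noteq> 0. scale ((-1) ^ m) (component m x))"

lemma parity_of_homogeneous:
  assumes "x \<in> gr m"
  shows "parity x = scale ((-1) ^ m) x"
proof -
  have "{l. component l x \<noteq> 0} \<subseteq> {m}" using component_of_homogeneous[OF assms] by auto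
  then have "parity x = (\<Sum>l\<in>{m}. scale ((-1) ^ l) (component l x))"
    unfolding parity_def by (intro sum_component_superset) auto
  then show ?thesis using component_of_homogeneous[OF assms] by simp
qed

lemma linear_parity: "Vector_Spaces.linear scale scale parity"
proof (unfold_locales)
  fix x y c
  let ?S = "{m. component m x \<noteq> 0} \<union> {m. component m y \<noteq> 0}"
  have fin: "finite ?S" using finite_component by simp
  have "parity z = (\<Sum>m\<in>?S. scale ((-1) ^ m) (component m z))"
    if "{m. component m z \<noteq> 0} \<subseteq> ?S" for z
    unfolding parity_def by (intro sum_component_superset that fin) simp
  moreover have "{m. component m (x + y) \<noteq> 0} \<subseteq> ?S" by (auto simp: component_add)
  ultimately show "parity (x + y) = parity x + parity y"
    by (simp add: component_add scale_right_distrib sum.distrib)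
  have "parity (scale c x) = (\<Sum>m | component m x \<noteq> 0. scale ((-1) ^ m) (component m (scale c x)))"
    unfolding parity_def
    by (intro sum_component_superset finite_component) (auto simp: component_scale)
  then show "parity (scale c x) = scale c (parity x)"
    by (simp add: component_scale parity_def scale_sum_right mult.commute)
qed

subsection \<open>Relations\<close>

abbreviation bv :: "'a list \<Rightarrow> 'a list \<Rightarrow> 'k" where "bv \<equiv> basis_vec"

lemma bv_free: "length as = n \<Longrightarrow> bv as \<in> free_space n"
  unfolding free_space_def by (intro fs.span_base) blast

lemma subspace_free: "fs.subspace (free_space n)"
  unfolding free_space_def by (rule fs.subspace_span)

lemma subspace_relations: "fs.subspace (tensor_relations n)"
  unfolding tensor_relations_def by (rule fs.subspace_span)

lemma relation_add:
  assumes "length us + length ws + 1 = n"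
  shows "bv (us @ (x + y) # ws) - bv (us @ x # ws) - bv (us @ y # ws) \<in> tensor_relations n"
  unfolding tensor_relations_def using assms
  by (intro fs.span_base UnI1 CollectI exI[of _ "us @ x # ws"] exI[of _ "length us"] exI[of _ x] exI[of _ y])
    auto

lemma relation_scale:
  assumes "length us + length ws + 1 = n"
  shows "bv (us @ scale c x # ws) - fun_scale c (bv (us @ x # ws)) \<in> tensor_relations n"
  unfolding tensor_relations_def using assms
  by (intro fs.span_base UnI2 CollectI exI[of _ "us @ x # ws"] exI[of _ "length us"] exI[of _ x] exI[of _ c])
    auto

lemma relation_zero:
  assumes "length us + length ws + 1 = n"
  shows "bv (us @ 0 # ws) \<in> tensor_relations n"
proof -
  have "fun_scale 0 (bv (us @ 0 # ws)) = 0" by (simp add: fun_scale_def fun_eq_iff)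
  then show ?thesis using relation_scale[OF assms, of 0 0] by simp
qed

lemma relations_induct:
  assumes "fs.subspace S"
    and "\<And>us x y ws. length us + length ws + 1 = n \<Longrightarrow>
      bv (us @ (x + y) # ws) - bv (us @ x # ws) - bv (us @ y # ws) \<in> S"
    and "\<And>us c x ws. length us + length ws + 1 = n \<Longrightarrow>
      bv (us @ scale c x # ws) - fun_scale c (bv (us @ x # ws)) \<in> S"
  shows "tensor_relations n \<subseteq> S"
  unfolding tensor_relations_def
proof (rule fs.span_minimal[OF _ assms(1)], safe)
  fix as :: "'a list" and i x y c assume "n = length as" "i < length as"
  then have "as[i := z] = take i as @ z # drop (Suc i) as"
    and "length (take i as) + length (drop (Suc i) as) + 1 = n" for z
    by (auto simp: upd_conv_take_nth_drop)
  then show "bv (as[i := x + y]) - bv (as[i := x]) - bv (as[i := y]) \<in> S"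
    "bv (as[i := scale c x]) - fun_scale c (bv (as[i := x])) \<in> S"
    using assms(2,3) by simp_all
qed

lemma relations_free: "tensor_relations n \<subseteq> free_space n"
  by (rule relations_induct[OF subspace_free])
    (auto intro!: fs.subspace_diff[OF subspace_free] fs.subspace_scale[OF subspace_free] bv_free)

lemma tensor_class_eq: "tensor_class n = coset (tensor_relations n)"
  by (auto simp: tensor_class_def fun_eq_iff a_r_coset_def' module_of_def coset_def)

lemma presents_tensor_power:
  "presents fun_scale (tensor_power n) (free_space n) (tensor_relations n) (tensor_class n)"
  unfolding tensor_power_def tensor_class_eq
  by (intro presents_coset fs.vector_space_axioms subspace_free subspace_relations relations_free)

text \<open>
  In \<open>deg_space n m\<close> the relations are added to the span of the homogeneous basis vectors of degree \<open>m\<close>, so that it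
  contains the kernel of the projection to the tensor power and presents \<open>(A\<^sup>\<otimes>\<^sup>n)\<^sup>m\<close>.
\<close>

definition homogeneous_basis :: "nat \<Rightarrow> nat \<Rightarrow> ('a list \<Rightarrow> 'k) set" where
  "homogeneous_basis n m = {bv as |as ds. homogeneous ds as \<and> length as = n \<and> sum_list ds = m}"

definition deg_space :: "nat \<Rightarrow> nat \<Rightarrow> ('a list \<Rightarrow> 'k) set" where
  "deg_space n m = fs.span (homogeneous_basis n m \<union> tensor_relations n)"

lemma subspace_deg_space: "fs.subspace (deg_space n m)"
  unfolding deg_space_def by (rule fs.subspace_span)

lemma relations_deg_space: "tensor_relations n \<subseteq> deg_space n m"
  unfolding deg_space_def using fs.span_superset by blast

lemma homogeneous_basis_deg_space: "homogeneous_basis n m \<subseteq> deg_space n m"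
  unfolding deg_space_def using fs.span_superset by blast

lemma deg_space_free: "deg_space n m \<subseteq> free_space n"
  unfolding deg_space_def using relations_free bv_free
  by (intro fs.span_minimal[OF _ subspace_free]) (auto simp: homogeneous_basis_def)

lemma tensor_class_eq_iff: "tensor_class n v = tensor_class n w \<longleftrightarrow> v - w \<in> tensor_relations n"
proof
  assume "tensor_class n v = tensor_class n w"
  moreover have "v \<in> coset (tensor_relations n) v"
    by (simp add: mem_coset fs.subspace_0[OF subspace_relations])
  ultimately show "v - w \<in> tensor_relations n" by (simp add: tensor_class_eq mem_coset)
next
  assume "v - w \<in> tensor_relations n"
  then show "tensor_class n v = tensor_class n w"
    unfolding tensor_class_eq by (rule fs.coset_eqI[OF subspace_relations])
qed

lemma presents_tensor_deg:
  "presents fun_scale (tensor_deg n m) (deg_space n m) (tensor_relations n) (tensor_class n)"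
proof -
  have "tensor_class n ` deg_space n m = tensor_class n ` fs.span (homogeneous_basis n m)"
  proof safe
    fix w assume "w \<in> deg_space n m"
    then obtain v r where "w = v + r" "v \<in> fs.span (homogeneous_basis n m)" "r \<in> tensor_relations n"
      unfolding deg_space_def fs.span_Un fs.span_eq_iff[THEN iffD2, OF subspace_relations] by auto
    then show "tensor_class n w \<in> tensor_class n ` fs.span (homogeneous_basis n m)"
      using tensor_class_eq_iff[of n w v] by auto
  next
    fix v assume "v \<in> fs.span (homogeneous_basis n m)"
    then show "tensor_class n v \<in> tensor_class n ` deg_space n m"
      unfolding deg_space_def using fs.span_mono[of "homogeneous_basis n m"] by blast
  qed
  then have "tensor_deg n m = (tensor_power n)\<lparr>carrier := tensor_class n ` deg_space n m\<rparr>"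
    by (simp add: tensor_deg_def homogeneous_basis_def)
  then show ?thesis
    using presents_restrict[OF presents_tensor_power subspace_deg_space relations_deg_space deg_space_free]
    by simp
qed

lemma carrier_tensor_deg: "carrier (tensor_deg n m) = tensor_class n ` deg_space n m"
  using presents_tensor_deg by (simp add: presents_def)

lemma graded_homogeneous: "graded zs \<longleftrightarrow> homogeneous (map fst zs) (map snd zs)"
  by (induction zs) (auto simp: homogeneous_def)

lemma all_homogeneous:
  "(\<forall>ds as. homogeneous ds as \<and> length as = n \<and> sum_list ds = m \<longrightarrow> P ds as) \<longleftrightarrow>
   (\<forall>zs. graded zs \<and> length zs = n \<and> tdeg zs = m \<longrightarrow> P (map fst zs) (map snd zs))"
proof (intro iffI allI impI)
  fix ds as assume *: "\<forall>zs. graded zs \<and> length zs = n \<and> tdeg zs = m \<longrightarrow> P (map fst zs) (map snd zs)"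
    and h: "homogeneous ds as \<and> length as = n \<and> sum_list ds = m"
  then have "length ds = length as" by (auto simp: homogeneous_def dest: list_all2_lengthD)
  with * h show "P ds as" by (auto dest!: spec[of _ "zip ds as"] simp: graded_homogeneous tdeg_def)
qed (auto simp: graded_homogeneous tdeg_def)

lemma bv_deg_space: "graded zs \<Longrightarrow> bv (map snd zs) \<in> deg_space (length zs) (tdeg zs)"
  using homogeneous_basis_deg_space
  by (force simp: homogeneous_basis_def graded_homogeneous tdeg_def)

subsection \<open>Cochains as multilinear functions\<close>

lemma cochain_add:
  assumes "f \<in> cochains n m" "v \<in> deg_space (n + 1) m" "w \<in> deg_space (n + 1) m"
  shows "f (tensor_class (n + 1) (v + w)) = f (tensor_class (n + 1) v) + f (tensor_class (n + 1) w)"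
  using assms presents_tensor_deg[of "n + 1" m]
  unfolding cochains_def linear_hom_def presents_def by (auto simp: module_of_def)

lemma cochain_scale:
  assumes "f \<in> cochains n m" "v \<in> deg_space (n + 1) m"
  shows "f (tensor_class (n + 1) (fun_scale c v)) = c * f (tensor_class (n + 1) v)"
  using assms presents_tensor_deg[of "n + 1" m]
  unfolding cochains_def linear_hom_def presents_def by (auto simp: module_of_def)

lemma cochain_relation:
  assumes "f \<in> cochains n m" "v \<in> tensor_relations (n + 1)"
  shows "f (tensor_class (n + 1) v) = 0"
proof -
  have "tensor_class (n + 1) v = tensor_class (n + 1) (fun_scale 0 v)"
    using assms fs.subspace_diff[OF subspace_relations, of v "n + 1" "fun_scale 0 v"]
      fs.subspace_scale[OF subspace_relations] by (auto simp: tensor_class_eq_iff)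
  then show ?thesis using cochain_scale[OF assms(1), of v 0] assms(2) relations_deg_space by auto
qed

lemma cochain_congruent:
  assumes "f \<in> cochains n m" "v - w \<in> tensor_relations (n + 1)"
  shows "f (tensor_class (n + 1) v) = f (tensor_class (n + 1) w)"
  using assms tensor_class_eq_iff by metis

text \<open>
  A cochain in degree \<open>m\<close> says nothing about tensors of other degrees; setting the value to zero on lists
  of other degrees makes \<open>val m f\<close> multilinear in all degrees at once, and the formulas for the
  operators then hold for homogeneous lists of any degree.
\<close>

definition val :: "nat \<Rightarrow> ('k, 'a) cochain \<Rightarrow> (nat \<times> 'a) list \<Rightarrow> 'k" where
  "val m f zs = (if tdeg zs = m then f (tens (map snd zs)) else 0)"

lemma multilinear_val:
  assumes f: "f \<in> cochains n m"
  shows "multilinear (Suc n) (val m f)"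
  unfolding multilinear_def
proof (intro allI impI)
  fix us k ws assume g: "graded us" "graded ws" and len: "length us + length ws + 1 = Suc n"
  let ?us = "map snd us" and ?ws = "map snd ws"
  have len': "length ?us + length ?ws + 1 = n + 1" using len by simp
  show "linear_slot k (\<lambda>x. val m f (us @ (k, x) # ws))"
  proof (cases "tdeg us + k + tdeg ws = m")
    case True
    then have val: "val m f (us @ (k, x) # ws) = f (tensor_class (n + 1) (bv (?us @ x # ?ws)))" for x
      using len by (simp add: val_def tens_def)
    have mem: "bv (?us @ x # ?ws) \<in> deg_space (n + 1) m" if "x \<in> gr k" for x
      using bv_deg_space[of "us @ (k, x) # ws"] g that True len by (simp add: add.assoc)
    have "f (tensor_class (n + 1) (bv (?us @ (x + y) # ?ws)))
        = f (tensor_class (n + 1) (bv (?us @ x # ?ws) + bv (?us @ y # ?ws)))" for x y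
      using relation_add[OF len', of x y] by (intro cochain_congruent[OF f]) (simp add: algebra_simps)
    moreover have "f (tensor_class (n + 1) (bv (?us @ scale c x # ?ws)))
        = f (tensor_class (n + 1) (fun_scale c (bv (?us @ x # ?ws))))" for c x
      using relation_scale[OF len', of c x] by (intro cochain_congruent[OF f])
    ultimately show ?thesis
      unfolding linear_slot_def val using mem cochain_add[OF f] cochain_scale[OF f] by simp
  next
    case False
    then show ?thesis by (simp add: val_def linear_slot_def add.assoc)
  qed
qed

text \<open>
  Cochains are determined by their values on homogeneous pure tensors, since these span.
\<close>

lemma cochain_eqI:
  assumes f: "f \<in> cochains n m" and g: "g \<in> cochains n m"
    and eq: "\<And>zs. graded zs \<Longrightarrow> length zs = n + 1 \<Longrightarrow> tdeg zs = m \<Longrightarrow> val m f zs = val m g zs"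
  shows "f = g"
proof (rule ext)
  fix U :: "('k, 'a) tensor"
  show "f U = g U"
  proof (cases "U \<in> carrier (tensor_deg (n + 1) m)")
    case True
    let ?S = "{v \<in> deg_space (n + 1) m. f (tensor_class (n + 1) v) = g (tensor_class (n + 1) v)}"
    have "fs.span (homogeneous_basis (n + 1) m \<union> tensor_relations (n + 1)) \<subseteq> ?S"
    proof (rule fs.span_minimal)
      show "fs.subspace ?S"
        using cochain_add[OF f] cochain_add[OF g] cochain_scale[OF f] cochain_scale[OF g]
          fs.subspace_add[OF subspace_deg_space] fs.subspace_scale[OF subspace_deg_space]
          fs.subspace_0[OF subspace_deg_space] fs.subspace_0[OF subspace_relations]
          cochain_relation[OF f] cochain_relation[OF g]
        by (intro fs.subspaceI) auto
      have "bv (map snd zs) \<in> ?S" if "graded zs \<and> length zs = n + 1 \<and> tdeg zs = m" for zs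
        using eq[of zs] bv_deg_space[of zs] that by (simp add: val_def tens_def)
      then have "\<forall>ds as. homogeneous ds as \<and> length as = n + 1 \<and> sum_list ds = m \<longrightarrow> bv as \<in> ?S"
        unfolding all_homogeneous by blast
      then have "homogeneous_basis (n + 1) m \<subseteq> ?S" unfolding homogeneous_basis_def by blast
      moreover have "tensor_relations (n + 1) \<subseteq> ?S"
        using relations_deg_space cochain_relation[OF f] cochain_relation[OF g] by auto
      ultimately show "homogeneous_basis (n + 1) m \<union> tensor_relations (n + 1) \<subseteq> ?S" by blast
    qed
    then show ?thesis using True by (auto simp: carrier_tensor_deg simp flip: deg_space_def)
  next
    case False
    then show ?thesis using f g by (simp add: cochains_def)
  qed
qed

lemma linear_vanishes_relations:
  assumes L: "Vector_Spaces.linear fun_scale (*) L"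
    and add: "\<And>us x y ws. length us + length ws + 1 = n \<Longrightarrow>
      L (bv (us @ (x + y) # ws)) = L (bv (us @ x # ws)) + L (bv (us @ y # ws))"
    and scale: "\<And>us c x ws. length us + length ws + 1 = n \<Longrightarrow>
      L (bv (us @ scale c x # ws)) = c * L (bv (us @ x # ws))"
    and v: "v \<in> tensor_relations n"
  shows "L v = (0 :: 'k)"
proof -
  interpret L: Vector_Spaces.linear fun_scale "(*)" L by fact
  have "tensor_relations n \<subseteq> {v. L v = 0}"
    by (rule relations_induct) (auto simp: L.add L.diff L.scale add scale intro!: fs.subspaceI)
  with v show ?thesis by blast
qed

text \<open>
  The function \<open>F\<close> is defined on homogeneous lists.  Summing it over the components of total degree \<open>m\<close>, of which there
  are finitely many, extends it to a function that is multilinear on all lists, and this one extends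
  linearly to the free space and respects the relations.
\<close>

lemma multilinear_extension:
  assumes F: "multilinear n F"
  obtains L where "Vector_Spaces.linear fun_scale (*) L"
    "\<And>v. v \<in> tensor_relations n \<Longrightarrow> L v = (0 :: 'k)"
    "\<And>zs. graded zs \<Longrightarrow> length zs = n \<Longrightarrow> tdeg zs = m \<Longrightarrow> L (bv (map snd zs)) = F zs"
proof -
  let ?D = "{ds. length ds = n \<and> sum_list ds = m}"
  let ?p = "\<lambda>ds as. zip ds (map2 component ds as)"
  let ?F = "\<lambda>as. \<Sum>ds\<in>?D. F (?p ds as)"
  have "?D \<subseteq> {ds. set ds \<subseteq> {..m} \<and> length ds = n}" using member_le_sum_list by fastforce
  then have fin: "finite ?D" by (rule finite_subset) (simp add: finite_lists_length_eq)
  obtain L where L: "Vector_Spaces.linear fun_scale (*) L" "\<And>as. L (bv as) = ?F as"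
    using free_lift_exists[OF vector_space_mult, of ?F] by blast
  have graded_p: "graded (?p ds as)" for ds as
    by (auto simp: graded_def in_set_zip component_gr)
  have split: "\<exists>d ds1 ds2. length ds1 = length us \<and> length ds2 = length ws \<and>
      (\<forall>x. ?p ds (us @ x # ws) = ?p ds1 us @ (d, component d x) # ?p ds2 ws)"
    if "ds \<in> ?D" "length us + length ws + 1 = n" for ds us ws
  proof -
    have "length us < length ds" using that by auto
    then have "ds = take (length us) ds @ ds ! length us # drop (Suc (length us)) ds"
      by (rule id_take_nth_drop)
    moreover have "length (take (length us) ds) = length us"
      "length (drop (Suc (length us)) ds) = length ws" using that by auto
    ultimately obtain d ds1 ds2 where "ds = ds1 @ d # ds2" "length ds1 = length us" "length ds2 = length ws"
      by blast
    then show ?thesis by (intro exI[of _ d] exI[of _ ds1] exI[of _ ds2]) simp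
  qed
  have slot: "F (?p ds (us @ (x + y) # ws)) = F (?p ds (us @ x # ws)) + F (?p ds (us @ y # ws))"
    "F (?p ds (us @ scale c x # ws)) = c * F (?p ds (us @ x # ws))"
    if ds: "ds \<in> ?D" and len: "length us + length ws + 1 = n" for ds us ws x y c
  proof -
    from split[OF that] obtain d ds1 ds2 where l: "length ds1 = length us" "length ds2 = length ws"
      and p: "\<And>x. ?p ds (us @ x # ws) = ?p ds1 us @ (d, component d x) # ?p ds2 ws" by blast
    have "linear_slot d (\<lambda>x. F (?p ds1 us @ (d, x) # ?p ds2 ws))"
      using F graded_p l len by (intro multilinear_slot) auto
    then show "F (?p ds (us @ (x + y) # ws)) = F (?p ds (us @ x # ws)) + F (?p ds (us @ y # ws))"
      "F (?p ds (us @ scale c x # ws)) = c * F (?p ds (us @ x # ws))"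
      unfolding p component_add component_scale by (simp_all add: linear_slot_def component_gr)
  qed
  have "L v = 0" if "v \<in> tensor_relations n" for v
    by (rule linear_vanishes_relations[OF L(1) _ _ that])
      (simp_all add: L(2) slot sum.distrib sum_distrib_left)
  moreover have "L (bv (map snd zs)) = F zs" if zs: "graded zs" "length zs = n" "tdeg zs = m" for zs
  proof -
    have "F (?p ds (map snd zs)) = (if ds = map fst zs then F zs else 0)" if ds: "ds \<in> ?D" for ds
    proof (cases "ds = map fst zs")
      case True
      have "?p (map fst zs) (map snd zs) = zs"
        using zs(1) by (induction zs) (auto simp: component_of_homogeneous)
      with True show ?thesis by simp
    next
      case False
      then obtain i where i: "i < n" "ds ! i \<noteq> fst (zs ! i)"
        using ds zs(2) nth_equalityI[of ds "map fst zs"] by force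
      have "?p ds (map snd zs) = take i (?p ds (map snd zs)) @ ?p ds (map snd zs) ! i #
          drop (Suc i) (?p ds (map snd zs))"
        using i ds zs by (intro id_take_nth_drop) simp
      moreover have "snd (zs ! i) \<in> gr (fst (zs ! i))" using zs i by (simp add: graded_def)
      then have "?p ds (map snd zs) ! i = (ds ! i, 0)"
        using i ds zs by (simp add: component_of_homogeneous)
      moreover have "linear_slot (ds ! i) (\<lambda>x. F (take i (?p ds (map snd zs)) @ (ds ! i, x) #
          drop (Suc i) (?p ds (map snd zs))))"
        using F i ds zs graded_p[of ds "map snd zs"]
        by (intro multilinear_slot) (auto simp: graded_def dest: in_set_takeD in_set_dropD)
      ultimately show ?thesis using linear_slot_0 False by metis
    qed
    moreover have "map fst zs \<in> ?D" using zs by (simp add: tdeg_def)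
    ultimately show ?thesis using fin by (simp add: L(2) sum.delta)
  qed
  ultimately show ?thesis using that L(1) by blast
qed

lemma cochain_exists:
  assumes F: "multilinear (n + 1) F"
  shows "\<exists>g\<in>cochains n m. \<forall>zs. graded zs \<and> length zs = n + 1 \<and> tdeg zs = m \<longrightarrow>
    g (tens (map snd zs)) = F zs"
proof -
  obtain L where L: "Vector_Spaces.linear fun_scale (*) L"
    "\<And>v. v \<in> tensor_relations (n + 1) \<Longrightarrow> L v = 0"
    "\<And>zs. graded zs \<Longrightarrow> length zs = n + 1 \<Longrightarrow> tdeg zs = m \<Longrightarrow> L (bv (map snd zs)) = F zs"
    using multilinear_extension[OF F] by blast
  interpret L: Vector_Spaces.linear fun_scale "(*)" L by fact
  let ?\<kappa> = "tensor_class (n + 1)" and ?Y = "deg_space (n + 1) m"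
  define g where "g U = (if U \<in> carrier (tensor_deg (n + 1) m) then L (SOME v. ?\<kappa> v = U) else 0)" for U
  have g: "g (?\<kappa> v) = L v" if "v \<in> ?Y" for v
  proof -
    have "?\<kappa> (SOME w. ?\<kappa> w = ?\<kappa> v) = ?\<kappa> v" by (rule someI[of _ v]) (rule refl)
    then have "L ((SOME w. ?\<kappa> w = ?\<kappa> v) - v) = 0" using L(2) tensor_class_eq_iff by blast
    then show ?thesis using that by (simp add: g_def carrier_tensor_deg L.diff)
  qed
  have "g \<in> linear_hom (tensor_deg (n + 1) m) (module_of (*) UNIV)"
    by (rule presents_linear_hom[OF presents_tensor_deg presents_field, where h = g and h' = L])
      (use g in \<open>simp_all add: L.add L.scale\<close>)
  then have "g \<in> cochains n m" by (simp add: cochains_def g_def)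
  moreover have "g (tens (map snd zs)) = F zs"
    if "graded zs" "length zs = n + 1" "tdeg zs = m" for zs
    using g[of "bv (map snd zs)"] bv_deg_space[of zs] L(3) that by (simp add: tens_def)
  ultimately show ?thesis by blast
qed

text \<open>
  Existence and uniqueness for a cochain that is described by its values on homogeneous pure
  tensors, in the form in which \<open>b\<close> and \<open>\<Lambda>\<close> are defined.
\<close>

lemma cochain_the:
  assumes F: "multilinear (n + 1) F"
    and F0: "\<And>zs. graded zs \<Longrightarrow> length zs = n + 1 \<Longrightarrow> tdeg zs \<noteq> m \<Longrightarrow> F zs = 0"
    and P: "\<And>g. P g \<longleftrightarrow> (\<forall>zs. graded zs \<and> length zs = n + 1 \<and> tdeg zs = m \<longrightarrow>
      g (tens (map snd zs)) = F zs)"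
  shows "(THE g. g \<in> cochains n m \<and> P g) \<in> cochains n m"
    and "graded zs \<Longrightarrow> length zs = n + 1 \<Longrightarrow> val m (THE g. g \<in> cochains n m \<and> P g) zs = F zs"
proof -
  have "\<exists>!g. g \<in> cochains n m \<and> P g"
  proof (rule ex_ex1I)
    show "\<exists>g. g \<in> cochains n m \<and> P g" using cochain_exists[OF F, of m] P by blast
    show "g = h" if "g \<in> cochains n m \<and> P g" "h \<in> cochains n m \<and> P h" for g h
      using that P by (intro cochain_eqI[of g n m h]) (auto simp: val_def)
  qed
  from theI'[OF this] have the: "(THE g. g \<in> cochains n m \<and> P g) \<in> cochains n m"
    "P (THE g. g \<in> cochains n m \<and> P g)" by blast+
  then show "(THE g. g \<in> cochains n m \<and> P g) \<in> cochains n m" by blast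
  show "val m (THE g. g \<in> cochains n m \<and> P g) zs = F zs" if "graded zs" "length zs = n + 1"
    using the(2) F0 that unfolding P val_def by auto
qed

subsection \<open>The operators\<close>

lemma map_snd_mul: "Suc j < length zs \<Longrightarrow>
    map snd (mul j zs) = take j (map snd zs) @ [map snd zs ! j * map snd zs ! (j + 1)] @ drop (j + 2) (map snd zs)"
  by (induction j zs rule: mul.induct) auto

lemma koszul_sign_eq: "zs \<noteq> [] \<Longrightarrow> koszul_sign zs = (-1) ^ koszul_exp (map fst zs)"
  by (simp add: koszul_sign_def koszul_exp_def tdeg_def last_map map_butlast)

lemma map_snd_mul_rot: "length zs \<ge> 2 \<Longrightarrow>
    map snd (mul 0 (rot zs)) = (last (map snd zs) * hd (map snd zs)) # butlast (tl (map snd zs))"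
proof -
  assume "length zs \<ge> 2"
  then obtain z vs where "zs = z # vs" "vs \<noteq> []" by (cases zs; cases "tl zs") auto
  then obtain ws x where zs: "zs = z # ws @ [x]" by (cases vs rule: rev_cases) auto
  have "rot zs = x # z # ws" using rot_simps[of "z # ws" x] zs by simp
  then show ?thesis using zs by (cases x; cases z) simp
qed

lemma val_hoch_off_degree: "zs \<noteq> [] \<Longrightarrow> tdeg zs \<noteq> m \<Longrightarrow> hoch L (val m f) zs = 0"
  by (simp add: hoch_def face_def val_def tdeg_rot sum.neutral)

lemma hochschild_b:
  assumes f: "f \<in> cochains n m"
  shows hochschild_b_cochain: "hochschild_b n m f \<in> cochains (n + 1) m"
    and val_hochschild_b: "graded zs \<Longrightarrow> length zs = n + 2 \<Longrightarrow>
      val m (hochschild_b n m f) zs = hoch (n + 1) (val m f) zs"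
proof -
  let ?P = "\<lambda>g. \<forall>ds as. homogeneous ds as \<and> length as = n + 2 \<and> sum_list ds = m \<longrightarrow>
        g (tens as) =
          (\<Sum>i\<le>n. (-1) ^ i * f (tens (take i as @ [as ! i * as ! (i + 1)] @ drop (i + 2) as)))
          + (-1) ^ (n + 1 + koszul_exp ds) * f (tens ((last as * hd as) # butlast (tl as)))"
  have eq: "hoch (n + 1) (val m f) zs =
      (\<Sum>i\<le>n. (-1) ^ i * f (tens (take i (map snd zs) @ [map snd zs ! i * map snd zs ! (i + 1)]
          @ drop (i + 2) (map snd zs))))
      + (-1) ^ (n + 1 + koszul_exp (map fst zs)) *
        f (tens ((last (map snd zs) * hd (map snd zs)) # butlast (tl (map snd zs))))"
    if "length zs = n + 2" "tdeg zs = m" for zs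
  proof -
    have ne: "zs \<noteq> []" using that by auto
    have "(\<Sum>i\<le>n. (-1) ^ i * face (n + 1) i (val m f) zs)
        = (\<Sum>i\<le>n. (-1) ^ i * f (tens (take i (map snd zs) @ [map snd zs ! i * map snd zs ! (i + 1)]
          @ drop (i + 2) (map snd zs))))"
      using that by (intro sum.cong) (simp_all add: face_def val_def map_snd_mul)
    then show ?thesis
      using that ne
      by (simp add: hoch_def face_def val_def map_snd_mul_rot koszul_sign_eq tdeg_rot power_add mult.assoc)
  qed
  have P: "?P g \<longleftrightarrow> (\<forall>zs. graded zs \<and> length zs = n + 1 + 1 \<and> tdeg zs = m \<longrightarrow>
      g (tens (map snd zs)) = hoch (n + 1) (val m f) zs)" for g
    unfolding all_homogeneous using eq by simp
  have F: "multilinear (n + 1 + 1) (hoch (n + 1) (val m f))"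
    using multilinear_hoch[of "n + 1"] multilinear_val[OF f] by simp
  have F0: "hoch (n + 1) (val m f) zs = 0" if "length zs = n + 1 + 1" "tdeg zs \<noteq> m" for zs
    using that by (intro val_hoch_off_degree) auto
  show "hochschild_b n m f \<in> cochains (n + 1) m"
    "graded zs \<Longrightarrow> length zs = n + 2 \<Longrightarrow> val m (hochschild_b n m f) zs = hoch (n + 1) (val m f) zs"
    unfolding hochschild_b_def using cochain_the[OF F F0 P] by simp_all
qed

lemma cyclic_op:
  assumes f: "f \<in> cochains n m"
  shows cyclic_op_cochain: "cyclic_op n m f \<in> cochains n m"
    and val_cyclic_op: "graded zs \<Longrightarrow> length zs = n + 1 \<Longrightarrow>
      val m (cyclic_op n m f) zs = (-1) ^ n * (koszul_sign zs * val m f (rot zs))"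
proof -
  let ?F = "\<lambda>zs. (-1) ^ n * (koszul_sign zs * val m f (rot zs))"
  let ?P = "\<lambda>g. \<forall>ds as. homogeneous ds as \<and> length as = n + 1 \<and> sum_list ds = m \<longrightarrow>
        g (tens as) = (-1) ^ (n + koszul_exp ds) * f (tens (last as # butlast as))"
  have eq: "?F zs = (-1) ^ (n + koszul_exp (map fst zs)) *
      f (tens (last (map snd zs) # butlast (map snd zs)))"
    if "length zs = n + 1" "tdeg zs = m" for zs
  proof -
    have ne: "zs \<noteq> []" using that by auto
    then have "map snd (rot zs) = last (map snd zs) # butlast (map snd zs)"
      by (simp add: rot_def last_map map_butlast)
    then show ?thesis
      using that ne by (simp add: val_def koszul_sign_eq tdeg_rot power_add mult.assoc)
  qed
  have P: "?P g \<longleftrightarrow> (\<forall>zs. graded zs \<and> length zs = n + 1 \<and> tdeg zs = m \<longrightarrow>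
      g (tens (map snd zs)) = ?F zs)" for g
    unfolding all_homogeneous using eq by simp
  have "multilinear (n + 1) (\<lambda>zs. \<Sum>i\<in>{()}. (-1) ^ n * (koszul_sign zs * val m f (rot zs)))"
    using multilinear_val[OF f] by (intro multilinear_sum multilinear_rot) simp
  then have F: "multilinear (n + 1) ?F" by simp
  have F0: "?F zs = 0" if "length zs = n + 1" "tdeg zs \<noteq> m" for zs
  proof -
    have "zs \<noteq> []" using that by auto
    then show ?thesis using that by (simp add: val_def tdeg_rot)
  qed
  show "cyclic_op n m f \<in> cochains n m"
    "graded zs \<Longrightarrow> length zs = n + 1 \<Longrightarrow> val m (cyclic_op n m f) zs = ?F zs"
    unfolding cyclic_op_def using cochain_the[OF F F0 P] by simp_all
qed

subsection \<open>The differential of a tensor power\<close>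

text \<open>
  The differential \<open>\<phi>\<^sup>\<otimes>\<^sup>n\<close> is first built on the free space.  With \<open>parity\<close> in place of the signs its summands are
  multilinear, so it descends to the tensor power.
\<close>

definition diff_term :: "nat \<Rightarrow> 'a list \<Rightarrow> 'a list" where
  "diff_term i as = map parity (take i as) @ \<phi> (as ! i) # drop (Suc i) as"

definition free_diff :: "('a list \<Rightarrow> 'k) \<Rightarrow> 'a list \<Rightarrow> 'k" where
  "free_diff = (SOME L. Vector_Spaces.linear fun_scale fun_scale L \<and>
     (\<forall>as. L (bv as) = (\<Sum>i<length as. bv (diff_term i as))))"

lemma linear_free_diff: "Vector_Spaces.linear fun_scale fun_scale free_diff"
  and free_diff_bv: "free_diff (bv as) = (\<Sum>i<length as. bv (diff_term i as))"
  using someI_ex[OF free_lift_exists[OF vector_space_fun_scale,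
        of "\<lambda>as. \<Sum>i<length as. bv (diff_term i as)"]]
  unfolding free_diff_def[symmetric] by blast+

lemma free_diff_add: "free_diff (v + w) = free_diff v + free_diff w"
  and free_diff_diff: "free_diff (v - w) = free_diff v - free_diff w"
  and free_diff_scale: "free_diff (fun_scale c v) = fun_scale c (free_diff v)"
  and free_diff_zero: "free_diff 0 = 0"
proof -
  interpret Vector_Spaces.linear fun_scale fun_scale free_diff by (rule linear_free_diff)
  show "free_diff (v + w) = free_diff v + free_diff w" "free_diff (v - w) = free_diff v - free_diff w"
    "free_diff (fun_scale c v) = fun_scale c (free_diff v)" "free_diff 0 = 0"
    by (rule add diff scale zero)+
qed

lemma length_diff_term: "i < length as \<Longrightarrow> length (diff_term i as) = length as"
  by (simp add: diff_term_def)

lemma subspace_free_diff_vimage: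
  assumes "fs.subspace S"
  shows "fs.subspace {v. free_diff v \<in> S}"
  using fs.subspace_add[OF assms] fs.subspace_scale[OF assms] fs.subspace_0[OF assms]
  by (intro fs.subspaceI) (auto simp: free_diff_add free_diff_scale free_diff_zero)

lemma free_diff_free: "v \<in> free_space n \<Longrightarrow> free_diff v \<in> free_space n"
proof -
  have "free_space n \<subseteq> {v. free_diff v \<in> free_space n}"
    unfolding free_space_def[of n]
  proof (rule fs.span_minimal)
    show "fs.subspace {v. free_diff v \<in> fs.span {basis_vec as |as. length as = n}}"
      by (intro subspace_free_diff_vimage fs.subspace_span)
    show "{basis_vec as |as. length as = n} \<subseteq> {v. free_diff v \<in> fs.span {basis_vec as |as. length as = n}}"
      unfolding free_space_def[symmetric]
      by (auto simp: free_diff_bv length_diff_term intro!: fs.subspace_sum[OF subspace_free] bv_free)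
  qed
  then show "v \<in> free_space n \<Longrightarrow> free_diff v \<in> free_space n" by blast
qed

text \<open>
  As a function of a single entry \<open>x\<close>, a summand applies to \<open>x\<close> one of the linear maps identity, \<open>\<phi>\<close> and \<open>parity\<close>.
\<close>

lemma diff_term_slot:
  assumes "i < length us + length ws + 1"
  shows "\<exists>us' g ws'. Vector_Spaces.linear scale scale g \<and> length us' = length us \<and>
    length ws' = length ws \<and> (\<forall>x. diff_term i (us @ x # ws) = us' @ g x # ws')"
proof -
  consider "i < length us" | "i = length us" | j where "i = length us + 1 + j" "j < length ws"
  proof (cases "i \<le> length us")
    case False
    then have "i = length us + 1 + (i - length us - 1)" "i - length us - 1 < length ws"
      using assms by auto
    then show ?thesis using that by blast
  qed (use that in linarith)
  then show ?thesis
  proof cases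
    case 1
    then show ?thesis
      by (intro exI[of _ "map parity (take i us) @ \<phi> (us ! i) # drop (Suc i) us"] exI[of _ "\<lambda>x. x"]
          exI[of _ ws]) (auto simp: diff_term_def nth_append linear_ident)
  next
    case 2
    then show ?thesis
      by (intro exI[of _ "map parity us"] exI[of _ \<phi>] exI[of _ ws])
        (auto simp: diff_term_def phi_linear)
  next
    case 3
    then show ?thesis
      by (intro exI[of _ "map parity us"] exI[of _ parity]
          exI[of _ "map parity (take j ws) @ \<phi> (ws ! j) # drop (Suc j) ws"])
        (auto simp: diff_term_def linear_parity nth_append)
  qed
qed

lemma free_diff_relations: "v \<in> tensor_relations n \<Longrightarrow> free_diff v \<in> tensor_relations n"
proof -
  have "tensor_relations n \<subseteq> {v. free_diff v \<in> tensor_relations n}"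
  proof (rule relations_induct)
    show "fs.subspace {v. free_diff v \<in> tensor_relations n}"
      by (rule subspace_free_diff_vimage[OF subspace_relations])
  next
    fix us ws :: "'a list" and x y assume len: "length us + length ws + 1 = n"
    have "bv (diff_term i (us @ (x + y) # ws)) - bv (diff_term i (us @ x # ws))
        - bv (diff_term i (us @ y # ws)) \<in> tensor_relations n" if i: "i < n" for i
    proof -
      obtain us' g ws' where g: "Vector_Spaces.linear scale scale g" "length us' = length us"
        "length ws' = length ws" and eq: "\<And>x. diff_term i (us @ x # ws) = us' @ g x # ws'"
        using diff_term_slot[of i us ws] i len by auto
      interpret g: Vector_Spaces.linear scale scale g by (rule g(1))
      have "g (x + y) = g x + g y" by (rule g.add)
      then show ?thesis using relation_add[of us' ws' n "g x" "g y"] g(2,3) len by (simp add: eq)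
    qed
    then have "(\<Sum>i<n. bv (diff_term i (us @ (x + y) # ws)) - bv (diff_term i (us @ x # ws))
        - bv (diff_term i (us @ y # ws))) \<in> tensor_relations n"
      by (intro fs.subspace_sum[OF subspace_relations]) simp
    then show "bv (us @ (x + y) # ws) - bv (us @ x # ws) - bv (us @ y # ws)
        \<in> {v. free_diff v \<in> tensor_relations n}"
      using len by (simp add: free_diff_diff free_diff_bv sum_subtractf)
  next
    fix us ws :: "'a list" and x c assume len: "length us + length ws + 1 = n"
    have "bv (diff_term i (us @ scale c x # ws)) - fun_scale c (bv (diff_term i (us @ x # ws)))
        \<in> tensor_relations n" if i: "i < n" for i
    proof -
      obtain us' g ws' where g: "Vector_Spaces.linear scale scale g" "length us' = length us"
        "length ws' = length ws" and eq: "\<And>x. diff_term i (us @ x # ws) = us' @ g x # ws'"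
        using diff_term_slot[of i us ws] i len by auto
      interpret g: Vector_Spaces.linear scale scale g by (rule g(1))
      have "g (scale c x) = scale c (g x)" by (rule g.scale)
      then show ?thesis using relation_scale[of us' ws' n c "g x"] g(2,3) len by (simp add: eq)
    qed
    then have "(\<Sum>i<n. bv (diff_term i (us @ scale c x # ws))
        - fun_scale c (bv (diff_term i (us @ x # ws)))) \<in> tensor_relations n"
      by (intro fs.subspace_sum[OF subspace_relations]) simp
    then show "bv (us @ scale c x # ws) - fun_scale c (bv (us @ x # ws))
        \<in> {v. free_diff v \<in> tensor_relations n}"
      using len by (simp add: free_diff_diff free_diff_scale free_diff_bv sum_subtractf fs.scale_sum_right)
  qed
  then show "v \<in> tensor_relations n \<Longrightarrow> free_diff v \<in> tensor_relations n" by blast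
qed

text \<open>
  Modulo the relations the scalars \<open>(-1) ^ \<bar>a\<bar>\<close> that \<open>parity\<close> puts on homogeneous entries multiply up to the Koszul
  sign of the whole prefix.
\<close>

lemma parity_prefix:
  assumes "graded zs" "length pre + length zs + length ws = n"
  shows "bv (pre @ map parity (map snd zs) @ ws) - fun_scale ((-1) ^ tdeg zs) (bv (pre @ map snd zs @ ws))
    \<in> tensor_relations n"
  using assms
proof (induction zs arbitrary: pre)
  case Nil
  have "bv (pre @ ws) - fun_scale 1 (bv (pre @ ws)) \<in> tensor_relations n"
    by (simp add: fs.subspace_0[OF subspace_relations])
  then show ?case by (simp only: list.map append_Nil tdeg_simps power_0)
next
  case (Cons z zs)
  let ?e = "(-1) ^ fst z :: 'k" and ?E = "(-1) ^ tdeg zs :: 'k"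
  let ?x = "snd z" and ?ps = "map parity (map snd zs)"
  have 1: "bv (pre @ scale ?e ?x # ?ps @ ws) - fun_scale ?e (bv (pre @ ?x # ?ps @ ws)) \<in> tensor_relations n"
    using Cons.prems by (intro relation_scale) simp
  have "bv ((pre @ [?x]) @ ?ps @ ws) - fun_scale ?E (bv ((pre @ [?x]) @ map snd zs @ ws)) \<in> tensor_relations n"
    using Cons.prems by (intro Cons.IH) simp_all
  then have 2: "fun_scale ?e (bv (pre @ ?x # ?ps @ ws) - fun_scale ?E (bv (pre @ ?x # map snd zs @ ws)))
      \<in> tensor_relations n"
    by (intro fs.subspace_scale[OF subspace_relations]) simp
  have parity: "parity ?x = scale ?e ?x" using Cons.prems by (intro parity_of_homogeneous) simp
  have "bv (pre @ scale ?e ?x # ?ps @ ws) - fun_scale (?e * ?E) (bv (pre @ ?x # map snd zs @ ws))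
      \<in> tensor_relations n"
    using fs.subspace_add[OF subspace_relations 1 2] by (simp add: fs.scale_right_diff_distrib)
  then show ?case by (simp only: list.map append_Cons parity tdeg_simps power_add)
qed

definition diff_summand :: "(nat \<times> 'a) list \<Rightarrow> nat \<Rightarrow> 'a list \<Rightarrow> 'k" where
  "diff_summand zs i = fun_scale ((-1) ^ tdeg (take i zs)) (bv ((map snd zs)[i := \<phi> (snd (zs ! i))]))"

lemma free_diff_homogeneous:
  assumes "graded zs" "length zs = n"
  shows "free_diff (bv (map snd zs)) - (\<Sum>i<n. diff_summand zs i) \<in> tensor_relations n"
proof -
  have "bv (diff_term i (map snd zs)) - diff_summand zs i \<in> tensor_relations n" if "i < n" for i
  proof -
    have g: "graded (take i zs)" using assms by (auto simp: graded_def dest: in_set_takeD)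
    show ?thesis
      using parity_prefix[OF g, of "[]" "\<phi> (snd (zs ! i)) # drop (Suc i) (map snd zs)" n] that assms
      by (simp add: diff_term_def diff_summand_def take_map upd_conv_take_nth_drop)
  qed
  then have "(\<Sum>i<n. bv (diff_term i (map snd zs)) - diff_summand zs i) \<in> tensor_relations n"
    by (intro fs.subspace_sum[OF subspace_relations]) simp
  then show ?thesis using assms by (simp add: free_diff_bv sum_subtractf)
qed

lemma bv_sum_span:
  assumes S: "fs.subspace S" "tensor_relations n \<subseteq> S" and len: "length us + length ws + 1 = n"
    and "finite I" and mem: "\<And>i. i \<in> I \<Longrightarrow> bv (us @ x i # ws) \<in> S"
  shows "bv (us @ (\<Sum>i\<in>I. x i) # ws) \<in> S"
  using \<open>finite I\<close> mem
proof (induction I)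
  case empty
  then show ?case using relation_zero[OF len] S(2) by auto
next
  case (insert i I)
  let ?y = "\<Sum>j\<in>I. x j"
  have "bv (us @ (x i + ?y) # ws) - bv (us @ x i # ws) - bv (us @ ?y # ws) \<in> S"
    using relation_add[OF len] S(2) by blast
  moreover have "bv (us @ x i # ws) \<in> S" "bv (us @ ?y # ws) \<in> S" using insert by auto
  ultimately have "(bv (us @ (x i + ?y) # ws) - bv (us @ x i # ws) - bv (us @ ?y # ws))
      + bv (us @ x i # ws) + bv (us @ ?y # ws) \<in> S"
    using fs.subspace_add[OF S(1)] by blast
  then show ?case using insert by simp
qed

text \<open>
  The entries are replaced by their homogeneous components from left to right: \<open>zs\<close> is the part
  that is already homogeneous, \<open>ws\<close> the part still to be treated.
\<close>

lemma bv_in_homogeneous_span: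
  assumes S: "fs.subspace S" "tensor_relations n \<subseteq> S"
    and hom: "\<And>zs. graded zs \<Longrightarrow> length zs = n \<Longrightarrow> bv (map snd zs) \<in> S"
  shows "graded zs \<Longrightarrow> length zs + length ws = n \<Longrightarrow> bv (map snd zs @ ws) \<in> S"
proof (induction ws arbitrary: zs)
  case Nil
  then show ?case using hom by simp
next
  case (Cons a ws)
  have "bv (map snd zs @ (\<Sum>m | component m a \<noteq> 0. component m a) # ws) \<in> S"
  proof (rule bv_sum_span[OF S _ finite_component])
    show "bv (map snd zs @ component m a # ws) \<in> S" for m
      using Cons.IH[of "zs @ [(m, component m a)]"] Cons.prems by (simp add: component_gr)
  qed (use Cons.prems in simp)
  then show ?case using sum_component[of a] by simp
qed

lemma free_space_homogeneous_span:
  assumes S: "fs.subspace S" "tensor_relations n \<subseteq> S"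
    and hom: "\<And>zs. graded zs \<Longrightarrow> length zs = n \<Longrightarrow> bv (map snd zs) \<in> S"
  shows "free_space n \<subseteq> S"
  unfolding free_space_def using bv_in_homogeneous_span[OF S hom, of "[]"]
  by (intro fs.span_minimal[OF _ S(1)]) auto

text \<open>
  The definite description of \<open>tensor_diff\<close> is met by the map induced by \<open>free_diff\<close>, and by no other
  because homogeneous pure tensors span the tensor power.
\<close>

lemma tensor_diff_class:
  assumes v: "v \<in> free_space n"
  shows "tensor_diff n (tensor_class n v) = tensor_class n (free_diff v)"
proof -
  let ?T = "tensor_power n" and ?\<kappa> = "tensor_class n"
  note T = presents_tensor_power[of n]
  let ?P = "\<lambda>L. L \<in> linear_hom ?T ?T \<and> L \<in> extensional (carrier ?T) \<and>
     (\<forall>ds as. homogeneous ds as \<and> length as = n \<longrightarrow>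
        L (tens as) = (\<Oplus>\<^bsub>?T\<^esub>i\<in>{..<n}.
          (-1) ^ sum_list (take i ds) \<odot>\<^bsub>?T\<^esub> tens (as[i := \<phi> (as ! i)])))"
  have carrier: "carrier ?T = ?\<kappa> ` free_space n" using T by (simp add: presents_def)
  have summand: "diff_summand zs i \<in> free_space n" if "length zs = n" for zs i
    using that by (auto simp: diff_summand_def intro!: fs.subspace_scale[OF subspace_free] bv_free)
  have formula: "(\<Oplus>\<^bsub>?T\<^esub>i\<in>{..<n}. (-1) ^ sum_list (take i (map fst zs)) \<odot>\<^bsub>?T\<^esub>
        tens ((map snd zs)[i := \<phi> (map snd zs ! i)])) = ?\<kappa> (free_diff (bv (map snd zs)))"
    if zs: "graded zs" "length zs = n" for zs
  proof -
    have "(-1) ^ sum_list (take i (map fst zs)) \<odot>\<^bsub>?T\<^esub> tens ((map snd zs)[i := \<phi> (map snd zs ! i)])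
        = ?\<kappa> (diff_summand zs i)" if "i < n" for i
    proof -
      have "bv ((map snd zs)[i := \<phi> (snd (zs ! i))]) \<in> free_space n" using zs by (intro bv_free) simp
      then show ?thesis
        using T that zs by (simp add: presents_def tens_def diff_summand_def tdeg_def take_map)
    qed
    moreover have "?\<kappa> (diff_summand zs i) \<in> carrier ?T" for i using summand[OF zs(2)] carrier by blast
    moreover have "abelian_monoid ?T"
      using presents_module[OF T] by (simp add: Module.module_def abelian_group_def)
    ultimately have "(\<Oplus>\<^bsub>?T\<^esub>i\<in>{..<n}. (-1) ^ sum_list (take i (map fst zs)) \<odot>\<^bsub>?T\<^esub>
        tens ((map snd zs)[i := \<phi> (map snd zs ! i)])) = (\<Oplus>\<^bsub>?T\<^esub>i\<in>{..<n}. ?\<kappa> (diff_summand zs i))"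
      by (intro abelian_monoid.finsum_cong') auto
    also have "\<dots> = ?\<kappa> (\<Sum>i<n. diff_summand zs i)"
      using summand[OF zs(2)] by (intro presents_finsum[OF T]) auto
    also have "\<dots> = ?\<kappa> (free_diff (bv (map snd zs)))"
      using free_diff_homogeneous[OF zs] fs.subspace_neg[OF subspace_relations]
      unfolding tensor_class_eq_iff by fastforce
    finally show ?thesis .
  qed
  have P: "?P L \<longleftrightarrow> L \<in> linear_hom ?T ?T \<and> L \<in> extensional (carrier ?T) \<and>
     (\<forall>zs. graded zs \<and> length zs = n \<longrightarrow> L (?\<kappa> (bv (map snd zs))) = ?\<kappa> (free_diff (bv (map snd zs))))" for L
  proof -
    have "(\<forall>ds as. homogeneous ds as \<and> length as = n \<longrightarrow> Q ds as) \<longleftrightarrow>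
        (\<forall>m. \<forall>ds as. homogeneous ds as \<and> length as = n \<and> sum_list ds = m \<longrightarrow> Q ds as)" for Q
      by blast
    then show ?thesis unfolding all_homogeneous using formula by (auto simp: tens_def)
  qed
  define L where "L U = (if U \<in> carrier ?T then ?\<kappa> (free_diff (SOME w. ?\<kappa> w = U)) else undefined)" for U
  have L: "L (?\<kappa> w) = ?\<kappa> (free_diff w)" if w: "w \<in> free_space n" for w
  proof -
    have "?\<kappa> (SOME u. ?\<kappa> u = ?\<kappa> w) = ?\<kappa> w" by (rule someI[of _ w]) (rule refl)
    then have "free_diff ((SOME u. ?\<kappa> u = ?\<kappa> w) - w) \<in> tensor_relations n"
      by (intro free_diff_relations) (simp add: tensor_class_eq_iff)
    then have "?\<kappa> (free_diff (SOME u. ?\<kappa> u = ?\<kappa> w)) = ?\<kappa> (free_diff w)"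
      by (simp add: tensor_class_eq_iff free_diff_diff)
    then show ?thesis using w by (simp add: L_def carrier)
  qed
  have "L \<in> linear_hom ?T ?T"
    by (rule presents_linear_hom[OF T T, where h = L and h' = free_diff])
      (use L free_diff_free in \<open>simp_all add: free_diff_add free_diff_scale\<close>)
  moreover have "L \<in> extensional (carrier ?T)" by (simp add: L_def extensional_def)
  ultimately have PL: "?P L" unfolding P using L bv_free by (metis length_map)
  have "L' = L" if PL': "?P L'" for L'
  proof (rule extensionalityI)
    show "L' \<in> extensional (carrier ?T)" "L \<in> extensional (carrier ?T)" using PL PL' by blast+
    have hom: "L' \<in> linear_hom ?T ?T" "L \<in> linear_hom ?T ?T" using PL PL' by blast+
    let ?S = "{w \<in> free_space n. L' (?\<kappa> w) = L (?\<kappa> w)}"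
    have lin: "K (?\<kappa> (w + w')) = K (?\<kappa> w) \<oplus>\<^bsub>?T\<^esub> K (?\<kappa> w')" "K (?\<kappa> (fun_scale c w)) = c \<odot>\<^bsub>?T\<^esub> K (?\<kappa> w)"
      if "K \<in> linear_hom ?T ?T" "w \<in> free_space n" "w' \<in> free_space n" for K w w' c
      using that T unfolding linear_hom_def presents_def by auto
    have zero: "L' (?\<kappa> w) = L (?\<kappa> w)" if w: "w \<in> tensor_relations n" for w
    proof -
      have "?\<kappa> w = ?\<kappa> (fun_scale 0 w)"
        unfolding tensor_class_eq_iff using w
        by (intro fs.subspace_diff[OF subspace_relations] fs.subspace_scale[OF subspace_relations])
      moreover have w_free: "w \<in> free_space n" using w relations_free by blast
      have hom_zero: "K (?\<kappa> (fun_scale 0 w)) = \<zero>\<^bsub>?T\<^esub>" if K: "K \<in> linear_hom ?T ?T" for K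
      proof -
        have "?\<kappa> w \<in> carrier ?T" using w_free carrier by simp
        then have "K (?\<kappa> w) \<in> carrier ?T" using K unfolding linear_hom_def by blast
        then obtain u where u: "u \<in> free_space n" "K (?\<kappa> w) = ?\<kappa> u" using carrier by auto
        have "0 \<odot>\<^bsub>?T\<^esub> ?\<kappa> u = ?\<kappa> (fun_scale 0 u)" using T u(1) by (simp add: presents_def)
        also have "fun_scale 0 u = 0" by (simp add: fun_scale_def fun_eq_iff)
        also have "?\<kappa> 0 = \<zero>\<^bsub>?T\<^esub>" using T by (simp add: presents_def)
        finally show ?thesis unfolding lin(2)[OF K w_free w_free] u(2) .
      qed
      ultimately show ?thesis using hom_zero[OF hom(1)] hom_zero[OF hom(2)] by simp
    qed
    have "free_space n \<subseteq> ?S"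
    proof (rule free_space_homogeneous_span)
      show "fs.subspace ?S"
        using lin[OF hom(1)] lin[OF hom(2)] zero fs.subspace_0[OF subspace_relations]
          fs.subspace_add[OF subspace_free] fs.subspace_scale[OF subspace_free]
          fs.subspace_0[OF subspace_free]
        by (intro fs.subspaceI) auto
      show "tensor_relations n \<subseteq> ?S" using zero relations_free by blast
      show "bv (map snd zs) \<in> ?S" if "graded zs" "length zs = n" for zs
        using PL PL' that bv_free[of "map snd zs" n] unfolding P by simp
    qed
    then show "L' U = L U" if "U \<in> carrier ?T" for U using that carrier by auto
  qed
  with PL have "tensor_diff n = L" unfolding tensor_diff_def by (intro the_equality) blast+
  then show ?thesis using L[OF v] by simp
qed

lemma tdeg_update: "i < length zs \<Longrightarrow> tdeg (zs[i := (k, x)]) + fst (zs ! i) = tdeg zs + k"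
proof (induction zs arbitrary: i)
  case (Cons z zs)
  then show ?case by (cases i) auto
qed simp

lemma graded_update: "graded zs \<Longrightarrow> x \<in> gr k \<Longrightarrow> graded (zs[i := (k, x)])"
  unfolding graded_def using set_update_subset_insert[of zs i "(k, x)"] by auto

lemma bv_update_zero:
  assumes "i < n" "length as = n"
  shows "bv (as[i := 0]) \<in> tensor_relations n"
  using relation_zero[of "take i as" "drop (Suc i) as" n] assms by (simp add: upd_conv_take_nth_drop)

text \<open>
  An entry of degree \<open>0\<close> contributes a basis vector with a zero entry, which is a relation and so
  belongs to every \<open>deg_space n m\<close>.
\<close>

lemma diff_summand_deg_space:
  assumes "graded zs" "length zs = n" "tdeg zs = Suc m" "i < n"
  shows "bv ((map snd zs)[i := \<phi> (snd (zs ! i))]) \<in> deg_space n m"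
proof (cases "fst (zs ! i)")
  case 0
  have "snd (zs ! i) \<in> gr (fst (zs ! i))" using assms by (simp add: graded_def)
  then have "\<phi> (snd (zs ! i)) = 0" using 0 phi_degree_0 by simp
  then show ?thesis using bv_update_zero[of i n "map snd zs"] assms relations_deg_space by auto
next
  case (Suc k)
  have "snd (zs ! i) \<in> gr (fst (zs ! i))" using assms by (simp add: graded_def)
  then have "graded (zs[i := (k, \<phi> (snd (zs ! i)))])" using Suc phi_degree graded_update[OF assms(1)] by simp
  moreover have "tdeg (zs[i := (k, \<phi> (snd (zs ! i)))]) = m"
    using tdeg_update[of i zs k] assms Suc by simp
  ultimately show ?thesis using bv_deg_space[of "zs[i := (k, \<phi> (snd (zs ! i)))]"] assms by (simp add: map_update)
qed

lemma free_diff_deg_space: "v \<in> deg_space n (Suc m) \<Longrightarrow> free_diff v \<in> deg_space n m"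
proof -
  let ?S = "{v. free_diff v \<in> deg_space n m}"
  have S: "fs.subspace ?S" by (rule subspace_free_diff_vimage[OF subspace_deg_space])
  have "bv (map snd zs) \<in> ?S" if zs: "graded zs \<and> length zs = n \<and> tdeg zs = Suc m" for zs
  proof -
    have "(\<Sum>i<n. diff_summand zs i) \<in> deg_space n m"
      unfolding diff_summand_def using diff_summand_deg_space zs
      by (intro fs.subspace_sum[OF subspace_deg_space] fs.subspace_scale[OF subspace_deg_space]) auto
    moreover have "free_diff (bv (map snd zs)) - (\<Sum>i<n. diff_summand zs i) \<in> deg_space n m"
      using free_diff_homogeneous zs relations_deg_space by blast
    ultimately have "(free_diff (bv (map snd zs)) - (\<Sum>i<n. diff_summand zs i)) + (\<Sum>i<n. diff_summand zs i)
        \<in> deg_space n m" using fs.subspace_add[OF subspace_deg_space] by blast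
    then show ?thesis by simp
  qed
  then have "\<forall>ds as. homogeneous ds as \<and> length as = n \<and> sum_list ds = Suc m \<longrightarrow> bv as \<in> ?S"
    unfolding all_homogeneous by blast
  then have "homogeneous_basis n (Suc m) \<subseteq> ?S" unfolding homogeneous_basis_def by blast
  moreover have "tensor_relations n \<subseteq> ?S" using free_diff_relations relations_deg_space by blast
  ultimately have "deg_space n (Suc m) \<subseteq> ?S"
    unfolding deg_space_def[of n "Suc m"] by (intro fs.span_minimal[OF _ S]) blast
  then show "v \<in> deg_space n (Suc m) \<Longrightarrow> free_diff v \<in> deg_space n m" by blast
qed

lemma cochain_sum:
  assumes f: "f \<in> cochains n m" and "finite I" and "\<And>i. i \<in> I \<Longrightarrow> v i \<in> deg_space (n + 1) m"
  shows "f (tensor_class (n + 1) (\<Sum>i\<in>I. v i)) = (\<Sum>i\<in>I. f (tensor_class (n + 1) (v i)))"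
  using assms(2,3)
proof (induction I)
  case empty
  show ?case
    using cochain_relation[OF f fs.subspace_0[OF subspace_relations]] by (simp only: sum.empty)
next
  case (insert i I)
  then have mem: "v i \<in> deg_space (n + 1) m" "(\<Sum>i\<in>I. v i) \<in> deg_space (n + 1) m"
    by (auto intro: fs.subspace_sum[OF subspace_deg_space])
  show ?case
    using cochain_add[OF f mem] insert by (simp only: sum.insert insert_iff simp_thms)
qed

lemma delta_class:
  assumes "v \<in> deg_space (n + 1) (m + 1)"
  shows "delta n m f (tensor_class (n + 1) v) = (-1) ^ m * f (tensor_class (n + 1) (free_diff v))"
proof -
  have "tensor_class (n + 1) v \<in> carrier (tensor_deg (n + 1) (m + 1))"
    using assms unfolding carrier_tensor_deg by blast
  moreover have "v \<in> free_space (n + 1)" using assms deg_space_free by blast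
  ultimately show ?thesis using tensor_diff_class[of v "n + 1"] by (simp add: delta_def)
qed

lemma delta_cochain:
  assumes f: "f \<in> cochains n m"
  shows "delta n m f \<in> cochains n (m + 1)"
proof -
  have "delta n m f \<in> linear_hom (tensor_deg (n + 1) (m + 1)) (module_of (*) UNIV)"
  proof (rule presents_linear_hom[OF presents_tensor_deg presents_field])
    show "delta n m f (tensor_class (n + 1) v) = (-1) ^ m * f (tensor_class (n + 1) (free_diff v))"
      if "v \<in> deg_space (n + 1) (m + 1)" for v using that by (rule delta_class)
  qed (use free_diff_deg_space[of _ "n + 1" m] cochain_add[OF f] cochain_scale[OF f] in
      \<open>simp_all add: free_diff_add free_diff_scale distrib_left\<close>)
  then show ?thesis by (simp add: cochains_def delta_def)
qed

lemma val_delta: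
  assumes f: "f \<in> cochains n m" and zs: "graded zs" "length zs = n + 1"
  shows "val (m + 1) (delta n m f) zs = (-1) ^ m * dif zs (val m f)"
proof -
  let ?u = "\<lambda>i. zs[i := (fst (zs ! i) - 1, \<phi> (snd (zs ! i)))]"
  let ?\<kappa> = "tensor_class (n + 1)"
  have hom: "snd (zs ! i) \<in> gr (fst (zs ! i))" if "i < n + 1" for i
    using zs that by (simp add: graded_def)
  have summand: "val m f (?u i) = (if tdeg zs = m + 1 then f (?\<kappa> (bv ((map snd zs)[i := \<phi> (snd (zs ! i))]))) else 0)"
    if i: "i < n + 1" for i
  proof (cases "fst (zs ! i)")
    case 0
    then have "\<phi> (snd (zs ! i)) = 0" using hom[OF i] phi_degree_0 by simp
    then show ?thesis
      using cochain_relation[OF f bv_update_zero[OF i, of "map snd zs"]] zs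
      by (simp add: val_def tens_def map_update)
  next
    case (Suc k)
    then show ?thesis
      using tdeg_update[of i zs k "\<phi> (snd (zs ! i))"] i zs
      by (auto simp: val_def tens_def map_update)
  qed
  have "dif zs (val m f) = (\<Sum>i<n + 1. (-1) ^ tdeg (take i zs) * val m f (?u i))"
    unfolding dif_eq_sum using zs(2) by simp
  also have "\<dots> = (\<Sum>i<n + 1. (-1) ^ tdeg (take i zs) *
      (if tdeg zs = m + 1 then f (?\<kappa> (bv ((map snd zs)[i := \<phi> (snd (zs ! i))]))) else 0))"
    using summand by (intro sum.cong) auto
  finally have dif: "dif zs (val m f) = \<dots>" .
  show ?thesis
  proof (cases "tdeg zs = m + 1")
    case True
    have mem: "bv ((map snd zs)[i := \<phi> (snd (zs ! i))]) \<in> deg_space (n + 1) m" if "i < n + 1" for i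
      using diff_summand_deg_space[OF zs] True that by simp
    have "f (?\<kappa> (free_diff (bv (map snd zs)))) = f (?\<kappa> (\<Sum>i<n + 1. diff_summand zs i))"
      by (rule cochain_congruent[OF f free_diff_homogeneous[OF zs]])
    also have "\<dots> = (\<Sum>i<n + 1. f (?\<kappa> (diff_summand zs i)))"
      using mem unfolding diff_summand_def
      by (intro cochain_sum[OF f] fs.subspace_scale[OF subspace_deg_space]) auto
    also have "\<dots> = dif zs (val m f)"
      unfolding dif diff_summand_def using mem True
      by (intro sum.cong) (auto simp: cochain_scale[OF f, simplified])
    finally show ?thesis
      using delta_class[of "bv (map snd zs)" n m f] bv_deg_space[of zs] zs True
      by (simp add: val_def tens_def)
  next
    case False
    then show ?thesis unfolding dif by (simp add: val_def)
  qed
qed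

subsection \<open>Identities between the operators\<close>

lemma subspace_cochains: "fs.subspace (cochains n m)"
  by (rule fs.subspaceI)
    (auto simp: cochains_def linear_hom_def module_of_def fun_scale_def algebra_simps)

lemma val_add: "val m (f + g) = (\<lambda>zs. val m f zs + val m g zs)"
  and val_scale: "val m (fun_scale c f) = (\<lambda>zs. c * val m f zs)"
  and val_zero: "val m 0 = (\<lambda>zs. 0)"
  by (auto simp: val_def fun_scale_def fun_eq_iff)

lemma cochain_eqI':
  assumes "f \<in> cochains n m" "g \<in> cochains n m"
    and "\<And>zs. graded zs \<Longrightarrow> length zs = n + 1 \<Longrightarrow> val m f zs = val m g zs"
  shows "f = g"
  using cochain_eqI[OF assms(1,2)] assms(3) by blast

lemma hochschild_b_add:
  assumes f: "f \<in> cochains n m" and g: "g \<in> cochains n m"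
  shows "hochschild_b n m (f + g) = hochschild_b n m f + hochschild_b n m g"
proof (rule cochain_eqI'[where n = "n + 1" and m = m])
  have fg: "f + g \<in> cochains n m" using f g by (rule fs.subspace_add[OF subspace_cochains])
  then show "hochschild_b n m (f + g) \<in> cochains (n + 1) m" by (rule hochschild_b_cochain)
  show "hochschild_b n m f + hochschild_b n m g \<in> cochains (n + 1) m"
    by (intro fs.subspace_add[OF subspace_cochains] hochschild_b_cochain f g)
  show "val m (hochschild_b n m (f + g)) zs = val m (hochschild_b n m f + hochschild_b n m g) zs"
    if "graded zs" "length zs = n + 1 + 1" for zs
    using that val_hochschild_b[OF fg] val_hochschild_b[OF f] val_hochschild_b[OF g]
    by (simp add: val_add hoch_add)
qed

lemma hochschild_b_scale:
  assumes f: "f \<in> cochains n m"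
  shows "hochschild_b n m (fun_scale c f) = fun_scale c (hochschild_b n m f)"
proof (rule cochain_eqI'[where n = "n + 1" and m = m])
  have cf: "fun_scale c f \<in> cochains n m" using f by (rule fs.subspace_scale[OF subspace_cochains])
  then show "hochschild_b n m (fun_scale c f) \<in> cochains (n + 1) m" by (rule hochschild_b_cochain)
  show "fun_scale c (hochschild_b n m f) \<in> cochains (n + 1) m"
    by (intro fs.subspace_scale[OF subspace_cochains] hochschild_b_cochain f)
  show "val m (hochschild_b n m (fun_scale c f)) zs = val m (fun_scale c (hochschild_b n m f)) zs"
    if "graded zs" "length zs = n + 1 + 1" for zs
    using that val_hochschild_b[OF cf] val_hochschild_b[OF f] by (simp add: val_scale hoch_cmult)
qed

lemma delta_add: "delta n m (f + g) = delta n m f + delta n m g"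
  and delta_scale: "delta n m (fun_scale c f) = fun_scale c (delta n m f)"
  by (auto simp: delta_def fun_scale_def fun_eq_iff algebra_simps)

lemma hochschild_b_hochschild_b:
  assumes f: "f \<in> cochains n m"
  shows "hochschild_b (n + 1) m (hochschild_b n m f) = 0"
proof (rule cochain_eqI'[where n = "n + 2" and m = m])
  have bf: "hochschild_b n m f \<in> cochains (n + 1) m" by (rule hochschild_b_cochain[OF f])
  show "hochschild_b (n + 1) m (hochschild_b n m f) \<in> cochains (n + 2) m"
    using hochschild_b_cochain[OF bf] by simp
  show "0 \<in> cochains (n + 2) m" by (rule fs.subspace_0[OF subspace_cochains])
  fix zs assume zs: "graded zs" "length zs = n + 2 + 1"
  have "val m (hochschild_b (n + 1) m (hochschild_b n m f)) zs
      = hoch (n + 2) (val m (hochschild_b n m f)) zs"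
    using val_hochschild_b[OF bf, of zs] zs by simp
  also have "\<dots> = hoch (n + 2) (hoch (n + 1) (val m f)) zs"
    using zs val_hochschild_b[OF f] by (intro hoch_cong) auto
  also have "\<dots> = 0" using hoch_hoch[of "n + 1" zs "val m f"] zs by simp
  finally show "val m (hochschild_b (n + 1) m (hochschild_b n m f)) zs = val m 0 zs"
    by (simp add: val_zero)
qed

lemma delta_delta:
  assumes f: "f \<in> cochains n m"
  shows "delta n (m + 1) (delta n m f) = 0"
proof (rule cochain_eqI'[where n = n and m = "m + 2"])
  have df: "delta n m f \<in> cochains n (m + 1)" by (rule delta_cochain[OF f])
  show "delta n (m + 1) (delta n m f) \<in> cochains n (m + 2)" using delta_cochain[OF df] by simp
  show "0 \<in> cochains n (m + 2)" by (rule fs.subspace_0[OF subspace_cochains])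
  fix zs assume zs: "graded zs" "length zs = n + 1"
  have "val (m + 2) (delta n (m + 1) (delta n m f)) zs
      = (-1) ^ (m + 1) * dif zs (val (m + 1) (delta n m f))"
    using val_delta[OF df zs] by simp
  also have "dif zs (val (m + 1) (delta n m f)) = dif zs (\<lambda>ws. (-1) ^ m * dif ws (val m f))"
    using zs val_delta[OF f] by (intro dif_cong) auto
  also have "\<dots> = 0"
    using dif_dif[of zs "val m f"] multilinear_val[OF f] zs by (simp add: dif_cmult)
  finally show "val (m + 2) (delta n (m + 1) (delta n m f)) zs = val (m + 2) 0 zs"
    by (simp add: val_zero)
qed

lemma delta_hochschild_b:
  assumes f: "f \<in> cochains n m"
  shows "delta (n + 1) m (hochschild_b n m f) = hochschild_b n (m + 1) (delta n m f)"
proof (rule cochain_eqI'[where n = "n + 1" and m = "m + 1"])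
  have bf: "hochschild_b n m f \<in> cochains (n + 1) m" by (rule hochschild_b_cochain[OF f])
  have df: "delta n m f \<in> cochains n (m + 1)" by (rule delta_cochain[OF f])
  show "delta (n + 1) m (hochschild_b n m f) \<in> cochains (n + 1) (m + 1)" by (rule delta_cochain[OF bf])
  show "hochschild_b n (m + 1) (delta n m f) \<in> cochains (n + 1) (m + 1)" by (rule hochschild_b_cochain[OF df])
  fix zs assume zs: "graded zs" "length zs = n + 1 + 1"
  have "val (m + 1) (delta (n + 1) m (hochschild_b n m f)) zs
      = (-1) ^ m * dif zs (val m (hochschild_b n m f))" by (rule val_delta[OF bf zs])
  also have "dif zs (val m (hochschild_b n m f)) = dif zs (hoch (n + 1) (val m f))"
    using zs val_hochschild_b[OF f] by (intro dif_cong) auto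
  also have "\<dots> = hoch (n + 1) (\<lambda>ws. dif ws (val m f)) zs"
    using zs multilinear_val[OF f] by (intro dif_hoch) auto
  also have "(-1) ^ m * \<dots> = hoch (n + 1) (\<lambda>ws. (-1) ^ m * dif ws (val m f)) zs"
    by (simp add: hoch_cmult)
  also have "\<dots> = hoch (n + 1) (val (m + 1) (delta n m f)) zs"
    using zs val_delta[OF f] by (intro hoch_cong) auto
  also have "\<dots> = val (m + 1) (hochschild_b n (m + 1) (delta n m f)) zs"
    using val_hochschild_b[OF df, of zs] zs by simp
  finally show "val (m + 1) (delta (n + 1) m (hochschild_b n m f)) zs
      = val (m + 1) (hochschild_b n (m + 1) (delta n m f)) zs" .
qed

text \<open>
  Invariance under \<open>\<Lambda>\<close> in terms of values on homogeneous lists, the form in which \<open>hoch_cyclic\<close> and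
  \<open>dif_cyclic\<close> use it.
\<close>

lemma cyclic_cochains_iff:
  "f \<in> cyclic_cochains n m \<longleftrightarrow> f \<in> cochains n m \<and>
     (\<forall>zs. graded zs \<longrightarrow> length zs = n + 1 \<longrightarrow> val m f zs = (-1) ^ n * (koszul_sign zs * val m f (rot zs)))"
proof (cases "f \<in> cochains n m")
  case True
  have "f \<in> cyclic_cochains n m \<longleftrightarrow> f = cyclic_op n m f" using True by (simp add: cyclic_cochains_def)
  also have "\<dots> \<longleftrightarrow> (\<forall>zs. graded zs \<longrightarrow> length zs = n + 1 \<longrightarrow> val m f zs = val m (cyclic_op n m f) zs)"
    using cochain_eqI'[OF True cyclic_op_cochain[OF True]] by auto
  finally show ?thesis using True val_cyclic_op[OF True] by simp
qed (simp add: cyclic_cochains_def)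

lemma subspace_cyclic_cochains: "fs.subspace (cyclic_cochains n m)"
  using fs.subspace_0[OF subspace_cochains] fs.subspace_add[OF subspace_cochains]
    fs.subspace_scale[OF subspace_cochains]
  by (intro fs.subspaceI) (auto simp: cyclic_cochains_iff val_add val_scale val_zero algebra_simps)

lemma hochschild_b_cyclic:
  assumes f: "f \<in> cyclic_cochains n m"
  shows "hochschild_b n m f \<in> cyclic_cochains (n + 1) m"
  unfolding cyclic_cochains_iff
proof (intro conjI allI impI)
  have c: "f \<in> cochains n m" and cyc: "\<And>zs. graded zs \<Longrightarrow> length zs = n + 1 \<Longrightarrow>
      val m f zs = (-1) ^ n * (koszul_sign zs * val m f (rot zs))"
    using f by (auto simp: cyclic_cochains_iff)
  show "hochschild_b n m f \<in> cochains (n + 1) m" by (rule hochschild_b_cochain[OF c])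
  fix zs assume zs: "graded zs" "length zs = n + 1 + 1"
  then have ne: "zs \<noteq> []" by auto
  have "hoch (n + 1) (val m f) zs = (-1) ^ (n + 1) * (koszul_sign zs * hoch (n + 1) (val m f) (rot zs))"
    using zs cyc by (intro hoch_cyclic) auto
  then show "val m (hochschild_b n m f) zs
      = (-1) ^ (n + 1) * (koszul_sign zs * val m (hochschild_b n m f) (rot zs))"
    using val_hochschild_b[OF c, of zs] val_hochschild_b[OF c, of "rot zs"] zs
      graded_rot[OF zs(1) ne] length_rot[OF ne] by simp
qed

lemma delta_cyclic:
  assumes f: "f \<in> cyclic_cochains n m"
  shows "delta n m f \<in> cyclic_cochains n (m + 1)"
  unfolding cyclic_cochains_iff
proof (intro conjI allI impI)
  have c: "f \<in> cochains n m" and cyc: "\<And>zs. graded zs \<Longrightarrow> length zs = n + 1 \<Longrightarrow>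
      val m f zs = (-1) ^ n * (koszul_sign zs * val m f (rot zs))"
    using f by (auto simp: cyclic_cochains_iff)
  show "delta n m f \<in> cochains n (m + 1)" by (rule delta_cochain[OF c])
  fix zs assume zs: "graded zs" "length zs = n + 1"
  then have ne: "zs \<noteq> []" by auto
  have "dif zs (val m f) = (-1) ^ n * (koszul_sign zs * dif (rot zs) (val m f))"
    using zs cyc multilinear_val[OF c] by (intro dif_cyclic) auto
  then show "val (m + 1) (delta n m f) zs
      = (-1) ^ n * (koszul_sign zs * val (m + 1) (delta n m f) (rot zs))"
    using val_delta[OF c zs] val_delta[OF c, of "rot zs"] zs
      graded_rot[OF zs(1) ne] length_rot[OF ne] by simp
qed

end


section \<open>Total complexes\<close>



definition total_space ::
  "(nat \<Rightarrow> nat \<Rightarrow> ('k::field, 'a) cochain set) \<Rightarrow> int \<Rightarrow> ('k, 'a) total_cochain set" where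
  "total_space C n = {x. (\<forall>p q. x p q \<in> C p q) \<and> (\<forall>p q. int p + int q \<noteq> n \<longrightarrow> x p q = 0)}"

definition total_filtration ::
  "(nat \<Rightarrow> nat \<Rightarrow> ('k::field, 'a) cochain set) \<Rightarrow> int \<Rightarrow> int \<Rightarrow> ('k, 'a) total_cochain set" where
  "total_filtration C s n = {x \<in> total_space C n. \<forall>p q. int p < s \<longrightarrow> x p q = 0}"

context dg_algebra
begin

lemma vector_space_total_scale: "vector_space (total_scale :: 'k \<Rightarrow> ('k, 'a) total_cochain \<Rightarrow> _)"
  by unfold_locales (auto simp: total_scale_def fun_eq_iff algebra_simps)

lemma total_eq: "total C n = module_of total_scale (total_space C n)"
  by (simp add: total_def total_space_def)

lemma vertical_filtration_eq: "vertical_filtration = total_filtration cochains"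
  by (simp add: vertical_filtration_def total_filtration_def total_eq module_of_def fun_eq_iff)

lemma total_scale_apply: "total_scale c x p q = fun_scale c (x p q)"
  by (simp add: total_scale_def fun_scale_def)

lemma hochschild_b_zero: "hochschild_b n m 0 = 0"
  using hochschild_b_scale[OF fs.subspace_0[OF subspace_cochains], of n m 0] by simp

lemma delta_zero: "delta n m 0 = 0"
  using delta_scale[of n m 0 0] by simp

lemma delta_diff: "delta n m (f - g) = delta n m f - delta n m g"
  by (auto simp: delta_def fun_eq_iff algebra_simps)


lemma total_diff_apply:
  "total_diff n x p q =
     (if p = 0 then 0 else hochschild_b (p - 1) q (x (p - 1) q)) +
     (if q = 0 then 0 else fun_scale ((-1) ^ p) (delta p (q - 1) (x p (q - 1))))"
  by (simp add: total_diff_def)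

text \<open>
  In bidegree \<open>(p, q)\<close> the summands \<open>b b\<close> and \<open>\<delta> \<delta>\<close> vanish, and the mixed ones cancel because \<open>b\<close> and \<open>\<delta>\<close>
  commute while the sign of \<open>\<delta>\<close> in \<open>d\<close> changes with \<open>p\<close>.
\<close>

lemma total_diff_total_diff:
  assumes x: "\<And>p q. x p q \<in> cochains p q"
  shows "total_diff n' (total_diff n x) = 0"
proof (intro ext)
  fix p q and U :: "('k, 'a) tensor"
  have "total_diff n' (total_diff n x) p q = 0"
  proof (cases p; cases q)
    fix i j assume p: "p = Suc i" and q: "q = Suc j"
    have bx: "(if i = 0 then 0 else hochschild_b (i - 1) q (x (i - 1) q)) \<in> cochains i q"
      using hochschild_b_cochain[OF x, of "i - 1" q] fs.subspace_0[OF subspace_cochains] by auto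
    have b: "hochschild_b i q (total_diff n x i q)
        = fun_scale ((-1) ^ i) (hochschild_b i q (delta i j (x i j)))"
      using hochschild_b_add[OF bx fs.subspace_scale[OF subspace_cochains delta_cochain[OF x[of i j]], of "(-1) ^ i", unfolded Suc_eq_plus1[symmetric], folded q]]
        hochschild_b_scale[OF delta_cochain[OF x[of i j]], of "(-1) ^ i"]
        hochschild_b_hochschild_b[OF x[of "i - 1" q]]
      by (cases i) (simp_all add: total_diff_apply q hochschild_b_zero)
    have d: "delta p j (total_diff n x p j) = delta p j (hochschild_b i j (x i j))"
      using delta_delta[OF x[of p "j - 1"]]
      by (cases j) (simp_all add: total_diff_apply p delta_add delta_diff delta_scale)
    show ?thesis
      unfolding total_diff_apply[of n' "total_diff n x"] using b d delta_hochschild_b[OF x[of i j]] p q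
      by (simp add: fs.scale_left_distrib[symmetric])
  next
    fix i assume p: "p = Suc i" and q: "q = 0"
    show ?thesis
      using hochschild_b_hochschild_b[OF x[of "i - 1" 0]]
      by (cases i) (simp_all add: total_diff_apply p q hochschild_b_zero)
  next
    fix j assume p: "p = 0" and q: "q = Suc j"
    show ?thesis
      using delta_delta[OF x[of 0 "j - 1"]]
      by (cases j) (simp_all add: total_diff_apply p q delta_zero)
  qed (simp add: total_diff_apply)
  then show "total_diff n' (total_diff n x) p q U = 0 p q U" by simp
qed

text \<open>
  Stated for any family of cochain subspaces that is closed under \<open>b\<close> and \<open>\<delta>\<close>, so that it covers both the
  Hochschild and the cyclic complex.  The filtration is everything at step \<open>0\<close> and zero at step \<open>n + 1\<close>.
\<close>

lemma filtered_complex_total: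
  assumes C: "\<And>p q. C p q \<subseteq> cochains p q" and sub: "\<And>p q. fs.subspace (C p q)"
    and b: "\<And>p q f. f \<in> C p q \<Longrightarrow> hochschild_b p q f \<in> C (p + 1) q"
    and \<delta>: "\<And>p q f. f \<in> C p q \<Longrightarrow> delta p q f \<in> C p (q + 1)"
  shows "filtered_complex total_scale (total_space C) total_diff (total_filtration C)"
proof -
  interpret ts: vector_space "total_scale :: 'k \<Rightarrow> ('k, 'a) total_cochain \<Rightarrow> _"
    by (rule vector_space_total_scale)
  have zero: "0 \<in> C p q" and add: "f \<in> C p q \<Longrightarrow> g \<in> C p q \<Longrightarrow> f + g \<in> C p q"
    and scale: "f \<in> C p q \<Longrightarrow> fun_scale c f \<in> C p q" for p q f g c
    using fs.subspace_0[OF sub] fs.subspace_add[OF sub] fs.subspace_scale[OF sub] by auto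
  have total_C: "x p q \<in> C p q" "x p q \<in> cochains p q" if "x \<in> total_space C n" for x n p q
    using that C[of p q] by (auto simp: total_space_def)
  have total_0: "x p q = 0" if "x \<in> total_space C n" "int p + int q \<noteq> n" for x n p q
    using that by (simp add: total_space_def)
  have diff_C: "total_diff n x \<in> total_space C (n + 1)" if x: "x \<in> total_space C n" for x n
    unfolding total_space_def
  proof (intro CollectI conjI allI impI)
    fix p q
    show "total_diff n x p q \<in> C p q"
      using b[OF total_C(1)[OF x, of "p - 1" q]] \<delta>[OF total_C(1)[OF x, of p "q - 1"]] zero add scale
      by (auto simp: total_diff_apply)
    show "total_diff n x p q = 0" if "int p + int q \<noteq> n + 1"
      using total_0[OF x, of "p - 1" q] total_0[OF x, of p "q - 1"] that
      by (auto simp: total_diff_apply hochschild_b_zero delta_zero of_nat_diff)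
  qed
  show ?thesis
  proof (unfold_locales)
    fix n p :: int
    show "ts.subspace (total_space C n)"
      by (rule ts.subspaceI) (auto simp: total_space_def total_scale_apply zero add scale)
    then show "ts.subspace (total_filtration C p n)"
      using ts.subspace_0 ts.subspace_add ts.subspace_scale
      by (intro ts.subspaceI) (auto simp: total_filtration_def total_scale_apply)
    show "total_filtration C p n \<subseteq> total_space C n" by (auto simp: total_filtration_def)
    show "total_filtration C (p + 1) n \<subseteq> total_filtration C p n" by (auto simp: total_filtration_def)
    show "\<exists>p. total_filtration C p n = total_space C n"
      by (intro exI[of _ 0]) (auto simp: total_filtration_def)
    have "x = 0" if x: "x \<in> total_filtration C (n + 1) n" for x
    proof (intro ext)
      fix p q U
      have "x p q = 0"
        using x by (cases "int p < n + 1") (auto simp: total_filtration_def total_space_def)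
      then show "x p q U = 0 p q U" by simp
    qed
    moreover have "0 \<in> total_filtration C (n + 1) n"
      using zero by (auto simp: total_filtration_def total_space_def)
    ultimately have "total_filtration C (n + 1) n = {0}" by blast
    then show "\<exists>p. total_filtration C p n = {0}" by blast
    fix x assume x: "x \<in> total_space C n"
    show "total_diff n x \<in> total_space C (n + 1)" by (rule diff_C[OF x])
    show "total_diff (n + 1) (total_diff n x) = 0"
      by (rule total_diff_total_diff[OF total_C(2)[OF x]])
    show "total_diff n (total_scale c x) = total_scale c (total_diff n x)" for c
      using hochschild_b_scale[OF total_C(2)[OF x]]
      by (intro ext) (simp add: total_diff_apply total_scale_apply delta_scale fs.scale_right_distrib
          mult.commute)
    fix y assume y: "y \<in> total_space C n"
    show "total_diff n (x + y) = total_diff n x + total_diff n y"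
      using hochschild_b_add[OF total_C(2)[OF x] total_C(2)[OF y]]
      by (intro ext) (simp add: total_diff_apply delta_add fs.scale_right_distrib)
  next
    fix x p n assume x: "x \<in> total_filtration C p n"
    then have "total_diff n x \<in> total_space C (n + 1)" using diff_C by (simp add: total_filtration_def)
    moreover have "total_diff n x i j = 0" if "int i < p" for i j
    proof -
      have "x (i - 1) j = 0" "x i (j - 1) = 0" using x that by (auto simp: total_filtration_def)
      then have "hochschild_b (i - 1) j (x (i - 1) j) = 0" "delta i (j - 1) (x i (j - 1)) = 0"
        by (simp_all only: hochschild_b_zero delta_zero)
      then show ?thesis
        unfolding total_diff_apply by (simp only: fs.scale_zero_right if_cancel add_0_right)
    qed
    ultimately show "total_diff n x \<in> total_filtration C p (n + 1)" by (simp add: total_filtration_def)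
  qed
qed

end

theorem theorem4p7:
  fixes scale :: "'k::field_char_0 \<Rightarrow> 'a::ring \<Rightarrow> 'a"
    and unit :: 'a and gr :: "nat \<Rightarrow> 'a set" and \<phi> :: "'a \<Rightarrow> 'a"
  assumes "dg_algebra scale unit gr \<phi>"
  shows "spectral_sequence (dg_algebra.characteristic_ss scale gr \<phi>) \<and>
    ss_converges_to (dg_algebra.characteristic_ss scale gr \<phi>) (dg_algebra.HH scale gr \<phi>) \<and>
    (\<exists>(E :: ('k, ('k, 'a) total_cochain set) spectral_seq) f.
       spectral_sequence E \<and>
       ss_converges_to E (dg_algebra.HC scale gr \<phi>) \<and>
       ss_morphism E (dg_algebra.characteristic_ss scale gr \<phi>) f)"
proof -
  interpret dg_algebra scale unit gr \<phi> by fact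
  interpret hh: filtered_complex total_scale "total_space cochains" total_diff vertical_filtration
    unfolding vertical_filtration_eq
    by (intro filtered_complex_total subspace_cochains hochschild_b_cochain delta_cochain) simp
  interpret hc: filtered_complex total_scale "total_space cyclic_cochains" total_diff
    "total_filtration cyclic_cochains"
    by (intro filtered_complex_total subspace_cyclic_cochains hochschild_b_cyclic delta_cyclic)
      (simp add: cyclic_cochains_def)

  interpret incl: filtered_complex_hom total_scale "total_space cyclic_cochains" total_diff
    "total_filtration cyclic_cochains" total_scale "total_space cochains" total_diff
    vertical_filtration "\<lambda>_ x. x"
    by unfold_locales
      (auto simp: vertical_filtration_eq total_filtration_def total_space_def cyclic_cochains_def)
  have "hh.M = total cochains" "hc.M = total cyclic_cochains"
    by (simp_all add: fun_eq_iff hh.M_def hc.M_def total_eq)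
  then have "characteristic_ss = hh.E" "HH = hh.H" "HC = hc.H"
    by (simp_all add: characteristic_ss_def HH_def HC_def)
  then show ?thesis
    using hh.spectral_sequence_filtration hh.filtration_ss_converges
      hc.spectral_sequence_filtration hc.filtration_ss_converges incl.ss_morphism_page_map
    by metis
qed

end
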